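(* Let $\theta,\rho\in\mathbb{R}$ with $|\theta|<1$, $|\rho|<1$, let $(V_n)_{n\ge1}$ be a sequence of independent and identically distributed real random variables with zero mean, variance $\sigma^2>0$ and finite moment of order $4$, let the initial values $X_0,\varepsilon_0$ be arbitrary, and for all $n\ge1$ let $X_n=\theta X_{n-1}+\varepsilon_n$ and $\varepsilon_n=\rho\varepsilon_{n-1}+V_n$. Assume that $\theta\neq0$ and $\theta\neq-\rho$. Let $\widehat\theta_n$ and the Durbin-Watson statistic $\widehat D_n$ be as defined in the context. Then, under the null hypothesis $\rho=0$, as $n\to\infty$, $$\frac{n}{4\widehat{\theta}_n^{\,2}}\big(\widehat{D}_n-2\big)^2\longrightarrow\chi^2\quad\text{in distribution},$$ where $\chi^2$ has a Chi-square distribution with one degree of freedom. In addition, under the alternative hypothesis $\rho\neq0$, $$\lim_{n\to\infty}\frac{n}{4\widehat{\theta}_n^{\,2}}\big(\widehat{D}_n-2\big)^2=+\infty\quad\text{almost surely}.$$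
   Context: For $n\ge1$ put $$\widehat{\theta}_n=\frac{\sum_{k=1}^n X_kX_{k-1}}{\sum_{k=1}^n X_{k-1}^2}.$$ At step $n$, the least squares residuals are $\widehat{\varepsilon}_0=X_0$ and $\widehat{\varepsilon}_k=X_k-\widehat{\theta}_nX_{k-1}$ for $1\le k\le n$ (they depend on $n$ through $\widehat\theta_n$). The Durbin-Watson statistic is $$\widehat{D}_n=\frac{\sum_{k=1}^n(\widehat{\varepsilon}_k-\widehat{\varepsilon}_{k-1})^2}{\sum_{k=0}^n\widehat{\varepsilon}_k^{\,2}}.$$ Here $\widehat\theta_n^{\,2}$ is the square of $\widehat\theta_n$. Convention: a quotient is read as $0$ if its denominator vanishes. *)

theory Defs
  imports "HOL-Probability.Probability"
begin

text \<open>The statistics below are functions of a trajectory \<open>x = (x 0, x 1, \<dots>)\<close> and of the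
  sample size \<open>n\<close>.  Division by zero yields \<open>0\<close> in HOL, which is the intended convention for
  quotients with a vanishing denominator.\<close>

definition lse :: "(nat \<Rightarrow> real) \<Rightarrow> nat \<Rightarrow> real" where
  "lse x n = (\<Sum>k=1..n. x k * x (k - 1)) / (\<Sum>k=1..n. (x (k - 1))\<^sup>2)"

definition residual :: "(nat \<Rightarrow> real) \<Rightarrow> nat \<Rightarrow> nat \<Rightarrow> real" where
  "residual x n k = (if k = 0 then x 0 else x k - lse x n * x (k - 1))"

definition durbin_watson :: "(nat \<Rightarrow> real) \<Rightarrow> nat \<Rightarrow> real" where
  "durbin_watson x n =
     (\<Sum>k=1..n. (residual x n k - residual x n (k - 1))\<^sup>2) / (\<Sum>k=0..n. (residual x n k)\<^sup>2)"

text \<open>The chi-square law with \<open>d\<close> degrees of freedom: the law of the sum of the squares of \<open>d\<close>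
  independent standard normal variables.\<close>

definition chi_square :: "nat \<Rightarrow> real measure" where
  "chi_square d =
     distr (PiM {..<d} (\<lambda>_. density lborel std_normal_density)) borel (\<lambda>z. \<Sum>i<d. (z i)\<^sup>2)"

end

theory Submission
  imports Defs
begin

text \<open>
  Eliminating \<open>\<epsilon>\<close> from the model gives the recursion
  \<open>X (k + 2) = (\<theta> + \<rho>) X (k + 1) - \<theta> \<rho> X k + V (k + 2)\<close>. Multiply it by \<open>X (k + 2)\<close>,
  \<open>X (k + 1)\<close> and \<open>X k\<close> and average over \<open>k\<close>. If the noise averages out against the past, this
  is a Yule-Walker system for the empirical autocovariances; its determinant is positive, so they
  converge. Hence the estimator tends to \<open>\<theta>* = (\<theta> + \<rho>) / (1 + \<theta> \<rho>)\<close> and the Durbin-Watson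
  statistic to \<open>2 - 2 \<theta> \<rho> \<theta>*\<close>. For \<open>\<rho> \<noteq> 0\<close> this is not \<open>2\<close>, and the normalised statistic
  grows like a positive multiple of \<open>n\<close>. All of this concerns one trajectory (locale
  \<open>ar2_path\<close>). Probability is needed only to see that almost every trajectory qualifies, and
  that follows from a strong law for orthogonal variables with bounded second moments
  (\<open>strong_law_orthogonal\<close>).

  For \<open>\<rho> = 0\<close> the normal equation of least squares turns \<open>D - 2\<close> into a closed formula
  (\<open>durbin_watson_centred\<close>, \<open>statistic_decomposition\<close>). Up to negligible terms it says that the
  signed square root of the statistic is \<open>n\<^sup>-\<^sup>1\<^sup>/\<^sup>2 \<Sum> V (k + 2) (X k - \<theta> X (k + 1))\<close> divided by
  \<open>\<sigma>\<^sup>2\<close>. The sum is a martingale. The squares of its weights \<open>X k - \<theta> X (k + 1)\<close> average to \<open>\<sigma>\<^sup>2\<close>, so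
  its normalised variance tends to \<open>\<sigma>\<^sup>4\<close>, and the central limit theorem \<open>martingale_clt\<close> yields
  a standard normal limit. Squaring gives the chi-square law.

  The starting values are arbitrary and may even depend on the noise, which would destroy the
  martingale structure. Therefore everything probabilistic is proved for the process started at
  rest; the true process differs from it by a geometrically decaying sequence, which changes
  neither the averages nor the sums normalised by \<open>sqrt n\<close>.
\<close>

section \<open>The statistic along a fixed trajectory of the AR(2) recursion\<close>

definition lag_sum :: "(nat \<Rightarrow> real) \<Rightarrow> nat \<Rightarrow> nat \<Rightarrow> real" where
  "lag_sum x h n = (\<Sum>k<n. x (k + h) * x k)"

lemma lse_eq_lag_sum: "lse x n = lag_sum x 1 n / lag_sum x 0 n"
  by (simp add: lse_def lag_sum_def sum.atLeast1_atMost_eq power2_eq_square)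

lemma sum_shift_add:
  fixes f :: "nat \<Rightarrow> real"
  shows "(\<Sum>k<n. f (Suc k)) = (\<Sum>k<n. f k) + f n - f 0"
  by (induction n) auto

lemma sum_residual_squares:
  "(\<Sum>k=0..n. (residual x n k)\<^sup>2) =
     (x 0)\<^sup>2 + (lag_sum x 0 n + (x n)\<^sup>2 - (x 0)\<^sup>2) - 2 * lse x n * lag_sum x 1 n + (lse x n)\<^sup>2 * lag_sum x 0 n"
proof -
  have "(\<Sum>k=0..n. (residual x n k)\<^sup>2) = (x 0)\<^sup>2 + (\<Sum>k<n. (x (Suc k) - lse x n * x k)\<^sup>2)"
    by (simp add: sum.atLeast0_atMost_Suc_shift atLeast0AtMost sum.atMost_shift residual_def)
  also have "(\<Sum>k<n. (x (Suc k) - lse x n * x k)\<^sup>2)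
      = (\<Sum>k<n. (x (Suc k))\<^sup>2) - 2 * lse x n * (\<Sum>k<n. x (Suc k) * x k) + (lse x n)\<^sup>2 * (\<Sum>k<n. (x k)\<^sup>2)"
    unfolding sum_distrib_left sum_subtractf[symmetric] sum.distrib[symmetric]
    by (rule sum.cong) (auto simp: power2_eq_square algebra_simps)
  also have "(\<Sum>k<n. (x (Suc k))\<^sup>2) = lag_sum x 0 n + (x n)\<^sup>2 - (x 0)\<^sup>2"
    using sum_shift_add[of "\<lambda>k. (x k)\<^sup>2" n] by (simp add: lag_sum_def power2_eq_square)
  finally show ?thesis
    by (simp add: lag_sum_def power2_eq_square)
qed

text \<open>
  The numerator of the statistic is \<open>2 J\<close> up to two boundary squares, minus twice the sum of the
  products of consecutive residuals. Least squares makes the residuals orthogonal to the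
  regressors. In a product of consecutive residuals, substitute the definition of the earlier one:
  its leading term is a regressor of the later one and drops out of the sum, and only the
  regressor two steps back remains, with the factor \<open>- lse x (Suc n)\<close>.
\<close>

lemma durbin_watson_centred:
  fixes x n defines "J \<equiv> \<Sum>k=0..Suc n. (residual x (Suc n) k)\<^sup>2"
  assumes "lag_sum x 0 (Suc n) \<noteq> 0" and J0: "J \<noteq> 0"
  shows "durbin_watson x (Suc n) - 2 =
    (2 * lse x (Suc n) * (\<Sum>k<n. residual x (Suc n) (k + 2) * x k) - (x 0)\<^sup>2 - (residual x (Suc n) (Suc n))\<^sup>2) / J"
proof -
  define r where "r = residual x (Suc n)"
  define q where "q = lse x (Suc n)"
  have "(\<Sum>k<Suc n. r (Suc k) * x k) = lag_sum x 1 (Suc n) - q * lag_sum x 0 (Suc n)"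
    unfolding r_def residual_def lag_sum_def q_def sum_distrib_left sum_subtractf[symmetric]
    by (rule sum.cong) (auto simp: algebra_simps)
  also have "\<dots> = 0"
    using assms(2) by (simp add: q_def lse_eq_lag_sum)
  finally have normal: "(\<Sum>k<Suc n. r (Suc k) * x k) = 0" .
  have "(\<Sum>k<Suc n. r (Suc k) * r k) = r 1 * r 0 + (\<Sum>k<n. r (Suc (Suc k)) * r (Suc k))"
    by (simp add: sum.lessThan_Suc_shift del: sum.lessThan_Suc)
  also have "\<dots> = r 1 * x 0 + (\<Sum>k<n. r (Suc (Suc k)) * x (Suc k)) - q * (\<Sum>k<n. r (Suc (Suc k)) * x k)"
    unfolding sum_distrib_left add_diff_eq[symmetric] sum_subtractf[symmetric]
    by (intro arg_cong2[where f="(+)"] sum.cong) (auto simp: r_def residual_def q_def algebra_simps)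
  also have "r 1 * x 0 + (\<Sum>k<n. r (Suc (Suc k)) * x (Suc k)) = (\<Sum>k<Suc n. r (Suc k) * x k)"
    by (simp add: sum.lessThan_Suc_shift del: sum.lessThan_Suc)
  finally have I: "(\<Sum>k<Suc n. r (Suc k) * r k) = - q * (\<Sum>k<n. r (k + 2) * x k)"
    using normal by simp
  have "(\<Sum>k=1..Suc n. (r k - r (k - 1))\<^sup>2) = (\<Sum>k<Suc n. (r (Suc k) - r k)\<^sup>2)"
    by (rule sum.reindex_bij_witness[of _ Suc "\<lambda>k. k - 1"]) auto
  also have "\<dots> = (\<Sum>k<Suc n. (r (Suc k))\<^sup>2) + (\<Sum>k<Suc n. (r k)\<^sup>2) - 2 * (\<Sum>k<Suc n. r (Suc k) * r k)"
    unfolding sum_distrib_left sum_subtractf[symmetric] sum.distrib[symmetric]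
    by (rule sum.cong) (auto simp: power2_eq_square algebra_simps)
  also have "(\<Sum>k<Suc n. (r (Suc k))\<^sup>2) = (\<Sum>k<Suc n. (r k)\<^sup>2) + (r (Suc n))\<^sup>2 - (r 0)\<^sup>2"
    by (rule sum_shift_add)
  also have "(\<Sum>k<Suc n. (r k)\<^sup>2) = J - (r (Suc n))\<^sup>2"
    by (simp add: J_def r_def atLeast0AtMost lessThan_Suc_atMost[symmetric])
  finally have "(\<Sum>k=1..Suc n. (r k - r (k - 1))\<^sup>2)
      = 2 * J + (2 * q * (\<Sum>k<n. r (k + 2) * x k) - (x 0)\<^sup>2 - (r (Suc n))\<^sup>2)"
    unfolding I by (simp add: r_def residual_def)
  moreover have "(2 * J + y) / J - 2 = y / J" for y
    using J0 by (simp add: add_divide_distrib)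
  ultimately show ?thesis
    by (simp only: durbin_watson_def r_def q_def J_def[symmetric])
qed

text \<open>
  What the argument uses of a single trajectory: the recursion, and noise that behaves on average
  like noise of variance \<open>s\<close> uncorrelated with the two preceding values.
\<close>

locale ar2_path =
  fixes x v :: "nat \<Rightarrow> real" and \<theta> \<rho> s :: real
  assumes stable: "\<bar>\<theta>\<bar> < 1" "\<bar>\<rho>\<bar> < 1"
    and s_pos: "s > 0"
    and rec: "\<And>k. x (k + 2) = (\<theta> + \<rho>) * x (k + 1) - \<theta> * \<rho> * x k + v (k + 2)"
    and noise_var: "(\<lambda>n. (\<Sum>k<n. (v (k + 2))\<^sup>2) / n) \<longlonglongrightarrow> s"
    and noise_lag1: "(\<lambda>n. (\<Sum>k<n. v (k + 2) * x (k + 1)) / n) \<longlonglongrightarrow> 0"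
    and noise_lag2: "(\<lambda>n. (\<Sum>k<n. v (k + 2) * x k) / n) \<longlonglongrightarrow> 0"
    and sq_negligible: "(\<lambda>n. (x n)\<^sup>2 / n) \<longlonglongrightarrow> 0"
begin

text \<open>
  In the stationary AR(2) process with these coefficients and noise variance \<open>s\<close>, \<open>lse_lim\<close> is the
  lag-one autocorrelation and \<open>x_var\<close> the variance.
\<close>

definition "lse_lim = (\<theta> + \<rho>) / (1 + \<theta> * \<rho>)"
definition "x_var = s * (1 + \<theta> * \<rho>) / ((1 - \<theta> * \<rho>) * (1 - \<theta>\<^sup>2) * (1 - \<rho>\<^sup>2))"

lemma prod_bound: "\<bar>\<theta> * \<rho>\<bar> < 1"
  using stable mult_strict_mono'[of "\<bar>\<theta>\<bar>" 1 "\<bar>\<rho>\<bar>" 1] by (simp add: abs_mult)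

lemma sq_bound: "\<theta>\<^sup>2 < 1" "\<rho>\<^sup>2 < 1"
  using stable by (simp_all add: abs_square_less_1)

lemma x_var_pos: "x_var > 0"
  unfolding x_var_def using prod_bound sq_bound s_pos
  by (intro divide_pos_pos mult_pos_pos) auto

lemma lse_lim_sq: "lse_lim\<^sup>2 < 1"
proof -
  have "(1 + \<theta> * \<rho>)\<^sup>2 - (\<theta> + \<rho>)\<^sup>2 = (1 - \<theta>\<^sup>2) * (1 - \<rho>\<^sup>2)"
    by (simp add: power2_eq_square algebra_simps)
  also have "\<dots> > 0"
    using sq_bound by simp
  finally show ?thesis
    unfolding lse_lim_def using prod_bound by (simp add: power_divide divide_simps)
qed

lemma sq_negligible_Suc: "(\<lambda>n. (x (Suc n))\<^sup>2 / n) \<longlonglongrightarrow> 0"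
proof -
  have "(\<lambda>n. (x (Suc n))\<^sup>2 / Suc n * (1 + inverse (real n))) \<longlonglongrightarrow> 0 * (1 + 0)"
    by (intro tendsto_intros LIMSEQ_Suc[OF sq_negligible] lim_inverse_n)
  moreover have "\<forall>\<^sub>F n in sequentially. (x (Suc n))\<^sup>2 / Suc n * (1 + inverse (real n)) = (x (Suc n))\<^sup>2 / n"
    using eventually_gt_at_top[of 0]
  proof eventually_elim
    case (elim n)
    then have "1 + inverse (real n) = real (Suc n) / real n" by (simp add: field_simps)
    then show ?case by simp
  qed
  ultimately show ?thesis
    by (simp add: tendsto_cong)
qed

lemma prod_negligible: "(\<lambda>n. x (Suc n) * x n / n) \<longlonglongrightarrow> 0"
proof (rule Lim_null_comparison[where g="\<lambda>n. (x (Suc n))\<^sup>2 / n + (x n)\<^sup>2 / n"])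
  have "\<bar>x (Suc n) * x n\<bar> \<le> (x (Suc n))\<^sup>2 + (x n)\<^sup>2" for n
  proof -
    have "2 * \<bar>x (Suc n) * x n\<bar> \<le> (x (Suc n))\<^sup>2 + (x n)\<^sup>2"
      using sum_squares_bound[of "\<bar>x (Suc n)\<bar>" "\<bar>x n\<bar>"] by (simp add: abs_mult mult.assoc)
    then show ?thesis by linarith
  qed
  then show "\<forall>\<^sub>F n in sequentially. norm (x (Suc n) * x n / n) \<le> (x (Suc n))\<^sup>2 / n + (x n)\<^sup>2 / n"
    by (auto intro!: always_eventually divide_right_mono simp: add_divide_distrib[symmetric])
  show "(\<lambda>n. (x (Suc n))\<^sup>2 / n + (x n)\<^sup>2 / n) \<longlonglongrightarrow> 0"
    using tendsto_add[OF sq_negligible_Suc sq_negligible] by simp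
qed

text \<open>
  The Yule-Walker equations, up to errors that vanish after division by \<open>n\<close>. Shifting the
  summation index costs only boundary terms, which \<open>sq_negligible\<close> controls. Convergence of the
  empirical autocovariances is not assumed but obtained by solving the linear system.
\<close>

lemma lag_sum_limits:
  shows lag_sum_0: "(\<lambda>n. lag_sum x 0 n / n) \<longlonglongrightarrow> x_var"
    and lag_sum_1: "(\<lambda>n. lag_sum x 1 n / n) \<longlonglongrightarrow> lse_lim * x_var"
    and lag_sum_2: "(\<lambda>n. lag_sum x 2 n / n) \<longlonglongrightarrow> ((\<theta> + \<rho>) * lse_lim - \<theta> * \<rho>) * x_var"
proof -
  define a where "a = \<theta> + \<rho>"
  define b where "b = \<theta> * \<rho>"
  define l0 where "l0 n = lag_sum x 0 n / n" for n
  define l1 where "l1 n = lag_sum x 1 n / n" for n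
  define l2 where "l2 n = lag_sum x 2 n / n" for n
  define r1 where "r1 n = (\<Sum>k<n. v (k + 2) * x (k + 1)) / n" for n
  define r2 where "r2 n = (\<Sum>k<n. v (k + 2) * x k) / n" for n
  define sv where "sv n = (\<Sum>k<n. (v (k + 2))\<^sup>2) / n" for n
  note rs = noise_lag1[folded r1_def] noise_lag2[folded r2_def] noise_var[folded sv_def]
  have rec': "x (Suc (Suc k)) = a * x (Suc k) - b * x k + v (Suc (Suc k))" for k
    using rec[of k] by (simp add: a_def b_def)
  have b: "1 + b > 0" "1 - b > 0"
    using prod_bound by (auto simp: b_def)
  have sq1: "(\<Sum>k<n. (x (Suc k))\<^sup>2) = lag_sum x 0 n + (x n)\<^sup>2 - (x 0)\<^sup>2" for n
    using sum_shift_add[of "\<lambda>k. (x k)\<^sup>2" n] by (simp add: lag_sum_def power2_eq_square)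
  have sq2: "(\<Sum>k<n. (x (Suc (Suc k)))\<^sup>2) = lag_sum x 0 n + (x n)\<^sup>2 - (x 0)\<^sup>2 + (x (Suc n))\<^sup>2 - (x 1)\<^sup>2" for n
    using sum_shift_add[of "\<lambda>k. (x (Suc k))\<^sup>2" n] by (simp add: sq1)
  have pr: "(\<Sum>k<n. x (Suc (Suc k)) * x (Suc k)) = lag_sum x 1 n + x (Suc n) * x n - x 1 * x 0" for n
    using sum_shift_add[of "\<lambda>k. x (Suc k) * x k" n] by (simp add: lag_sum_def)
  have e1: "(\<lambda>n. (1 + b) * l1 n - a * l0 n) \<longlonglongrightarrow> 0"
  proof -
    have "(\<Sum>k<n. x (Suc (Suc k)) * x (Suc k)) = a * (\<Sum>k<n. (x (Suc k))\<^sup>2) - b * lag_sum x 1 n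
        + (\<Sum>k<n. v (k + 2) * x (k + 1))" for n
      unfolding lag_sum_def sum_distrib_left sum_subtractf[symmetric] sum.distrib[symmetric]
      by (rule sum.cong) (auto simp: rec' power2_eq_square algebra_simps)
    then have "(1 + b) * lag_sum x 1 n - a * lag_sum x 0 n =
       a * ((x n)\<^sup>2 - (x 0)\<^sup>2) - (x (Suc n) * x n - x 1 * x 0) + (\<Sum>k<n. v (k + 2) * x (k + 1))" for n
      unfolding pr sq1 by (simp add: algebra_simps)
    from this[THEN arg_cong[where f="\<lambda>y. y / real _"]]
    have "(1 + b) * l1 n - a * l0 n = a * ((x n)\<^sup>2 / n - (x 0)\<^sup>2 / n) - (x (Suc n) * x n / n - x 1 * x 0 / n) + r1 n" for n
      by (simp add: l1_def l0_def r1_def add_divide_distrib diff_divide_distrib right_diff_distrib)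
    moreover have "(\<lambda>n. a * ((x n)\<^sup>2 / n - (x 0)\<^sup>2 / n) - (x (Suc n) * x n / n - x 1 * x 0 / n) + r1 n)
        \<longlonglongrightarrow> a * (0 - 0) - (0 - 0) + 0"
      by (intro tendsto_intros sq_negligible prod_negligible lim_const_over_n rs)
    ultimately show ?thesis by simp
  qed
  have e2: "l2 n = a * l1 n - b * l0 n + r2 n" for n
  proof -
    have "lag_sum x 2 n = a * lag_sum x 1 n - b * lag_sum x 0 n + (\<Sum>k<n. v (k + 2) * x k)"
      unfolding lag_sum_def sum_distrib_left sum_subtractf[symmetric] sum.distrib[symmetric]
      by (rule sum.cong) (auto simp: rec' power2_eq_square algebra_simps)
    then show ?thesis
      by (simp add: l2_def l1_def l0_def r2_def add_divide_distrib diff_divide_distrib)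
  qed
  have e3: "(\<lambda>n. l0 n - a * l1 n + b * l2 n - sv n) \<longlonglongrightarrow> 0"
  proof -
    have "(\<Sum>k<n. (x (Suc (Suc k)))\<^sup>2) = a * (\<Sum>k<n. x (Suc (Suc k)) * x (Suc k)) - b * lag_sum x 2 n
        + (a * (\<Sum>k<n. v (k + 2) * x (k + 1)) - b * (\<Sum>k<n. v (k + 2) * x k) + (\<Sum>k<n. (v (k + 2))\<^sup>2))" for n
      unfolding lag_sum_def sum_distrib_left sum_subtractf[symmetric] sum.distrib[symmetric]
      by (rule sum.cong) (auto simp: rec' power2_eq_square algebra_simps)
    then have "lag_sum x 0 n - a * lag_sum x 1 n + b * lag_sum x 2 n - (\<Sum>k<n. (v (k + 2))\<^sup>2) =
       a * (x (Suc n) * x n - x 1 * x 0) - ((x n)\<^sup>2 - (x 0)\<^sup>2 + (x (Suc n))\<^sup>2 - (x 1)\<^sup>2)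
        + a * (\<Sum>k<n. v (k + 2) * x (k + 1)) - b * (\<Sum>k<n. v (k + 2) * x k)" for n
      unfolding pr sq2 by (simp add: algebra_simps)
    from this[THEN arg_cong[where f="\<lambda>y. y / real _"]]
    have "l0 n - a * l1 n + b * l2 n - sv n =
       a * (x (Suc n) * x n / n - x 1 * x 0 / n) - ((x n)\<^sup>2 / n - (x 0)\<^sup>2 / n + (x (Suc n))\<^sup>2 / n - (x 1)\<^sup>2 / n)
       + a * r1 n - b * r2 n" for n
      by (simp add: l2_def l1_def l0_def r1_def r2_def sv_def add_divide_distrib diff_divide_distrib right_diff_distrib)
    moreover have "(\<lambda>n. a * (x (Suc n) * x n / n - x 1 * x 0 / n) - ((x n)\<^sup>2 / n - (x 0)\<^sup>2 / n + (x (Suc n))\<^sup>2 / n - (x 1)\<^sup>2 / n)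
       + a * r1 n - b * r2 n) \<longlonglongrightarrow> a * (0 - 0) - (0 - 0 + 0 - 0) + a * 0 - b * 0"
      by (intro tendsto_intros sq_negligible sq_negligible_Suc prod_negligible lim_const_over_n rs)
    ultimately show ?thesis by simp
  qed
  (* Eliminating l1 and l2 leaves a multiple \<kappa> of l0. In terms of \<theta> and \<rho> it factors into
     positive terms, which is where both stability conditions enter. *)
  define \<kappa> where "\<kappa> = (1 - b) * ((1 + b)\<^sup>2 - a\<^sup>2)"
  have \<kappa>: "\<kappa> = (1 - \<theta> * \<rho>) * (1 - \<theta>\<^sup>2) * (1 - \<rho>\<^sup>2)"
    by (simp add: \<kappa>_def a_def b_def power2_eq_square algebra_simps)
  then have "\<kappa> > 0"
    using prod_bound sq_bound by simp
  have "l0 n = ((1 + b) * (l0 n - a * l1 n + b * l2 n - sv n) + (1 + b) * sv n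
       + a * (1 - b) * ((1 + b) * l1 n - a * l0 n) - b * (1 + b) * r2 n) / \<kappa>" for n
    using \<open>\<kappa> > 0\<close> by (simp add: field_simps e2) (simp add: \<kappa>_def power2_eq_square algebra_simps)
  moreover have "(\<lambda>n. ((1 + b) * (l0 n - a * l1 n + b * l2 n - sv n) + (1 + b) * sv n
       + a * (1 - b) * ((1 + b) * l1 n - a * l0 n) - b * (1 + b) * r2 n) / \<kappa>)
     \<longlonglongrightarrow> ((1 + b) * 0 + (1 + b) * s + a * (1 - b) * 0 - b * (1 + b) * 0) / \<kappa>"
    by (intro tendsto_intros e1 e3 rs) (use \<open>\<kappa> > 0\<close> in simp)
  ultimately have l0: "l0 \<longlonglongrightarrow> x_var"
    by (simp add: x_var_def \<kappa> b_def mult.commute)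
  have "(\<lambda>n. (((1 + b) * l1 n - a * l0 n) + a * l0 n) / (1 + b)) \<longlonglongrightarrow> (0 + a * x_var) / (1 + b)"
    by (intro tendsto_intros e1 l0) (use b in simp)
  moreover have "(((1 + b) * l1 n - a * l0 n) + a * l0 n) / (1 + b) = l1 n" for n
    using b by simp
  ultimately have l1: "l1 \<longlonglongrightarrow> lse_lim * x_var"
    by (simp add: lse_lim_def a_def b_def)
  have "(\<lambda>n. a * l1 n - b * l0 n + r2 n) \<longlonglongrightarrow> a * (lse_lim * x_var) - b * x_var + 0"
    by (intro tendsto_intros l0 l1 rs)
  then have "l2 \<longlonglongrightarrow> (a * lse_lim - b) * x_var"
    by (simp add: e2[abs_def] algebra_simps)
  with l0 l1 show "(\<lambda>n. lag_sum x 0 n / n) \<longlonglongrightarrow> x_var" "(\<lambda>n. lag_sum x 1 n / n) \<longlonglongrightarrow> lse_lim * x_var"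
     "(\<lambda>n. lag_sum x 2 n / n) \<longlonglongrightarrow> ((\<theta> + \<rho>) * lse_lim - \<theta> * \<rho>) * x_var"
    by (simp_all add: l0_def[abs_def] l1_def[abs_def] l2_def[abs_def] a_def b_def)
qed

lemma lag_sum_0_nonzero: "\<forall>\<^sub>F n in sequentially. lag_sum x 0 n \<noteq> 0"
  using order_tendstoD(1)[OF lag_sum_0 x_var_pos] by eventually_elim auto

lemma lse_tendsto: "lse x \<longlonglongrightarrow> lse_lim"
proof -
  have "(\<lambda>n. (lag_sum x 1 n / n) / (lag_sum x 0 n / n)) \<longlonglongrightarrow> (lse_lim * x_var) / x_var"
    by (intro tendsto_intros lag_sum_0 lag_sum_1) (use x_var_pos in simp)
  moreover have "\<forall>\<^sub>F n in sequentially. (lag_sum x 1 n / n) / (lag_sum x 0 n / n) = lse x n"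
    using eventually_gt_at_top[of 0] by eventually_elim (simp add: lse_eq_lag_sum)
  ultimately show ?thesis
    using x_var_pos by (simp add: tendsto_cong)
qed

lemma residual_var_tendsto: "(\<lambda>n. (\<Sum>k=0..n. (residual x n k)\<^sup>2) / n) \<longlonglongrightarrow> x_var * (1 - lse_lim\<^sup>2)"
proof -
  have "(\<lambda>n. lag_sum x 0 n / n + (x n)\<^sup>2 / n - 2 * lse x n * (lag_sum x 1 n / n) + (lse x n)\<^sup>2 * (lag_sum x 0 n / n))
     \<longlonglongrightarrow> x_var + 0 - 2 * lse_lim * (lse_lim * x_var) + lse_lim\<^sup>2 * x_var"
    by (intro tendsto_intros lag_sum_0 lag_sum_1 lse_tendsto sq_negligible)
  moreover have "x_var + 0 - 2 * lse_lim * (lse_lim * x_var) + lse_lim\<^sup>2 * x_var = x_var * (1 - lse_lim\<^sup>2)"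
    by (simp add: power2_eq_square algebra_simps)
  ultimately show ?thesis
    unfolding sum_residual_squares by (simp add: add_divide_distrib diff_divide_distrib mult.assoc)
qed

lemma residual_var_pos: "x_var * (1 - lse_lim\<^sup>2) > 0"
  using x_var_pos lse_lim_sq by simp

lemma residual_sum_nonzero: "\<forall>\<^sub>F n in sequentially. (\<Sum>k=0..n. (residual x n k)\<^sup>2) \<noteq> 0"
  using order_tendstoD(1)[OF residual_var_tendsto residual_var_pos] by eventually_elim auto

lemma last_residual_negligible: "(\<lambda>n. (residual x n n)\<^sup>2 / n) \<longlonglongrightarrow> 0"
proof (rule LIMSEQ_imp_Suc)
  have "(\<lambda>n. ((x (Suc n))\<^sup>2 / Suc n - 2 * lse x (Suc n) * (x (Suc n) * x n / n * (n / Suc n))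
        + (lse x (Suc n))\<^sup>2 * ((x n)\<^sup>2 / n * (n / Suc n)))) \<longlonglongrightarrow>
        0 - 2 * lse_lim * (0 * 1) + lse_lim\<^sup>2 * (0 * 1)"
    by (intro tendsto_intros LIMSEQ_Suc[OF sq_negligible] LIMSEQ_Suc[OF lse_tendsto] sq_negligible prod_negligible LIMSEQ_n_over_Suc_n)
  moreover have "\<forall>\<^sub>F n in sequentially. (x (Suc n))\<^sup>2 / Suc n - 2 * lse x (Suc n) * (x (Suc n) * x n / n * (n / Suc n))
        + (lse x (Suc n))\<^sup>2 * ((x n)\<^sup>2 / n * (n / Suc n)) = (residual x (Suc n) (Suc n))\<^sup>2 / Suc n"
    using eventually_gt_at_top[of 0]
  proof eventually_elim
    case (elim n)
    have "A\<^sup>2 / m - 2 * q * (A * B / N * (N / m)) + q\<^sup>2 * (B\<^sup>2 / N * (N / m)) = (A - q * B)\<^sup>2 / m"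
      if "N \<noteq> 0" "m \<noteq> 0" for A B q N m :: real
      using that by (simp add: divide_simps) (simp add: power2_eq_square algebra_simps)
    from this[of "real n" "real (Suc n)"] elim show ?case
      by (simp add: residual_def)
  qed
  ultimately show "(\<lambda>n. (residual x (Suc n) (Suc n))\<^sup>2 / real (Suc n)) \<longlonglongrightarrow> 0"
    by (simp add: tendsto_cong)
qed

text \<open>
  By \<open>durbin_watson_centred\<close> the limit is determined by the autocovariances at lags one and two.
  The factor \<open>1 - lse_lim\<^sup>2\<close> cancels against the limit of the residual variance because
  \<open>\<theta> + \<rho> = lse_lim * (1 + \<theta> * \<rho>)\<close>.
\<close>

lemma durbin_watson_tendsto: "durbin_watson x \<longlonglongrightarrow> 2 - 2 * \<theta> * \<rho> * lse_lim"
proof -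
  let ?J = "\<lambda>n. \<Sum>k=0..n. (residual x n k)\<^sup>2"
  have lim: "(\<lambda>n. (2 * lse x (Suc n) * ((lag_sum x 2 n / n) * (n / Suc n) - lse x (Suc n) * (lag_sum x 1 n / n) * (n / Suc n))
       - (x 0)\<^sup>2 / Suc n - (residual x (Suc n) (Suc n))\<^sup>2 / Suc n) / (?J (Suc n) / Suc n))
     \<longlonglongrightarrow> (2 * lse_lim * (((\<theta> + \<rho>) * lse_lim - \<theta> * \<rho>) * x_var * 1 - lse_lim * (lse_lim * x_var) * 1) - 0 - 0) / (x_var * (1 - lse_lim\<^sup>2))"
    by (intro tendsto_intros LIMSEQ_Suc[OF lse_tendsto] lag_sum_1 lag_sum_2 LIMSEQ_n_over_Suc_n
        LIMSEQ_Suc[OF last_residual_negligible] LIMSEQ_Suc[OF lim_const_over_n] LIMSEQ_Suc[OF residual_var_tendsto])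
      (use x_var_pos lse_lim_sq in auto)
  have "\<forall>\<^sub>F n in sequentially. (2 * lse x (Suc n) * ((lag_sum x 2 n / n) * (n / Suc n) - lse x (Suc n) * (lag_sum x 1 n / n) * (n / Suc n))
       - (x 0)\<^sup>2 / Suc n - (residual x (Suc n) (Suc n))\<^sup>2 / Suc n) / (?J (Suc n) / Suc n) = durbin_watson x (Suc n) - 2"
    using eventually_gt_at_top[of 0] eventually_sequentially_Suc[THEN iffD2, OF lag_sum_0_nonzero]
      eventually_sequentially_Suc[THEN iffD2, OF residual_sum_nonzero]
  proof eventually_elim
    case (elim n)
    define q where "q = lse x (Suc n)"
    have "(\<Sum>k<n. residual x (Suc n) (k + 2) * x k) = lag_sum x 2 n - q * lag_sum x 1 n"
      unfolding lag_sum_def q_def sum_distrib_left sum_subtractf[symmetric]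
      by (rule sum.cong) (auto simp: residual_def algebra_simps)
    moreover have "(2 * q * ((L2 / N) * (N / m) - q * (L1 / N) * (N / m)) - c / m - d / m) / (J / m)
        = (2 * q * (L2 - q * L1) - c - d) / J" if "N \<noteq> 0" "m \<noteq> 0" for L1 L2 N m c d J :: real
      using that by (cases "J = 0") (simp_all add: field_simps)
    note this[of "real n" "real (Suc n)"]
    ultimately show ?case
      using elim(1) unfolding durbin_watson_centred[OF elim(2,3)] q_def[symmetric]
      by simp
  qed
  with lim have dw: "(\<lambda>n. durbin_watson x (Suc n) - 2) \<longlonglongrightarrow>
     (2 * lse_lim * (((\<theta> + \<rho>) * lse_lim - \<theta> * \<rho>) * x_var * 1 - lse_lim * (lse_lim * x_var) * 1) - 0 - 0) / (x_var * (1 - lse_lim\<^sup>2))"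
    by (simp add: tendsto_cong)
  have "\<theta> + \<rho> = lse_lim * (1 + \<theta> * \<rho>)"
    using prod_bound by (simp add: lse_lim_def)
  then have "2 * lse_lim * (((\<theta> + \<rho>) * lse_lim - \<theta> * \<rho>) * x_var * 1 - lse_lim * (lse_lim * x_var) * 1) - 0 - 0
      = - (2 * \<theta> * \<rho> * lse_lim) * (x_var * (1 - lse_lim\<^sup>2))"
    by (simp only:) (simp add: power2_eq_square algebra_simps)
  then have "(2 * lse_lim * (((\<theta> + \<rho>) * lse_lim - \<theta> * \<rho>) * x_var * 1 - lse_lim * (lse_lim * x_var) * 1) - 0 - 0) / (x_var * (1 - lse_lim\<^sup>2))
      = - (2 * \<theta> * \<rho> * lse_lim)"
    using residual_var_pos by (simp only:) (metis less_irrefl nonzero_mult_div_cancel_right)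
  with dw have "(\<lambda>n. durbin_watson x (Suc n) - 2) \<longlonglongrightarrow> - (2 * \<theta> * \<rho> * lse_lim)"
    by (simp only:)
  from tendsto_add[OF this tendsto_const[of 2]] have "(\<lambda>n. durbin_watson x (Suc n)) \<longlonglongrightarrow> 2 - 2 * \<theta> * \<rho> * lse_lim"
    by simp
  then show ?thesis
    by (rule LIMSEQ_imp_Suc)
qed

lemma statistic_diverges:
  assumes "\<theta> \<noteq> 0" "\<rho> \<noteq> 0" "\<theta> \<noteq> - \<rho>"
  shows "filterlim (\<lambda>n. real n / (4 * (lse x n)\<^sup>2) * (durbin_watson x n - 2)\<^sup>2) at_top sequentially"
proof -
  have L: "lse_lim \<noteq> 0"
    using assms prod_bound by (auto simp: lse_lim_def)
  have "(\<lambda>n. (durbin_watson x n - 2)\<^sup>2 / (4 * (lse x n)\<^sup>2)) \<longlonglongrightarrow>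
      (2 - 2 * \<theta> * \<rho> * lse_lim - 2)\<^sup>2 / (4 * lse_lim\<^sup>2)"
    by (intro tendsto_intros durbin_watson_tendsto lse_tendsto) (use L in simp)
  moreover have "(2 - 2 * \<theta> * \<rho> * lse_lim - 2)\<^sup>2 / (4 * lse_lim\<^sup>2) > 0"
    using L assms by simp
  ultimately have "filterlim (\<lambda>n. (durbin_watson x n - 2)\<^sup>2 / (4 * (lse x n)\<^sup>2) * real n) at_top sequentially"
    by (intro filterlim_tendsto_pos_mult_at_top filterlim_real_sequentially)
  then show ?thesis
    by (simp add: mult.commute)
qed

lemma white_noise_limits:
  assumes "\<rho> = 0"
  shows "lse_lim = \<theta>" "x_var * (1 - \<theta>\<^sup>2) = s"
  using sq_bound unfolding lse_lim_def x_var_def by (simp_all add: assms)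

text \<open>
  The terms are squared residuals of the regression run backwards in time. A stationary
  autoregression of order one is reversible in its second moments, so their average has the same
  limit \<open>s\<close> as that of the squared noise.
\<close>

lemma score_var_tendsto:
  assumes \<rho>: "\<rho> = 0"
  shows "(\<lambda>n. (\<Sum>k<n. (x k - \<theta> * x (k + 1))\<^sup>2) / n) \<longlonglongrightarrow> s"
proof -
  have "(\<Sum>k<n. (x k - \<theta> * x (k + 1))\<^sup>2) =
      lag_sum x 0 n - 2 * \<theta> * lag_sum x 1 n + \<theta>\<^sup>2 * (\<Sum>k<n. (x (Suc k))\<^sup>2)" for n
    unfolding lag_sum_def sum_distrib_left sum_subtractf[symmetric] sum.distrib[symmetric]
    by (rule sum.cong) (auto simp: power2_eq_square algebra_simps)
  note sq = this
  have eq: "(\<Sum>k<n. (x k - \<theta> * x (k + 1))\<^sup>2) / n = lag_sum x 0 n / n - 2 * \<theta> * (lag_sum x 1 n / n)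
      + \<theta>\<^sup>2 * (lag_sum x 0 n / n + (x n)\<^sup>2 / n - (x 0)\<^sup>2 / n)" for n
  proof -
    have "(\<Sum>k<n. (x (Suc k))\<^sup>2) = lag_sum x 0 n + (x n)\<^sup>2 - (x 0)\<^sup>2"
      using sum_shift_add[of "\<lambda>k. (x k)\<^sup>2" n] by (simp add: lag_sum_def power2_eq_square)
    moreover have "(A - c * B + d * (A + y - z)) / m = A / m - c * (B / m) + d * (A / m + y / m - z / m)"
      for A B c d y z m :: real
      by (simp add: divide_inverse algebra_simps)
    ultimately show ?thesis
      unfolding sq by (simp only:)
  qed
  have "(\<lambda>n. lag_sum x 0 n / n - 2 * \<theta> * (lag_sum x 1 n / n)
      + \<theta>\<^sup>2 * (lag_sum x 0 n / n + (x n)\<^sup>2 / n - (x 0)\<^sup>2 / n))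
    \<longlonglongrightarrow> x_var - 2 * \<theta> * (lse_lim * x_var) + \<theta>\<^sup>2 * (x_var + 0 - 0)"
    by (intro tendsto_intros lag_sum_0 lag_sum_1 sq_negligible lim_const_over_n)
  moreover have "x_var - 2 * \<theta> * (lse_lim * x_var) + \<theta>\<^sup>2 * (x_var + 0 - 0) = s"
  proof -
    have "x_var - 2 * \<theta> * (\<theta> * x_var) + \<theta>\<^sup>2 * (x_var + 0 - 0) = x_var * (1 - \<theta>\<^sup>2)"
      by (simp add: power2_eq_square algebra_simps)
    then show ?thesis
      by (simp only: white_noise_limits[OF \<rho>])
  qed
  ultimately show ?thesis
    unfolding eq by simp
qed

text \<open>
  For \<open>\<rho> = 0\<close> the residuals are \<open>v (k + 2) - (h - \<theta>) x (k + 1)\<close>, where the estimation error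
  \<open>h - \<theta>\<close> is itself the noise sum at lag one divided by the sum of squares. Since \<open>q\<close> tends to
  \<open>\<theta>\<close>, only the first sum contributes to the limit law; the noise sum at lag one has been split
  off with the weight \<open>\<theta> - q\<close> for this purpose.
\<close>

lemma statistic_decomposition:
  fixes n
  defines "h \<equiv> lse x (Suc n)" and "J \<equiv> \<Sum>k=0..Suc n. (residual x (Suc n) k)\<^sup>2"
    and "q \<equiv> lag_sum x 1 n / lag_sum x 0 (Suc n)"
  assumes \<rho>: "\<rho> = 0" and S: "lag_sum x 0 (Suc n) \<noteq> 0" and J: "J \<noteq> 0" and h: "h \<noteq> 0"
  shows "sqrt (Suc n) * (durbin_watson x (Suc n) - 2) / (2 * h) = sqrt (Suc n) / J *
    ((\<Sum>k<n. v (k + 2) * (x k - \<theta> * x (k + 1))) + (\<theta> - q) * (\<Sum>k<n. v (k + 2) * x (k + 1))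
      - q * ((x 1 - \<theta> * x 0) * x 0) - ((x 0)\<^sup>2 + (residual x (Suc n) (Suc n))\<^sup>2) / (2 * h))"
proof -
  define N where "N = (\<Sum>k<n. v (k + 2) * (x k - \<theta> * x (k + 1)))"
  define R where "R = (\<Sum>k<n. v (k + 2) * x (k + 1))"
  define c where "c = (x 1 - \<theta> * x 0) * x 0"
  have step: "x (Suc (Suc k)) - \<theta> * x (Suc k) = v (Suc (Suc k))" for k
    using rec[of k] \<rho> by simp
  have "lag_sum x 1 (Suc n) - \<theta> * lag_sum x 0 (Suc n) = (\<Sum>k<Suc n. (x (Suc k) - \<theta> * x k) * x k)"
    unfolding lag_sum_def sum_distrib_left sum_subtractf[symmetric]
    by (rule sum.cong) (auto simp: algebra_simps)
  also have "\<dots> = c + R"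
    by (simp add: sum.lessThan_Suc_shift step c_def R_def del: sum.lessThan_Suc)
  finally have err: "h - \<theta> = (c + R) / lag_sum x 0 (Suc n)"
    using S by (simp add: h_def lse_eq_lag_sum divide_simps)
  have "(\<Sum>k<n. residual x (Suc n) (k + 2) * x k) = N + \<theta> * R - (h - \<theta>) * lag_sum x 1 n"
    unfolding N_def R_def lag_sum_def sum_distrib_left sum_subtractf[symmetric] sum.distrib[symmetric]
    by (rule sum.cong) (auto simp: residual_def h_def algebra_simps simp flip: step)
  also have "(h - \<theta>) * lag_sum x 1 n = q * (c + R)"
    by (simp add: err q_def)
  finally have I: "(\<Sum>k<n. residual x (Suc n) (k + 2) * x k) = N + (\<theta> - q) * R - q * c"
    by (simp add: algebra_simps)
  define e where "e = residual x (Suc n) (Suc n)"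
  have "sqrt (Suc n) * ((2 * h * Y - (x 0)\<^sup>2 - e\<^sup>2) / J) / (2 * h) = sqrt (Suc n) / J * (Y - ((x 0)\<^sup>2 + e\<^sup>2) / (2 * h))" for Y
  proof -
    have "(2 * h * Y - (x 0)\<^sup>2 - e\<^sup>2) / (2 * h) = Y - ((x 0)\<^sup>2 + e\<^sup>2) / (2 * h)"
      using h by (simp add: diff_divide_distrib add_divide_distrib)
    then have "sqrt (Suc n) / J * ((2 * h * Y - (x 0)\<^sup>2 - e\<^sup>2) / (2 * h)) = sqrt (Suc n) / J * (Y - ((x 0)\<^sup>2 + e\<^sup>2) / (2 * h))"
      by (rule arg_cong)
    then show ?thesis
      by (simp only: times_divide_eq_right times_divide_eq_left divide_divide_eq_left mult.commute mult.left_commute)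
  qed
  from this[of "N + (\<theta> - q) * R - q * c"] show ?thesis
    unfolding durbin_watson_centred[OF S J[unfolded J_def]] I[unfolded h_def] h_def[symmetric] J_def[symmetric]
      N_def[symmetric] R_def[symmetric] c_def[symmetric] e_def[symmetric] I .
qed

end

section \<open>A strong law for orthogonal sequences\<close>

text \<open>
  By monotone convergence the series itself is integrable, hence finite almost everywhere, and its
  terms tend to zero there.
\<close>

lemma AE_tendsto_zero_if_summable_integrals:
  fixes f :: "nat \<Rightarrow> 'a \<Rightarrow> real"
  assumes int: "\<And>n. integrable M (f n)" and nonneg: "\<And>n x. 0 \<le> f n x"
    and summable: "summable (\<lambda>n. \<integral>x. f n x \<partial>M)"
  shows "AE x in M. (\<lambda>n. f n x) \<longlonglongrightarrow> 0"
proof -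
  have [measurable]: "f n \<in> borel_measurable M" for n
    by (rule borel_measurable_integrable[OF int])
  have eq: "(\<integral>\<^sup>+x. ennreal (f n x) \<partial>M) = ennreal (\<integral>x. f n x \<partial>M)" for n
    by (rule nn_integral_eq_integral[OF int]) (simp add: nonneg)
  have "(\<integral>\<^sup>+x. (\<Sum>n. ennreal (f n x)) \<partial>M) = (\<Sum>n. \<integral>\<^sup>+x. ennreal (f n x) \<partial>M)"
    by (rule nn_integral_suminf) simp
  also have "\<dots> = (\<Sum>n. ennreal (\<integral>x. f n x \<partial>M))"
    by (simp only: eq)
  finally have sum_eq: "(\<integral>\<^sup>+x. (\<Sum>n. ennreal (f n x)) \<partial>M) = (\<Sum>n. ennreal (\<integral>x. f n x \<partial>M))" .
  have "(\<Sum>n. ennreal (\<integral>x. f n x \<partial>M)) \<noteq> \<infinity>"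
    unfolding infinity_ennreal_def
    by (rule ennreal_suminf_neq_top[OF summable]) (rule Bochner_Integration.integral_nonneg, rule nonneg)
  then have "AE x in M. (\<Sum>n. ennreal (f n x)) \<noteq> \<infinity>"
    by (intro nn_integral_PInf_AE) (simp_all add: sum_eq)
  then show ?thesis
  proof eventually_elim
    case (elim x)
    then have "summable (\<lambda>n. f n x)"
      using nonneg by (intro summable_suminf_not_top) auto
    then show ?case
      by (rule summable_LIMSEQ_zero)
  qed
qed

lemma integrable_mult_if_squares:
  fixes f g :: "'a \<Rightarrow> real"
  assumes [measurable]: "f \<in> borel_measurable M" "g \<in> borel_measurable M"
    and "integrable M (\<lambda>x. (f x)\<^sup>2)" "integrable M (\<lambda>x. (g x)\<^sup>2)"
  shows "integrable M (\<lambda>x. f x * g x)"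
proof (rule Bochner_Integration.integrable_bound)
  show "integrable M (\<lambda>x. (f x)\<^sup>2 + (g x)\<^sup>2)"
    using assms by simp
  have "\<bar>a * b\<bar> \<le> a\<^sup>2 + b\<^sup>2" for a b :: real
  proof -
    have "2 * \<bar>a * b\<bar> \<le> a\<^sup>2 + b\<^sup>2"
      using sum_squares_bound[of "\<bar>a\<bar>" "\<bar>b\<bar>"] by (simp add: abs_mult mult.assoc)
    then show ?thesis by linarith
  qed
  then show "AE x in M. norm (f x * g x) \<le> norm ((f x)\<^sup>2 + (g x)\<^sup>2)"
    by auto
qed measurable

lemma orthogonal_sum_second_moment:
  fixes Y :: "nat \<Rightarrow> 'a \<Rightarrow> real"
  assumes [measurable]: "\<And>i. Y i \<in> borel_measurable M"
    and sq: "\<And>i. integrable M (\<lambda>x. (Y i x)\<^sup>2)"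
    and orth: "\<And>i j. i < j \<Longrightarrow> (\<integral>x. Y i x * Y j x \<partial>M) = 0"
    and bound: "\<And>i. (\<integral>x. (Y i x)\<^sup>2 \<partial>M) \<le> K"
    and "finite A"
  shows "integrable M (\<lambda>x. (\<Sum>i\<in>A. Y i x)\<^sup>2)" "(\<integral>x. (\<Sum>i\<in>A. Y i x)\<^sup>2 \<partial>M) \<le> K * card A"
proof -
  have prod: "integrable M (\<lambda>x. Y i x * Y j x)" for i j
    by (intro integrable_mult_if_squares sq) measurable
  have eq: "(\<Sum>i\<in>A. Y i x)\<^sup>2 = (\<Sum>i\<in>A. \<Sum>j\<in>A. Y i x * Y j x)" for x
    by (simp add: power2_eq_square sum_product)
  show "integrable M (\<lambda>x. (\<Sum>i\<in>A. Y i x)\<^sup>2)"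
    unfolding eq by (intro Bochner_Integration.integrable_sum prod)
  have "(\<integral>x. Y i x * Y j x \<partial>M) = (if i = j then \<integral>x. (Y i x)\<^sup>2 \<partial>M else 0)" for i j
    using orth[of i j] orth[of j i] by (auto simp: power2_eq_square mult.commute neq_iff)
  then have "(\<integral>x. (\<Sum>i\<in>A. Y i x)\<^sup>2 \<partial>M) = (\<Sum>i\<in>A. \<integral>x. (Y i x)\<^sup>2 \<partial>M)"
    unfolding eq using \<open>finite A\<close> by (simp add: Bochner_Integration.integral_sum prod)
  also have "\<dots> \<le> K * card A"
    using sum_bounded_above[of A "\<lambda>i. \<integral>x. (Y i x)\<^sup>2 \<partial>M" K] bound by (simp add: mult.commute)
  finally show "(\<integral>x. (\<Sum>i\<in>A. Y i x)\<^sup>2 \<partial>M) \<le> K * card A" .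
qed

text \<open>
  By orthogonality a sum of \<open>n\<close> terms has second moment at most \<open>K n\<close>. Along the squares
  \<open>n = m\<^sup>2\<close> the averages have second moments of order \<open>1 / m\<^sup>2\<close>, which is summable. Between \<open>m\<^sup>2\<close> and
  \<open>(m + 1)\<^sup>2\<close> there are of order \<open>m\<close> partial sums, each moving away from the one at \<open>m\<^sup>2\<close> by an
  amount with second moment of order \<open>m\<close>; even the sum of all these moments is of order \<open>m\<^sup>2\<close>,
  and division by \<open>m\<^sup>4\<close> again leaves a summable sequence.
\<close>

theorem strong_law_orthogonal:
  fixes Y :: "nat \<Rightarrow> 'a \<Rightarrow> real"
  assumes meas [measurable]: "\<And>i. Y i \<in> borel_measurable M"
    and sq: "\<And>i. integrable M (\<lambda>x. (Y i x)\<^sup>2)"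
    and orth: "\<And>i j. i < j \<Longrightarrow> (\<integral>x. Y i x * Y j x \<partial>M) = 0"
    and bound: "\<And>i. (\<integral>x. (Y i x)\<^sup>2 \<partial>M) \<le> K"
  shows "AE x in M. (\<lambda>n. (\<Sum>i<n. Y i x) / n) \<longlonglongrightarrow> 0"
proof -
  define S where "S n x = (\<Sum>i<n. Y i x)" for n x
  define block where "block m = {m\<^sup>2..<(m + 1)\<^sup>2}" for m :: nat
  (* T m dominates, up to the factor 2, the squares of all averages with index in block m. *)
  define T where "T m x = ((S (m\<^sup>2) x)\<^sup>2 + (\<Sum>n\<in>block m. (S n x - S (m\<^sup>2) x)\<^sup>2)) / real m ^ 4" for m x
  note moment = orthogonal_sum_second_moment[OF meas sq orth bound]
  have K: "0 \<le> K"
    using bound[of 0] Bochner_Integration.integral_nonneg[of M "\<lambda>x. (Y 0 x)\<^sup>2"] by (meson order_trans zero_le_power2)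
  have diff: "S n x - S (m\<^sup>2) x = (\<Sum>i\<in>{m\<^sup>2..<n}. Y i x)" if "n \<in> block m" for n m x
    unfolding S_def lessThan_atLeast0 using that by (intro sum_diff_nat_ivl) (auto simp: block_def)
  have T_int: "integrable M (T m)" for m
  proof -
    have "integrable M (\<lambda>x. (S n x - S (m\<^sup>2) x)\<^sup>2)" if "n \<in> block m" for n
      unfolding diff[OF that] by (rule moment(1)) auto
    moreover have "integrable M (\<lambda>x. (S (m\<^sup>2) x)\<^sup>2)"
      unfolding S_def by (rule moment(1)) auto
    ultimately show ?thesis
      unfolding T_def[abs_def] by (intro integrable_divide Bochner_Integration.integrable_add Bochner_Integration.integrable_sum) auto
  qed
  have T_bound: "(\<integral>x. T m x \<partial>M) \<le> 10 * K / real m ^ 2" for m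
  proof (cases "m = 0")
    case False
    have "integrable M (\<lambda>x. (S n x - S (m\<^sup>2) x)\<^sup>2)" if "n \<in> block m" for n
      unfolding diff[OF that] by (rule moment(1)) auto
    moreover have "integrable M (\<lambda>x. (S (m\<^sup>2) x)\<^sup>2)"
      unfolding S_def by (rule moment(1)) auto
    ultimately have "(\<integral>x. T m x \<partial>M) =
        ((\<integral>x. (S (m\<^sup>2) x)\<^sup>2 \<partial>M) + (\<Sum>n\<in>block m. \<integral>x. (S n x - S (m\<^sup>2) x)\<^sup>2 \<partial>M)) / real m ^ 4"
      unfolding T_def[abs_def] by (simp add: Bochner_Integration.integral_add Bochner_Integration.integral_sum)
    also have "\<dots> \<le> (K * (real m)\<^sup>2 + (\<Sum>n\<in>block m. K * (3 * real m))) / real m ^ 4"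
    proof (intro divide_right_mono add_mono sum_mono)
      show "(\<integral>x. (S (m\<^sup>2) x)\<^sup>2 \<partial>M) \<le> K * (real m)\<^sup>2"
        unfolding S_def using moment(2)[where A="{..<m\<^sup>2}"] by simp
      fix n assume n: "n \<in> block m"
      have "(\<integral>x. (S n x - S (m\<^sup>2) x)\<^sup>2 \<partial>M) \<le> K * real (n - m\<^sup>2)"
        unfolding diff[OF n] using moment(2)[where A="{m\<^sup>2..<n}"] by simp
      also have "\<dots> \<le> K * (3 * real m)"
      proof (intro mult_left_mono K)
        have "n - m\<^sup>2 \<le> 3 * m"
          using n \<open>m \<noteq> 0\<close> by (auto simp: block_def power2_eq_square algebra_simps)
        then show "real (n - m\<^sup>2) \<le> 3 * real m"
          by (metis of_nat_le_iff of_nat_mult of_nat_numeral)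
      qed
      finally show "(\<integral>x. (S n x - S (m\<^sup>2) x)\<^sup>2 \<partial>M) \<le> K * (3 * real m)" .
    qed auto
    also have "(\<Sum>n\<in>block m. K * (3 * real m)) = K * (3 * real m) * real (2 * m + 1)"
      by (simp add: block_def power2_eq_square algebra_simps)
    also have "\<dots> \<le> K * (3 * real m) * (3 * real m)"
      using \<open>m \<noteq> 0\<close> K by (intro mult_left_mono) auto
    also have "(K * (real m)\<^sup>2 + K * (3 * real m) * (3 * real m)) / real m ^ 4 = 10 * K / real m ^ 2"
      using \<open>m \<noteq> 0\<close> by (simp add: power2_eq_square power4_eq_xxxx field_simps)
    finally show ?thesis by (simp add: divide_right_mono)
  qed (simp add: T_def)
  have T_nonneg: "0 \<le> T m x" for m x
    by (simp add: T_def sum_nonneg)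
  have "summable (\<lambda>m. 10 * K * inverse (real m ^ 2))"
    by (intro summable_mult inverse_power_summable) auto
  then have "summable (\<lambda>m. \<integral>x. T m x \<partial>M)"
    by (rule summable_comparison_test') (use T_bound T_nonneg in \<open>auto simp: Bochner_Integration.integral_nonneg divide_inverse\<close>)
  from AE_tendsto_zero_if_summable_integrals[OF T_int T_nonneg this]
  show ?thesis
  proof eventually_elim
    case (elim x)
    define m where "m n = floor_sqrt n" for n
    have "filterlim m at_top sequentially"
      unfolding m_def filterlim_at_top
    proof
      fix Z show "\<forall>\<^sub>F n in sequentially. Z \<le> floor_sqrt n"
        using eventually_ge_at_top[of "Z\<^sup>2"] by eventually_elim (simp add: le_floor_sqrtI)
    qed
    with elim have "(\<lambda>n. T (m n) x) \<longlonglongrightarrow> 0"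
      by (rule filterlim_compose)
    then have "(\<lambda>n. 2 * T (m n) x) \<longlonglongrightarrow> 0"
      using tendsto_mult_right_zero by blast
    moreover have "\<forall>\<^sub>F n in sequentially. norm ((S n x / n)\<^sup>2) \<le> 2 * T (m n) x"
      using eventually_gt_at_top[of 0]
    proof eventually_elim
      case (elim n)
      let ?m = "m n"
      have m: "?m\<^sup>2 \<le> n" "n < (?m + 1)\<^sup>2" "?m > 0"
        using elim Suc_floor_sqrt_power2_gt[of n] by (auto simp: m_def)
      then have n: "n \<in> block ?m"
        by (simp add: block_def)
      have "real ?m ^ 4 \<le> (real n)\<^sup>2"
      proof -
        have "(?m\<^sup>2)\<^sup>2 \<le> n\<^sup>2"
          using m by (intro power_mono) auto
        then show ?thesis
          by (simp flip: of_nat_power add: of_nat_le_iff)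
      qed
      moreover have "(S n x)\<^sup>2 \<le> 2 * (T ?m x * real ?m ^ 4)"
      proof -
        have "(S n x)\<^sup>2 \<le> 2 * (S (?m\<^sup>2) x)\<^sup>2 + 2 * (S n x - S (?m\<^sup>2) x)\<^sup>2"
          using zero_le_power2[of "2 * S (?m\<^sup>2) x - S n x"] by (simp add: power2_eq_square algebra_simps)
        also have "(S n x - S (?m\<^sup>2) x)\<^sup>2 \<le> (\<Sum>n\<in>block ?m. (S n x - S (?m\<^sup>2) x)\<^sup>2)"
          by (rule member_le_sum[OF n]) (auto simp: block_def)
        finally show ?thesis
          using m(3) by (simp add: T_def)
      qed
      moreover have "T ?m x * real ?m ^ 4 \<le> T ?m x * (real n)\<^sup>2"
        using calculation(1) T_nonneg by (intro mult_left_mono)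
      ultimately have "(S n x)\<^sup>2 \<le> 2 * T ?m x * (real n)\<^sup>2"
        by linarith
      then show ?case
        using elim by (simp add: power_divide divide_le_eq)
    qed
    ultimately have "(\<lambda>n. (S n x / n)\<^sup>2) \<longlonglongrightarrow> 0"
      by (rule Lim_null_comparison[rotated])
    then show ?case
      by (simp add: S_def)
  qed
qed

section \<open>Autoregressions with bounded fourth moments\<close>

definition bounded_fourth_moment :: "'a measure \<Rightarrow> (nat \<Rightarrow> 'a \<Rightarrow> real) \<Rightarrow> bool" where
  "bounded_fourth_moment M U \<longleftrightarrow>
     (\<exists>K. \<forall>n. U n \<in> borel_measurable M \<and> integrable M (\<lambda>\<omega>. U n \<omega> ^ 4) \<and> (\<integral>\<omega>. U n \<omega> ^ 4 \<partial>M) \<le> K)"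

lemma bounded_fourth_momentE:
  assumes "bounded_fourth_moment M U"
  obtains K where "\<And>n. U n \<in> borel_measurable M" "\<And>n. integrable M (\<lambda>\<omega>. U n \<omega> ^ 4)"
    "\<And>n. (\<integral>\<omega>. U n \<omega> ^ 4 \<partial>M) \<le> K" "0 \<le> K"
proof -
  obtain K where K: "\<And>n. U n \<in> borel_measurable M" "\<And>n. integrable M (\<lambda>\<omega>. U n \<omega> ^ 4)"
    "\<And>n. (\<integral>\<omega>. U n \<omega> ^ 4 \<partial>M) \<le> K"
    using assms unfolding bounded_fourth_moment_def by blast
  have "0 \<le> (\<integral>\<omega>. U 0 \<omega> ^ 4 \<partial>M)"
    by (rule Bochner_Integration.integral_nonneg) simp
  then have "0 \<le> K"
    using K(3)[of 0] by linarith
  with K show thesis by (rule that)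
qed

lemma bounded_fourth_moment_shift:
  "bounded_fourth_moment M U \<Longrightarrow> bounded_fourth_moment M (\<lambda>n. U (n + k))"
  unfolding bounded_fourth_moment_def by blast

text \<open>
  Convexity of the fourth power with weights \<open>\<bar>c\<bar>\<close> and \<open>1 - \<bar>c\<bar>\<close>. The coefficient of \<open>y ^ 4\<close> is
  below one, so that the bound can be iterated along an autoregression.
\<close>

lemma convex_combination_fourth_power:
  fixes c y u :: real
  assumes "\<bar>c\<bar> < 1"
  shows "(c * y + u) ^ 4 \<le> \<bar>c\<bar> * y ^ 4 + u ^ 4 / (1 - \<bar>c\<bar>) ^ 3"
proof -
  let ?d = "1 - \<bar>c\<bar>"
  have d: "?d > 0" using assms by simp
  have "(?d * (u / ?d) + \<bar>c\<bar> * (sgn c * y)) ^ 4 \<le> ?d * (u / ?d) ^ 4 + \<bar>c\<bar> * (sgn c * y) ^ 4"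
    using convex_onD[OF convex_power_even[of 4], of "\<bar>c\<bar>" "u / ?d" "sgn c * y"] assms by simp
  also have "?d * (u / ?d) + \<bar>c\<bar> * (sgn c * y) = c * y + u"
    using d by (simp add: mult.assoc[symmetric] abs_mult_sgn)
  also have "?d * (u / ?d) ^ 4 = u ^ 4 / ?d ^ 3"
    using d by (simp add: power_divide eval_nat_numeral)
  also have "\<bar>c\<bar> * (sgn c * y) ^ 4 = \<bar>c\<bar> * y ^ 4"
    by (cases c "0::real" rule: linorder_cases) (auto simp: power_mult_distrib)
  finally show ?thesis by simp
qed

lemma fourth_power_add_le: "(a + b :: real) ^ 4 \<le> 8 * a ^ 4 + 8 * b ^ 4"
proof -
  have "(1/2 * (2 * a) + 1/2 * (2 * b)) ^ 4 \<le> 1/2 * (2 * a) ^ 4 + 1/2 * (2 * b) ^ 4"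
    using convex_onD[OF convex_power_even[of 4], of "1/2" "2 * a" "2 * b"] by simp
  then show ?thesis by (simp add: power_mult_distrib)
qed

lemma bounded_fourth_moment_lincomb:
  assumes "bounded_fourth_moment M U" "bounded_fourth_moment M U'"
  shows "bounded_fourth_moment M (\<lambda>n \<omega>. a * U n \<omega> + b * U' n \<omega>)"
proof -
  obtain K where U [measurable]: "\<And>n. U n \<in> borel_measurable M" "\<And>n. integrable M (\<lambda>\<omega>. U n \<omega> ^ 4)"
    and UK: "\<And>n. (\<integral>\<omega>. U n \<omega> ^ 4 \<partial>M) \<le> K" "0 \<le> K"
    by (rule bounded_fourth_momentE[OF assms(1)]) (rule that, auto)
  obtain L where U' [measurable]: "\<And>n. U' n \<in> borel_measurable M" "\<And>n. integrable M (\<lambda>\<omega>. U' n \<omega> ^ 4)"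
    and UL: "\<And>n. (\<integral>\<omega>. U' n \<omega> ^ 4 \<partial>M) \<le> L" "0 \<le> L"
    by (rule bounded_fourth_momentE[OF assms(2)]) (rule that, auto)
  let ?g = "\<lambda>n \<omega>. 8 * (a ^ 4 * U n \<omega> ^ 4) + 8 * (b ^ 4 * U' n \<omega> ^ 4)"
  have g: "integrable M (?g n)" for n
    by (intro Bochner_Integration.integrable_add integrable_mult_right U U')
  have le: "(a * U n \<omega> + b * U' n \<omega>) ^ 4 \<le> ?g n \<omega>" for n \<omega>
    using fourth_power_add_le[of "a * U n \<omega>" "b * U' n \<omega>"] by (simp add: power_mult_distrib)
  have int: "integrable M (\<lambda>\<omega>. (a * U n \<omega> + b * U' n \<omega>) ^ 4)" for n
    by (rule Bochner_Integration.integrable_bound[OF g[of n]])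
       (use le in \<open>auto intro!: order_trans[OF _ abs_ge_self]\<close>)
  have "(\<integral>\<omega>. (a * U n \<omega> + b * U' n \<omega>) ^ 4 \<partial>M) \<le> 8 * (a ^ 4 * K) + 8 * (b ^ 4 * L)" for n
  proof -
    have "(\<integral>\<omega>. (a * U n \<omega> + b * U' n \<omega>) ^ 4 \<partial>M) \<le> (\<integral>\<omega>. ?g n \<omega> \<partial>M)"
      by (rule integral_mono[OF int g le])
    also have "\<dots> = 8 * (a ^ 4 * (\<integral>\<omega>. U n \<omega> ^ 4 \<partial>M)) + 8 * (b ^ 4 * (\<integral>\<omega>. U' n \<omega> ^ 4 \<partial>M))"
      using U U' by simp
    also have "\<dots> \<le> 8 * (a ^ 4 * K) + 8 * (b ^ 4 * L)"
      by (intro add_mono mult_left_mono UK UL) auto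
    finally show ?thesis .
  qed
  then show ?thesis
    unfolding bounded_fourth_moment_def using int by (intro exI[of _ "8 * (a ^ 4 * K) + 8 * (b ^ 4 * L)"]) auto
qed

lemma square_le_fourth_power: "(x::real)\<^sup>2 \<le> 1 + x ^ 4"
proof -
  have "0 \<le> (x\<^sup>2 - 1)\<^sup>2" "0 \<le> x\<^sup>2" by simp_all
  moreover have "(x\<^sup>2 - 1)\<^sup>2 = x ^ 4 - 2 * x\<^sup>2 + 1"
    by (simp add: power2_eq_square power4_eq_xxxx algebra_simps)
  ultimately show ?thesis by linarith
qed

lemma (in prob_space) bounded_second_moment:
  assumes "bounded_fourth_moment M U"
  obtains K where "\<And>n. integrable M (\<lambda>\<omega>. (U n \<omega>)\<^sup>2)" "\<And>n. (\<integral>\<omega>. (U n \<omega>)\<^sup>2 \<partial>M) \<le> K"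
proof -
  obtain K where U [measurable]: "\<And>n. U n \<in> borel_measurable M" "\<And>n. integrable M (\<lambda>\<omega>. U n \<omega> ^ 4)"
    and UK: "\<And>n. (\<integral>\<omega>. U n \<omega> ^ 4 \<partial>M) \<le> K"
    by (rule bounded_fourth_momentE[OF assms]) (rule that, auto)
  have g: "integrable M (\<lambda>\<omega>. 1 + U n \<omega> ^ 4)" for n
    using U by simp
  have int: "integrable M (\<lambda>\<omega>. (U n \<omega>)\<^sup>2)" for n
    by (rule Bochner_Integration.integrable_bound[OF g[of n]])
       (use square_le_fourth_power in \<open>auto intro!: order_trans[OF _ abs_ge_self]\<close>)
  have "(\<integral>\<omega>. (U n \<omega>)\<^sup>2 \<partial>M) \<le> 1 + K" for n
  proof -
    have "(\<integral>\<omega>. (U n \<omega>)\<^sup>2 \<partial>M) \<le> (\<integral>\<omega>. 1 + U n \<omega> ^ 4 \<partial>M)"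
      by (rule integral_mono[OF int g square_le_fourth_power])
    also have "\<dots> = 1 + (\<integral>\<omega>. U n \<omega> ^ 4 \<partial>M)"
      using U by (simp add: prob_space)
    finally show ?thesis using UK[of n] by simp
  qed
  with int show thesis by (rule that)
qed

text \<open>
  The fourth moments make the second moments of \<open>(U n)\<^sup>2 / n\<close> summable.
\<close>

lemma AE_square_negligible:
  assumes "bounded_fourth_moment M U"
  shows "AE \<omega> in M. (\<lambda>n. (U n \<omega>)\<^sup>2 / n) \<longlonglongrightarrow> 0"
proof -
  obtain K where U [measurable]: "\<And>n. U n \<in> borel_measurable M" "\<And>n. integrable M (\<lambda>\<omega>. U n \<omega> ^ 4)"
    and UK: "\<And>n. (\<integral>\<omega>. U n \<omega> ^ 4 \<partial>M) \<le> K"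
    by (rule bounded_fourth_momentE[OF assms]) (rule that, auto)
  have "AE \<omega> in M. (\<lambda>n. U n \<omega> ^ 4 / real n ^ 2) \<longlonglongrightarrow> 0"
  proof (rule AE_tendsto_zero_if_summable_integrals)
    show "integrable M (\<lambda>\<omega>. U n \<omega> ^ 4 / real n ^ 2)" for n
      using U(2) by (rule integrable_divide)
    have "summable (\<lambda>n. K * inverse (real n ^ 2))"
      by (intro summable_mult inverse_power_summable) auto
    then show "summable (\<lambda>n. \<integral>\<omega>. U n \<omega> ^ 4 / real n ^ 2 \<partial>M)"
    proof (rule summable_comparison_test'[where N=0])
      fix n
      have "0 \<le> (\<integral>\<omega>. U n \<omega> ^ 4 \<partial>M)"
        by (rule Bochner_Integration.integral_nonneg) simp
      then show "norm (\<integral>\<omega>. U n \<omega> ^ 4 / real n ^ 2 \<partial>M) \<le> K * inverse (real n ^ 2)"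
        using UK[of n] by (simp add: divide_inverse mult_right_mono)
    qed
  qed simp
  then show ?thesis
  proof eventually_elim
    case (elim \<omega>)
    have "U n \<omega> ^ 4 / real n ^ 2 = ((U n \<omega>)\<^sup>2 / n)\<^sup>2" for n
      by (simp add: power_divide flip: power_mult)
    with elim show ?case by simp
  qed
qed

text \<open>
  The first-order autoregression started at rest at time \<open>0\<close> and driven by \<open>u 1, u 2, \<dots>\<close>.
\<close>

primrec ar1 :: "real \<Rightarrow> (nat \<Rightarrow> real) \<Rightarrow> nat \<Rightarrow> real" where
  "ar1 c u 0 = 0"
| "ar1 c u (Suc n) = c * ar1 c u n + u (Suc n)"

lemma bounded_fourth_moment_ar1:
  assumes c: "\<bar>c\<bar> < 1" and "bounded_fourth_moment M (\<lambda>n. U (Suc n))"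
  shows "bounded_fourth_moment M (\<lambda>n \<omega>. ar1 c (\<lambda>k. U k \<omega>) n)"
proof -
  obtain K where U [measurable]: "\<And>n. U (Suc n) \<in> borel_measurable M" "\<And>n. integrable M (\<lambda>\<omega>. U (Suc n) \<omega> ^ 4)"
    and UK: "\<And>n. (\<integral>\<omega>. U (Suc n) \<omega> ^ 4 \<partial>M) \<le> K" "0 \<le> K"
    by (rule bounded_fourth_momentE[OF assms(2)]) (rule that, auto)
  let ?d = "1 - \<bar>c\<bar>" and ?y = "\<lambda>n \<omega>. ar1 c (\<lambda>k. U k \<omega>) n"
  have d: "?d > 0" using c by simp
  have meas [measurable]: "?y n \<in> borel_measurable M" for n
    by (induction n) simp_all
  have "integrable M (\<lambda>\<omega>. ?y n \<omega> ^ 4) \<and> (\<integral>\<omega>. ?y n \<omega> ^ 4 \<partial>M) \<le> K / ?d ^ 4" for n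
  proof (induction n)
    case 0
    then show ?case using UK(2) d by simp
  next
    case (Suc n)
    let ?g = "\<lambda>\<omega>. \<bar>c\<bar> * ?y n \<omega> ^ 4 + U (Suc n) \<omega> ^ 4 / ?d ^ 3"
    have g: "integrable M ?g"
      using Suc U by (intro Bochner_Integration.integrable_add integrable_mult_right integrable_divide) auto
    have le: "?y (Suc n) \<omega> ^ 4 \<le> ?g \<omega>" for \<omega>
      using convex_combination_fourth_power[OF c] by simp
    have int: "integrable M (\<lambda>\<omega>. ?y (Suc n) \<omega> ^ 4)"
      by (rule Bochner_Integration.integrable_bound[OF g])
         (use le in \<open>auto intro!: order_trans[OF _ abs_ge_self] simp del: ar1.simps\<close>)
    have "(\<integral>\<omega>. ?y (Suc n) \<omega> ^ 4 \<partial>M) \<le> (\<integral>\<omega>. ?g \<omega> \<partial>M)"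
      by (rule integral_mono[OF int g le])
    also have "\<dots> = \<bar>c\<bar> * (\<integral>\<omega>. ?y n \<omega> ^ 4 \<partial>M) + (\<integral>\<omega>. U (Suc n) \<omega> ^ 4 \<partial>M) / ?d ^ 3"
      using Suc U by simp
    also have "\<dots> \<le> \<bar>c\<bar> * (K / ?d ^ 4) + K / ?d ^ 3"
      using Suc UK d by (intro add_mono mult_left_mono divide_right_mono) auto
    also have "K / ?d ^ 3 = ?d * (K / ?d ^ 4)"
      using d by (simp add: eval_nat_numeral)
    also have "\<bar>c\<bar> * (K / ?d ^ 4) + ?d * (K / ?d ^ 4) = K / ?d ^ 4"
      unfolding distrib_right[symmetric] by simp
    finally show ?case using int by simp
  qed
  then show ?thesis
    unfolding bounded_fourth_moment_def using meas by blast
qed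

section \<open>Martingale transforms of the innovations\<close>

text \<open>
  The two variables take values in different spaces, so their independence is stated for events:
  the two variables of \<open>indep_var\<close> share one type.
\<close>

lemma (in prob_space) integral_independent_pair:
  fixes h :: "'b \<times> 'c \<Rightarrow> 'd::{banach, second_countable_topology}"
  assumes X [measurable]: "random_variable S X" and Y [measurable]: "random_variable T Y"
    and indep: "\<And>A B. A \<in> sets S \<Longrightarrow> B \<in> sets T \<Longrightarrow>
      prob ((X -` A \<inter> space M) \<inter> (Y -` B \<inter> space M)) = prob (X -` A \<inter> space M) * prob (Y -` B \<inter> space M)"
    and h [measurable]: "h \<in> borel_measurable (S \<Otimes>\<^sub>M T)"
    and int: "integrable M (\<lambda>\<omega>. h (X \<omega>, Y \<omega>))"
  shows "(\<integral>\<omega>. h (X \<omega>, Y \<omega>) \<partial>M) = (\<integral>\<omega>. (\<integral>x. h (x, Y \<omega>) \<partial>distr M S X) \<partial>M)"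
proof -
  interpret X: prob_space "distr M S X" by (rule prob_space_distr) measurable
  interpret Y: prob_space "distr M T Y" by (rule prob_space_distr) measurable
  interpret XY: pair_prob_space "distr M S X" "distr M T Y" ..
  have eq: "distr M S X \<Otimes>\<^sub>M distr M T Y = distr M (S \<Otimes>\<^sub>M T) (\<lambda>\<omega>. (X \<omega>, Y \<omega>))"
  proof (rule pair_measure_eqI)
    fix A B assume "A \<in> sets (distr M S X)" "B \<in> sets (distr M T Y)"
    then have AB [measurable]: "A \<in> sets S" "B \<in> sets T" by simp_all
    have "(\<lambda>\<omega>. (X \<omega>, Y \<omega>)) -` (A \<times> B) \<inter> space M = (X -` A \<inter> space M) \<inter> (Y -` B \<inter> space M)"
      by auto
    then show "emeasure (distr M S X) A * emeasure (distr M T Y) B =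
        emeasure (distr M (S \<Otimes>\<^sub>M T) (\<lambda>\<omega>. (X \<omega>, Y \<omega>))) (A \<times> B)"
      by (simp add: emeasure_distr emeasure_eq_measure indep[OF AB] flip: ennreal_mult)
  qed (simp_all add: X.sigma_finite_measure_axioms Y.sigma_finite_measure_axioms cong: sets_pair_measure_cong)
  have int': "integrable (distr M S X \<Otimes>\<^sub>M distr M T Y) (case_prod (\<lambda>x y. h (x, y)))"
    unfolding eq by (simp add: integrable_distr_eq int)
  have "(\<integral>\<omega>. h (X \<omega>, Y \<omega>) \<partial>M) = (\<integral>z. h z \<partial>distr M (S \<Otimes>\<^sub>M T) (\<lambda>\<omega>. (X \<omega>, Y \<omega>)))"
    by (simp add: integral_distr)
  also have "\<dots> = (\<integral>y. (\<integral>x. h (x, y) \<partial>distr M S X) \<partial>distr M T Y)"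
    unfolding eq[symmetric] by (subst XY.integral_snd[OF int']) simp
  also have "\<dots> = (\<integral>\<omega>. (\<integral>x. h (x, Y \<omega>) \<partial>distr M S X) \<partial>M)"
  proof (rule integral_distr[OF Y])
    show "(\<lambda>y. \<integral>x. h (x, y) \<partial>distr M S X) \<in> borel_measurable T"
      by measurable
  qed
  finally show ?thesis .
qed

locale innovations = prob_space M for M :: "'a measure" +
  fixes V :: "nat \<Rightarrow> 'a \<Rightarrow> real" and \<sigma> :: real
  assumes indep: "indep_vars (\<lambda>_. borel) V {1..}"
    and ident: "n \<ge> 1 \<Longrightarrow> distr M borel (V n) = distr M borel (V 1)"
    and centred: "n \<ge> 1 \<Longrightarrow> expectation (V n) = 0"
    and var: "n \<ge> 1 \<Longrightarrow> variance (V n) = \<sigma>\<^sup>2"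
    and fourth_moment: "n \<ge> 1 \<Longrightarrow> integrable M (\<lambda>\<omega>. V n \<omega> ^ 4)"
begin

lemma V_meas: "n \<ge> 1 \<Longrightarrow> V n \<in> borel_measurable M"
  using indep by (auto simp: indep_vars_def)

lemma V_Suc_meas [measurable]: "V (Suc n) \<in> borel_measurable M" "V (n + 2) \<in> borel_measurable M"
  by (auto intro: V_meas)

lemma integral_V_eq:
  fixes g :: "real \<Rightarrow> 'b::{banach, second_countable_topology}"
  assumes "n \<ge> 1" and [measurable]: "g \<in> borel_measurable borel"
  shows "expectation (\<lambda>\<omega>. g (V n \<omega>)) = expectation (\<lambda>\<omega>. g (V 1 \<omega>))"
    and "integrable M (\<lambda>\<omega>. g (V n \<omega>)) \<longleftrightarrow> integrable M (\<lambda>\<omega>. g (V 1 \<omega>))"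
proof -
  have [measurable]: "V n \<in> borel_measurable M" "V 1 \<in> borel_measurable M"
    using assms(1) by (auto intro: V_meas)
  show "expectation (\<lambda>\<omega>. g (V n \<omega>)) = expectation (\<lambda>\<omega>. g (V 1 \<omega>))"
    using ident[OF assms(1)] integral_distr[of "V n" M borel g] integral_distr[of "V 1" M borel g] by simp
  show "integrable M (\<lambda>\<omega>. g (V n \<omega>)) \<longleftrightarrow> integrable M (\<lambda>\<omega>. g (V 1 \<omega>))"
    using ident[OF assms(1)] integrable_distr_eq[of "V n" M borel g] integrable_distr_eq[of "V 1" M borel g] by simp
qed

lemma V_bounded_fourth_moment: "bounded_fourth_moment M (\<lambda>n. V (Suc n))"
  unfolding bounded_fourth_moment_def
proof (intro exI allI conjI)
  fix n
  show "expectation (\<lambda>\<omega>. V (Suc n) \<omega> ^ 4) \<le> expectation (\<lambda>\<omega>. V 1 \<omega> ^ 4)"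
    using integral_V_eq(1)[of "Suc n" "\<lambda>x. x ^ 4"] by simp
qed (auto intro: fourth_moment V_meas)

lemma V_square: "n \<ge> 1 \<Longrightarrow> integrable M (\<lambda>\<omega>. (V n \<omega>)\<^sup>2)" "n \<ge> 1 \<Longrightarrow> expectation (\<lambda>\<omega>. (V n \<omega>)\<^sup>2) = \<sigma>\<^sup>2"
proof -
  assume n: "n \<ge> 1"
  then obtain m where m: "n = Suc m" by (cases n) auto
  obtain K where K: "\<And>n. integrable M (\<lambda>\<omega>. (V (Suc n) \<omega>)\<^sup>2)"
    by (rule bounded_second_moment[OF V_bounded_fourth_moment]) (rule that, auto)
  then show "integrable M (\<lambda>\<omega>. (V n \<omega>)\<^sup>2)" by (simp add: m)
  show "expectation (\<lambda>\<omega>. (V n \<omega>)\<^sup>2) = \<sigma>\<^sup>2"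
    using var[OF n] centred[OF n] by simp
qed

lemma V_integrable: "n \<ge> 1 \<Longrightarrow> integrable M (V n)"
  by (rule square_integrable_imp_integrable) (auto intro: V_meas V_square)

text \<open>
  The information generated strictly before time \<open>n\<close>: what is measurable with respect to \<open>past n\<close>
  is independent of \<open>V n\<close>.
\<close>

definition past :: "nat \<Rightarrow> 'a measure" where
  "past n = sigma (space M) (\<Union>i\<in>{1..<n}. {V i -` A \<inter> space M | A. A \<in> sets borel})"

lemma space_past [simp]: "space (past n) = space M"
  by (simp add: past_def space_measure_of_conv)

lemma sets_past: "sets (past n) = sigma_sets (space M) (\<Union>i\<in>{1..<n}. {V i -` A \<inter> space M | A. A \<in> sets borel})"
  unfolding past_def by (rule sets_measure_of) auto

lemma past_mono: "m \<le> n \<Longrightarrow> f \<in> measurable (past m) N \<Longrightarrow> f \<in> measurable (past n) N"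
proof (erule measurable_mono[THEN subsetD, of N N "past m" "past n", rotated -1])
  assume "m \<le> n"
  then show "sets (past m) \<subseteq> sets (past n)"
    unfolding sets_past by (intro sigma_sets_mono' UN_mono) auto
qed auto

lemma past_measurable: "f \<in> measurable (past n) N \<Longrightarrow> f \<in> measurable M N"
proof (rule measurable_mono[THEN subsetD, of N N "past n" M])
  show "sets (past n) \<subseteq> sets M"
    unfolding sets_past by (rule sets.sigma_sets_subset) (auto intro: measurable_sets[OF V_meas])
qed auto

lemma V_past: "1 \<le> i \<Longrightarrow> i < n \<Longrightarrow> V i \<in> borel_measurable (past n)"
proof (rule measurableI)
  fix A :: "real set" assume i: "1 \<le> i" "i < n" and "A \<in> sets borel"
  then have "V i -` A \<inter> space M \<in> {V i -` A \<inter> space M | A. A \<in> sets borel}"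
    by blast
  with i show "V i -` A \<inter> space (past n) \<in> sets (past n)"
    unfolding sets_past space_past by (intro sigma_sets.Basic UN_I[of i]) auto
qed simp

lemma ar1_past:
  assumes "\<And>k. U (Suc k) \<in> borel_measurable (past (Suc (Suc k)))"
  shows "(\<lambda>\<omega>. ar1 c (\<lambda>k. U k \<omega>) n) \<in> borel_measurable (past (Suc n))"
proof (induction n)
  case (Suc n)
  have [measurable]: "(\<lambda>\<omega>. ar1 c (\<lambda>k. U k \<omega>) n) \<in> borel_measurable (past (Suc (Suc n)))"
    by (rule past_mono[OF _ Suc]) simp
  note [measurable] = assms[of n]
  show ?case
    unfolding ar1.simps by measurable
qed simp

lemma indep_set_past:
  assumes "n \<ge> 1"
  shows "indep_set (sigma_sets (space M) {V n -` A \<inter> space M | A. A \<in> sets borel}) (sets (past n))"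
proof -
  let ?I = "\<lambda>b::bool. if b then {n} else {1..<n}"
  have sub: "(\<Union>j\<in>UNIV. ?I j) \<subseteq> {1..}"
  proof
    fix i assume "i \<in> (\<Union>j\<in>UNIV. ?I j)"
    then obtain j where "i \<in> ?I j" by blast
    with assms show "i \<in> {1..}" by (cases j) simp_all
  qed
  have indep': "indep_sets (\<lambda>i. {V i -` A \<inter> space M |A. A \<in> sets borel}) {1..}"
    using indep unfolding indep_vars_def2 by (rule conjunct2)
  have "indep_sets (\<lambda>j. sigma_sets (space M) (\<Union>i\<in>?I j. {V i -` A \<inter> space M | A. A \<in> sets borel})) UNIV"
  proof (rule indep_sets_collect_sigma)
    show "indep_sets (\<lambda>i. {V i -` A \<inter> space M |A. A \<in> sets borel}) (\<Union>j\<in>UNIV. ?I j)"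
      by (rule indep_sets_mono_index[OF sub indep'])
    show "Int_stable {V i -` A \<inter> space M |A. A \<in> sets borel}" for i
    proof (rule Int_stableI)
      fix a b assume "a \<in> {V i -` A \<inter> space M |A. A \<in> sets borel}" "b \<in> {V i -` A \<inter> space M |A. A \<in> sets borel}"
      then obtain A B where "a = V i -` A \<inter> space M" "b = V i -` B \<inter> space M" "A \<inter> B \<in> sets borel"
        by blast
      moreover from this have "a \<inter> b = V i -` (A \<inter> B) \<inter> space M"
        by blast
      ultimately show "a \<inter> b \<in> {V i -` A \<inter> space M |A. A \<in> sets borel}"
        by blast
    qed
    show "disjoint_family_on ?I UNIV"
      by (simp add: disjoint_family_on_def)
  qed
  then show ?thesis
    unfolding indep_set_def sets_past
    by (rule indep_sets_mono_sets) (simp split: bool.split)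
qed

lemma prob_past:
  assumes "n \<ge> 1" "A \<in> sets borel" "Y \<in> measurable (past n) T" "B \<in> sets T"
  shows "prob ((V n -` A \<inter> space M) \<inter> (Y -` B \<inter> space M)) = prob (V n -` A \<inter> space M) * prob (Y -` B \<inter> space M)"
proof -
  have "V n -` A \<inter> space M \<in> sigma_sets (space M) {V n -` A \<inter> space M | A. A \<in> sets borel}"
    using assms(2) by (intro sigma_sets.Basic) blast
  moreover have "Y -` B \<inter> space M \<in> sets (past n)"
    using measurable_sets[OF assms(3,4)] by simp
  ultimately show ?thesis
    using indep_set_past[OF assms(1)] unfolding indep_sets2_eq by blast
qed

lemma indep_var_past:
  assumes n: "n \<ge> 1" and Y: "Y \<in> borel_measurable (past n)"
  shows "indep_var borel (V n) borel (Y :: 'a \<Rightarrow> real)"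
proof -
  have "sigma_sets (space M) {Y -` A \<inter> space M |A. A \<in> sets borel} \<subseteq> sets (past n)"
    using measurable_sets[OF Y] unfolding space_past
    by (intro sets.sigma_sets_subset[of _ "past n", unfolded space_past]) blast
  then have "indep_set (sigma_sets (space M) {V n -` A \<inter> space M | A. A \<in> sets borel})
      (sigma_sets (space M) {Y -` A \<inter> space M |A. A \<in> sets borel})"
    using indep_set_past[OF n] unfolding indep_sets2_eq by blast
  then show ?thesis
    unfolding indep_var_eq by (intro conjI V_meas[OF n] past_measurable[OF Y])
qed

lemma expectation_mult_past:
  fixes f :: "'a \<Rightarrow> real"
  assumes n: "n \<ge> 1" and f: "f \<in> borel_measurable (past n)" "integrable M f"
    and g: "g \<in> borel_measurable borel" "integrable M (\<lambda>\<omega>. g (V n \<omega>))"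
  shows "integrable M (\<lambda>\<omega>. g (V n \<omega>) * f \<omega>)"
    and "expectation (\<lambda>\<omega>. g (V n \<omega>) * f \<omega>) = expectation (\<lambda>\<omega>. g (V n \<omega>)) * expectation f"
proof -
  have "indep_var borel (g \<circ> V n) borel (id \<circ> f)"
    using g(1) by (intro indep_var_compose[OF indep_var_past[OF n f(1)]]) auto
  then have "indep_var borel (\<lambda>\<omega>. g (V n \<omega>)) borel f"
    by (simp add: o_def)
  from indep_var_integrable[OF this g(2) f(2)] indep_var_lebesgue_integral[OF this g(2) f(2)]
  show "integrable M (\<lambda>\<omega>. g (V n \<omega>) * f \<omega>)"
    "expectation (\<lambda>\<omega>. g (V n \<omega>) * f \<omega>) = expectation (\<lambda>\<omega>. g (V n \<omega>)) * expectation f" .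
qed

abbreviation "\<phi> \<equiv> char (distr M borel (V 1))"

text \<open>
  Conditionally on the past, \<open>V n\<close> still has its own law, so integrating it out replaces the
  exponential by the characteristic function at the past-measurable frequency \<open>G\<close>.
\<close>

lemma expectation_char_past:
  fixes F :: "'a \<Rightarrow> complex" and G :: "'a \<Rightarrow> real"
  assumes n: "n \<ge> 1" and F: "F \<in> borel_measurable (past n)" "\<And>\<omega>. norm (F \<omega>) \<le> B"
    and G: "G \<in> borel_measurable (past n)"
  shows "expectation (\<lambda>\<omega>. F \<omega> * iexp (V n \<omega> * G \<omega>)) = expectation (\<lambda>\<omega>. F \<omega> * \<phi> (G \<omega>))"
proof -
  note [measurable] = past_measurable[OF F(1)] past_measurable[OF G] V_meas[OF n]
  let ?h = "\<lambda>(v, z). fst z * iexp (v * snd z) :: complex"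
  have "expectation (\<lambda>\<omega>. ?h (V n \<omega>, (F \<omega>, G \<omega>))) =
      expectation (\<lambda>\<omega>. \<integral>x. ?h (x, (F \<omega>, G \<omega>)) \<partial>distr M borel (V n))"
  proof (rule integral_independent_pair[where T="borel \<Otimes>\<^sub>M borel"])
    show "prob ((V n -` A \<inter> space M) \<inter> ((\<lambda>\<omega>. (F \<omega>, G \<omega>)) -` B \<inter> space M)) =
        prob (V n -` A \<inter> space M) * prob ((\<lambda>\<omega>. (F \<omega>, G \<omega>)) -` B \<inter> space M)"
      if "A \<in> sets borel" "B \<in> sets (borel \<Otimes>\<^sub>M borel)" for A B
      using that F(1) G by (intro prob_past[OF n]) auto
    show "integrable M (\<lambda>\<omega>. ?h (V n \<omega>, (F \<omega>, G \<omega>)))"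
      by (rule integrable_const_bound[of _ B]) (use F(2) in \<open>auto simp: norm_mult\<close>)
  qed measurable
  then show ?thesis
    by (simp add: ident[OF n] char_def mult.commute)
qed

text \<open>
  A product \<open>Y i * Y j\<close> with \<open>i < j\<close> contains \<open>V (j + 2)\<close> as a centred factor independent of all
  the others.
\<close>

lemma martingale_differences:
  assumes W: "\<And>k. W k \<in> borel_measurable (past (k + 2))"
    and sq: "\<And>k. integrable M (\<lambda>\<omega>. (W k \<omega>)\<^sup>2)" and bound: "\<And>k. expectation (\<lambda>\<omega>. (W k \<omega>)\<^sup>2) \<le> K"
  defines "Y \<equiv> \<lambda>k \<omega>. V (k + 2) \<omega> * W k \<omega>"
  shows "Y k \<in> borel_measurable M" "integrable M (\<lambda>\<omega>. (Y k \<omega>)\<^sup>2)"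
    "expectation (\<lambda>\<omega>. (Y k \<omega>)\<^sup>2) \<le> \<sigma>\<^sup>2 * K" "i < j \<Longrightarrow> expectation (\<lambda>\<omega>. Y i \<omega> * Y j \<omega>) = 0"
proof -
  have W_M [measurable]: "W k \<in> borel_measurable M" for k
    by (rule past_measurable[OF W])
  show Y_M [measurable]: "Y k \<in> borel_measurable M" for k
    unfolding Y_def by measurable
  have W2: "(\<lambda>\<omega>. (W k \<omega>)\<^sup>2) \<in> borel_measurable (past (k + 2))" for k
    using W[of k] by measurable
  note mult = expectation_mult_past[OF _ W2 sq, of _ "\<lambda>v. v\<^sup>2"]
  have Y2: "(Y k \<omega>)\<^sup>2 = (V (k + 2) \<omega>)\<^sup>2 * (W k \<omega>)\<^sup>2" for k \<omega>
    by (simp add: Y_def power_mult_distrib)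
  show Y2_int: "integrable M (\<lambda>\<omega>. (Y k \<omega>)\<^sup>2)" for k
    unfolding Y2 by (rule mult(1)) (auto intro: V_square)
  have "expectation (\<lambda>\<omega>. (Y k \<omega>)\<^sup>2) = \<sigma>\<^sup>2 * expectation (\<lambda>\<omega>. (W k \<omega>)\<^sup>2)"
    unfolding Y2 by (subst mult(2)) (auto simp: V_square)
  also have "\<dots> \<le> \<sigma>\<^sup>2 * K"
    by (intro mult_left_mono bound) simp
  finally show "expectation (\<lambda>\<omega>. (Y k \<omega>)\<^sup>2) \<le> \<sigma>\<^sup>2 * K" .
  show "expectation (\<lambda>\<omega>. Y i \<omega> * Y j \<omega>) = 0" if "i < j"
  proof -
    have Wj: "(\<lambda>\<omega>. Y i \<omega> * W j \<omega>) \<in> borel_measurable (past (j + 2))"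
      unfolding Y_def
      using past_mono[OF _ W[of i], of "j + 2"] V_past[of "i + 2" "j + 2"] W[of j] that by simp
    have eq: "(\<lambda>\<omega>. V (j + 2) \<omega> * (Y i \<omega> * W j \<omega>)) = (\<lambda>\<omega>. Y i \<omega> * Y j \<omega>)"
      by (auto simp: Y_def)
    have "expectation (\<lambda>\<omega>. V (j + 2) \<omega> * (Y i \<omega> * W j \<omega>)) = expectation (\<lambda>\<omega>. V (j + 2) \<omega>) * expectation (\<lambda>\<omega>. Y i \<omega> * W j \<omega>)"
      by (rule expectation_mult_past(2)[where g="\<lambda>v. v", OF _ Wj])
         (auto intro!: integrable_mult_if_squares Y2_int sq V_integrable)
    then show ?thesis
      unfolding eq by (simp add: centred)
  qed
qed

lemma martingale_strong_law:
  assumes W: "\<And>k. W k \<in> borel_measurable (past (k + 2))" and W4: "bounded_fourth_moment M W"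
  shows "AE \<omega> in M. (\<lambda>n. (\<Sum>k<n. V (k + 2) \<omega> * W k \<omega>) / n) \<longlonglongrightarrow> 0"
proof -
  obtain K where K: "\<And>n. integrable M (\<lambda>\<omega>. (W n \<omega>)\<^sup>2)" "\<And>n. expectation (\<lambda>\<omega>. (W n \<omega>)\<^sup>2) \<le> K"
    by (rule bounded_second_moment[OF W4]) (rule that, auto)
  show ?thesis
    by (rule strong_law_orthogonal[OF martingale_differences(1,2,4,3)[OF W K]])
qed

lemma martingale_variance:
  assumes W: "\<And>k. W k \<in> borel_measurable (past (k + 2))" and W4: "bounded_fourth_moment M W"
  obtains K where "\<And>n. integrable M (\<lambda>\<omega>. (\<Sum>k<n. V (k + 2) \<omega> * W k \<omega>)\<^sup>2)"
    "\<And>n. expectation (\<lambda>\<omega>. (\<Sum>k<n. V (k + 2) \<omega> * W k \<omega>)\<^sup>2) \<le> K * real n"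
proof -
  obtain K where K: "\<And>n. integrable M (\<lambda>\<omega>. (W n \<omega>)\<^sup>2)" "\<And>n. expectation (\<lambda>\<omega>. (W n \<omega>)\<^sup>2) \<le> K"
    by (rule bounded_second_moment[OF W4]) (rule that, auto)
  show thesis
  proof
    show "integrable M (\<lambda>\<omega>. (\<Sum>k<n. V (k + 2) \<omega> * W k \<omega>)\<^sup>2)" for n
      by (rule orthogonal_sum_second_moment(1)[OF martingale_differences(1,2,4,3)[OF W K]]) auto
    have "expectation (\<lambda>\<omega>. (\<Sum>k<n. V (k + 2) \<omega> * W k \<omega>)\<^sup>2) \<le> \<sigma>\<^sup>2 * K * real (card {..<n})" for n
      by (rule orthogonal_sum_second_moment(2)[OF martingale_differences(1,2,4,3)[OF W K]]) auto
    then show "expectation (\<lambda>\<omega>. (\<Sum>k<n. V (k + 2) \<omega> * W k \<omega>)\<^sup>2) \<le> \<sigma>\<^sup>2 * K * real n" for n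
      by simp
  qed
qed

lemma V_square_strong_law: "AE \<omega> in M. (\<lambda>n. (\<Sum>k<n. (V (k + 2) \<omega>)\<^sup>2) / n) \<longlonglongrightarrow> \<sigma>\<^sup>2"
proof -
  let ?Y = "\<lambda>k \<omega>. (V (k + 2) \<omega>)\<^sup>2 - \<sigma>\<^sup>2"
  let ?g = "\<lambda>v. v\<^sup>2 - \<sigma>\<^sup>2"
  have Y2: "(?g v)\<^sup>2 = v ^ 4 - 2 * \<sigma>\<^sup>2 * v\<^sup>2 + \<sigma> ^ 4" for v :: real
    by (simp add: power2_eq_square power4_eq_xxxx algebra_simps)
  have int: "integrable M (\<lambda>\<omega>. (?Y k \<omega>)\<^sup>2)" for k
    unfolding Y2 by (intro Bochner_Integration.integrable_add Bochner_Integration.integrable_diff integrable_mult_right)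
      (auto intro: fourth_moment V_square)
  have "AE \<omega> in M. (\<lambda>n. (\<Sum>i<n. ?Y i \<omega>) / real n) \<longlonglongrightarrow> 0"
  proof (rule strong_law_orthogonal[OF _ int])
    show "expectation (\<lambda>\<omega>. (?Y k \<omega>)\<^sup>2) \<le> expectation (\<lambda>\<omega>. (?g (V 1 \<omega>))\<^sup>2)" for k
      using integral_V_eq(1)[of "k + 2" "\<lambda>v. (?g v)\<^sup>2"] by simp
    show "expectation (\<lambda>\<omega>. ?Y i \<omega> * ?Y j \<omega>) = 0" if "i < j" for i j
    proof -
      have Yi: "?Y i \<in> borel_measurable (past (j + 2))"
        using V_past[of "i + 2" "j + 2"] that by simp
      have "expectation (\<lambda>\<omega>. ?g (V (j + 2) \<omega>) * ?Y i \<omega>) = expectation (\<lambda>\<omega>. ?g (V (j + 2) \<omega>)) * expectation (?Y i)"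
        by (rule expectation_mult_past(2)[OF _ Yi]) (auto intro!: V_square)
      also have "expectation (\<lambda>\<omega>. ?g (V (j + 2) \<omega>)) = 0"
        by (simp add: V_square prob_space)
      finally show ?thesis by (simp add: mult.commute)
    qed
  qed measurable
  then show ?thesis
  proof eventually_elim
    case (elim \<omega>)
    then have "(\<lambda>n. (\<Sum>i<n. ?Y i \<omega>) / real n + \<sigma>\<^sup>2) \<longlonglongrightarrow> 0 + \<sigma>\<^sup>2"
      by (intro tendsto_add tendsto_const)
    moreover have "\<forall>\<^sub>F n in sequentially. (\<Sum>i<n. ?Y i \<omega>) / real n + \<sigma>\<^sup>2 = (\<Sum>k<n. (V (k + 2) \<omega>)\<^sup>2) / n"
      using eventually_gt_at_top[of 0] by eventually_elim (simp add: sum_subtractf diff_divide_distrib)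
    ultimately show ?case by (simp add: tendsto_cong)
  qed
qed

end

section \<open>A central limit theorem for martingale transforms\<close>

lemma exp_minus_second_order:
  fixes x :: real
  assumes "0 \<le> x"
  shows "\<bar>exp (- x) - (1 - x)\<bar> \<le> x\<^sup>2 / 2"
proof -
  have ge: "1 - x \<le> exp (- x)"
    using exp_ge_add_one_self[of "- x"] by simp
  have "exp (- x) \<le> 1 - x + x\<^sup>2 / 2"
  proof -
    let ?f = "\<lambda>x::real. 1 - x + x\<^sup>2 / 2 - exp (- x)"
    have "?f 0 \<le> ?f x"
    proof (rule DERIV_nonneg_imp_nondecreasing[OF assms])
      fix y :: real assume "0 \<le> y" "y \<le> x"
      have "(?f has_real_derivative (y - 1 + exp (- y))) (at y)"
        by (auto intro!: derivative_eq_intros)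
      moreover have "0 \<le> y - 1 + exp (- y)"
        using exp_ge_add_one_self[of "- y"] by simp
      ultimately show "\<exists>z. (?f has_real_derivative z) (at y) \<and> 0 \<le> z"
        by blast
    qed
    then show ?thesis by simp
  qed
  with ge show ?thesis by simp
qed

lemma cubed_abs_le_fourth_power: "\<bar>x::real\<bar> ^ 3 \<le> 1 + x ^ 4"
proof (cases "\<bar>x\<bar> \<le> 1")
  case True
  then have "\<bar>x\<bar> ^ 3 \<le> 1"
    by (intro power_le_one) auto
  moreover have "0 \<le> x ^ 4"
    by simp
  ultimately show ?thesis by linarith
next
  case False
  then have "\<bar>x\<bar> ^ 3 \<le> \<bar>x\<bar> ^ 4"
    by (intro power_increasing) auto
  then show ?thesis by (simp add: power_abs)
qed

context innovations
begin

text \<open>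
  The characteristic function of \<open>V\<close> and the Gaussian one agree up to second order. Multiplying by
  the inverse of the Gaussian one keeps the error cubic as long as \<open>u\<close> stays bounded.
\<close>

lemma char_expansion:
  obtains C where "0 \<le> C" "\<And>u. \<bar>u\<bar> \<le> u0 \<Longrightarrow> norm (\<phi> u * exp (u\<^sup>2 * \<sigma>\<^sup>2 / 2) - 1) \<le> C * \<bar>u\<bar> ^ 3"
proof -
  define m3 where "m3 = expectation (\<lambda>\<omega>. \<bar>V 1 \<omega>\<bar> ^ 3)"
  have m3_int: "integrable M (\<lambda>\<omega>. \<bar>V 1 \<omega>\<bar> ^ 3)"
  proof (rule Bochner_Integration.integrable_bound)
    show "integrable M (\<lambda>\<omega>. 1 + V 1 \<omega> ^ 4)"
      using fourth_moment[of 1] by simp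
    show "AE \<omega> in M. norm (\<bar>V 1 \<omega>\<bar> ^ 3) \<le> norm (1 + V 1 \<omega> ^ 4)"
      by (auto intro!: cubed_abs_le_fourth_power)
  qed (use V_meas[of 1] in simp)
  have m3: "0 \<le> m3"
    unfolding m3_def by (rule Bochner_Integration.integral_nonneg) simp
  define u1 where "u1 = max u0 0"
  define C where "C = exp (u1\<^sup>2 * \<sigma>\<^sup>2 / 2) * (m3 / 6 + u1 * \<sigma> ^ 4 / 8)"
  show thesis
  proof
    show "0 \<le> C"
      using m3 by (simp add: C_def u1_def)
    fix u :: real assume "\<bar>u\<bar> \<le> u0"
    then have u: "\<bar>u\<bar> \<le> u1" by (simp add: u1_def)
    let ?e = "u\<^sup>2 * \<sigma>\<^sup>2 / 2"
    have "cmod (\<phi> u - (1 - u^2 * \<sigma>\<^sup>2 / 2)) \<le>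
        (u^2 / 6) * expectation (\<lambda>x. min (6 * (V 1 x)^2) (\<bar>u\<bar> * \<bar>V 1 x\<bar>^3))"
      by (rule char_approx3') (use V_meas[of 1] V_integrable[of 1] V_square(1)[of 1] centred[of 1] var[of 1] in auto)
    also have "\<dots> \<le> (u^2 / 6) * (\<bar>u\<bar> * m3)"
    proof (intro mult_left_mono)
      have "expectation (\<lambda>x. min (6 * (V 1 x)^2) (\<bar>u\<bar> * \<bar>V 1 x\<bar>^3)) \<le> expectation (\<lambda>x. \<bar>u\<bar> * \<bar>V 1 x\<bar>^3)"
        by (rule integral_mono) (use m3_int V_square(1)[of 1] in auto)
      then show "expectation (\<lambda>x. min (6 * (V 1 x)^2) (\<bar>u\<bar> * \<bar>V 1 x\<bar>^3)) \<le> \<bar>u\<bar> * m3"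
        by (simp add: m3_def)
    qed simp
    also have "\<dots> = (m3 / 6) * \<bar>u\<bar> ^ 3"
      by (simp add: power3_eq_cube power2_eq_square)
    finally have 1: "cmod (\<phi> u - of_real (1 - ?e)) \<le> (m3 / 6) * \<bar>u\<bar> ^ 3"
      by simp
    have "\<bar>exp (- ?e) - (1 - ?e)\<bar> \<le> ?e\<^sup>2 / 2"
      by (rule exp_minus_second_order) simp
    also have "?e\<^sup>2 / 2 = \<bar>u\<bar> * (\<sigma> ^ 4 / 8) * \<bar>u\<bar> ^ 3"
      by (simp add: power_divide power_mult_distrib power2_eq_square power3_eq_cube power4_eq_xxxx)
    also have "\<dots> \<le> u1 * (\<sigma> ^ 4 / 8) * \<bar>u\<bar> ^ 3"
      using u by (intro mult_right_mono) auto
    finally have 2: "cmod (of_real (exp (- ?e)) - of_real (1 - ?e)) \<le> u1 * (\<sigma> ^ 4 / 8) * \<bar>u\<bar> ^ 3"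
      by (simp only: of_real_diff[symmetric] norm_of_real)
    have "cmod (\<phi> u - of_real (exp (- ?e))) \<le> (m3 / 6 + u1 * \<sigma> ^ 4 / 8) * \<bar>u\<bar> ^ 3"
      using norm_triangle_ineq4[of "\<phi> u - of_real (1 - ?e)" "of_real (exp (- ?e)) - of_real (1 - ?e)"] 1 2
      by (simp add: distrib_right)
    then have "exp ?e * cmod (\<phi> u - of_real (exp (- ?e))) \<le> exp (u1\<^sup>2 * \<sigma>\<^sup>2 / 2) * ((m3 / 6 + u1 * \<sigma> ^ 4 / 8) * \<bar>u\<bar> ^ 3)"
    proof (intro mult_mono)
      have "u\<^sup>2 \<le> u1\<^sup>2"
        using u power_mono[of "\<bar>u\<bar>" u1 2] by simp
      then show "exp ?e \<le> exp (u1\<^sup>2 * \<sigma>\<^sup>2 / 2)"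
        by (simp add: mult_right_mono)
    qed auto
    also have "exp ?e * cmod (\<phi> u - of_real (exp (- ?e))) = cmod (of_real (exp ?e) * (\<phi> u - of_real (exp (- ?e))))"
      by (simp add: norm_mult)
    also have "of_real (exp ?e) * (\<phi> u - of_real (exp (- ?e))) = \<phi> u * of_real (exp ?e) - 1"
      by (simp add: right_diff_distrib exp_minus flip: of_real_mult)
    finally show "norm (\<phi> u * exp ?e - 1) \<le> C * \<bar>u\<bar> ^ 3"
      by (simp add: C_def mult.assoc)
  qed
qed

text \<open>
  If the conditional variances were deterministic, the exponential of \<open>\<i> t S\<close> divided by the
  product of the Gaussian characteristic functions of the increments would have expectation close
  to one, each step costing an error of third order by \<open>char_expansion\<close>. Here they are random, but
  the same compensated exponential works once it is kept bounded: the weights are set to zero as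
  soon as their accumulated squares exceed \<open>c n\<close>, a decision that depends on the past only. Almost
  surely the truncation is eventually inactive, and one application of dominated convergence
  replaces the random compensator by its limit.
\<close>

theorem martingale_clt:
  assumes W: "\<And>k. W k \<in> borel_measurable (past (k + 2))" and W4: "bounded_fourth_moment M W"
    and W_var: "AE \<omega> in M. (\<lambda>n. (\<Sum>k<n. (W k \<omega>)\<^sup>2) / n) \<longlonglongrightarrow> w"
  shows "(\<lambda>n. expectation (\<lambda>\<omega>. iexp (t * ((\<Sum>k<n. V (k + 2) \<omega> * W k \<omega>) / sqrt n))))
           \<longlonglongrightarrow> exp (- (t\<^sup>2 * \<sigma>\<^sup>2 * w / 2))"
proof -
  interpret V1: real_distribution "distr M borel (V 1)"
    using V_meas[of 1] by simp
  define c where "c = \<bar>w\<bar> + 1"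
  have c: "0 < c" "w < c" by (auto simp: c_def)
  define b where "b = t\<^sup>2 * \<sigma>\<^sup>2 / 2"
  have b: "0 \<le> b" by (simp add: b_def)
  (* The truncated weights. The sum includes W k itself, so that the accumulated squares of H
     never exceed c n, and H n k is still known before the noise V (k + 2) it multiplies. *)
  define H where "H n k \<omega> = (if (\<Sum>j<Suc k. (W j \<omega>)\<^sup>2) \<le> c * real n then W k \<omega> else 0)" for n k \<omega>
  define S where "S n k \<omega> = (\<Sum>j<k. V (j + 2) \<omega> * H n j \<omega>) / sqrt (real n)" for n k \<omega>
  define Q where "Q n k \<omega> = (\<Sum>j<k. (H n j \<omega>)\<^sup>2) / real n" for n k \<omega>
  (* The compensated exponential: a martingale up to third-order errors, with modulus at
     most exp (b * c). *)
  define U where "U n k \<omega> = iexp (t * S n k \<omega>) * of_real (exp (b * Q n k \<omega>))" for n k \<omega>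
  define Y where "Y n \<omega> = iexp (t * ((\<Sum>k<n. V (k + 2) \<omega> * W k \<omega>) / sqrt n))" for n \<omega>
  have W_past: "W j \<in> borel_measurable (past (k + 2))" if "j \<le> k" for j k
    by (rule past_mono[OF _ W]) (use that in simp)
  have H_past: "H n j \<in> borel_measurable (past (k + 2))" if "j \<le> k" for n j k
  proof -
    have [measurable]: "(\<lambda>\<omega>. \<Sum>i<Suc j. (W i \<omega>)\<^sup>2) \<in> borel_measurable (past (k + 2))"
      by (intro borel_measurable_sum borel_measurable_power) (use that W_past in auto)
    have [measurable]: "W j \<in> borel_measurable (past (k + 2))"
      by (rule W_past[OF that])
    show ?thesis
      unfolding H_def[abs_def] by measurable
  qed
  have V_past': "V (j + 2) \<in> borel_measurable (past (k + 2))" if "j < k" for j k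
    using that by (intro V_past) auto
  have U_past: "U n k \<in> borel_measurable (past (k + 2))" for n k
  proof -
    have [measurable]: "S n k \<in> borel_measurable (past (k + 2))"
      unfolding S_def[abs_def]
      by (intro borel_measurable_divide borel_measurable_sum borel_measurable_times borel_measurable_const V_past' H_past) auto
    have [measurable]: "Q n k \<in> borel_measurable (past (k + 2))"
      unfolding Q_def[abs_def]
      by (intro borel_measurable_divide borel_measurable_sum borel_measurable_power borel_measurable_const H_past) auto
    show ?thesis
      unfolding U_def[abs_def] by measurable
  qed
  have [measurable]: "W k \<in> borel_measurable M" "H n k \<in> borel_measurable M" "U n k \<in> borel_measurable M" for n k
    by (rule past_measurable[OF W] past_measurable[OF H_past[OF order_refl]] past_measurable[OF U_past])+
  have [measurable]: "Y n \<in> borel_measurable M" for n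
    unfolding Y_def[abs_def] by measurable
  have H_sum: "(\<Sum>j<k. (H n j \<omega>)\<^sup>2) \<le> c * real n" for n k \<omega>
  proof (induction k)
    case (Suc k)
    show ?case
    proof (cases "(\<Sum>j<Suc k. (W j \<omega>)\<^sup>2) \<le> c * real n")
      case True
      have "(\<Sum>j<Suc k. (H n j \<omega>)\<^sup>2) \<le> (\<Sum>j<Suc k. (W j \<omega>)\<^sup>2)"
        by (intro sum_mono) (simp add: H_def)
      with True show ?thesis by linarith
    next
      case False
      then have "H n k \<omega> = 0" by (simp only: H_def if_False)
      with Suc show ?thesis by simp
    qed
  qed (use c in simp)
  have Q_bound: "Q n k \<omega> \<le> c" for n k \<omega>
  proof (cases "n = 0")
    case False
    moreover have "(\<Sum>j<k. (H n j \<omega>)\<^sup>2) \<le> c * real n"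
      by (rule H_sum)
    ultimately show ?thesis
      by (simp add: Q_def divide_le_eq)
  qed (use c in \<open>simp add: Q_def\<close>)
  define B where "B = exp (b * c)"
  have U_bound: "norm (U n k \<omega>) \<le> B" for n k \<omega>
    using b Q_bound[of n k \<omega>] by (simp add: U_def B_def norm_mult mult_left_mono)
  have H_bound: "\<bar>t * H n k \<omega> / sqrt (real n)\<bar> \<le> \<bar>t\<bar> * sqrt c" if "n > 0" for n k \<omega>
  proof -
    have "(H n k \<omega>)\<^sup>2 \<le> (\<Sum>j<Suc k. (H n j \<omega>)\<^sup>2)"
      by (rule member_le_sum) auto
    also have "\<dots> \<le> c * real n"
      by (rule H_sum)
    finally have "\<bar>H n k \<omega>\<bar> \<le> sqrt c * sqrt (real n)"
      by (metis real_sqrt_le_iff real_sqrt_abs real_sqrt_mult)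
    then have "\<bar>H n k \<omega>\<bar> / sqrt (real n) \<le> sqrt c"
      using that by (simp add: divide_le_eq)
    then show ?thesis
      by (simp add: abs_mult mult_left_mono flip: times_divide_eq_right)
  qed
  obtain C where C: "0 \<le> C"
    "\<And>u. \<bar>u\<bar> \<le> \<bar>t\<bar> * sqrt c \<Longrightarrow> norm (\<phi> u * exp (u\<^sup>2 * \<sigma>\<^sup>2 / 2) - 1) \<le> C * \<bar>u\<bar> ^ 3"
    by (rule char_expansion[of "\<bar>t\<bar> * sqrt c"]) (rule that, auto)
  obtain K where K: "\<And>k. integrable M (\<lambda>\<omega>. W k \<omega> ^ 4)" "\<And>k. expectation (\<lambda>\<omega>. W k \<omega> ^ 4) \<le> K" "0 \<le> K"
    by (rule bounded_fourth_momentE[OF W4]) (rule that, auto)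
  define L where "L = B * (C * (\<bar>t\<bar> ^ 3 * (1 + K)))"
  (* Integrating out V (k + 2) turns the increment of U into U times the error that
     char_expansion controls. The bound is of order n powr (-3/2), so n steps leave
     n powr (-1/2). *)
  have step: "norm (expectation (U n (Suc k)) - expectation (U n k)) \<le> L / (real n * sqrt (real n))" if "n > 0" for n k
  proof -
    define G where "G \<omega> = t * H n k \<omega> / sqrt (real n)" for \<omega>
    define F where "F \<omega> = U n k \<omega> * of_real (exp ((G \<omega>)\<^sup>2 * \<sigma>\<^sup>2 / 2))" for \<omega>
    have G_past: "G \<in> borel_measurable (past (k + 2))"
      unfolding G_def[abs_def] using H_past[OF order_refl] by measurable
    have F_past: "F \<in> borel_measurable (past (k + 2))"
      unfolding F_def[abs_def] using U_past G_past by measurable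
    note [measurable] = past_measurable[OF G_past] past_measurable[OF F_past]
    have U_Suc: "U n (Suc k) \<omega> = F \<omega> * iexp (V (k + 2) \<omega> * G \<omega>)" for \<omega>
    proof -
      have "t * S n (Suc k) \<omega> = t * S n k \<omega> + V (k + 2) \<omega> * G \<omega>"
        by (simp add: S_def G_def add_divide_distrib distrib_left)
      moreover have "b * Q n (Suc k) \<omega> = b * Q n k \<omega> + (G \<omega>)\<^sup>2 * \<sigma>\<^sup>2 / 2"
        by (simp add: Q_def G_def b_def add_divide_distrib distrib_left power_divide power_mult_distrib ac_simps)
      ultimately show ?thesis
        unfolding U_def F_def by (simp add: exp_add ring_distribs)
    qed
    have F_bound: "norm (F \<omega>) \<le> B * exp ((\<bar>t\<bar> * sqrt c)\<^sup>2 * \<sigma>\<^sup>2 / 2)" for \<omega>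
    proof -
      have "(G \<omega>)\<^sup>2 \<le> (\<bar>t\<bar> * sqrt c)\<^sup>2"
        using H_bound[OF \<open>n > 0\<close>, of k \<omega>] c by (intro abs_le_square_iff[THEN iffD1]) (simp add: G_def)
      then show ?thesis
        unfolding F_def norm_mult by (intro mult_mono U_bound) (auto simp: B_def mult_right_mono divide_right_mono)
    qed
    have "expectation (U n (Suc k)) = expectation (\<lambda>\<omega>. F \<omega> * \<phi> (G \<omega>))"
      unfolding U_Suc[abs_def] by (rule expectation_char_past[OF _ F_past F_bound G_past]) simp
    moreover have "integrable M (U n k)"
      by (rule integrable_const_bound[of _ B]) (use U_bound in auto)
    moreover have F\<phi>_int: "integrable M (\<lambda>\<omega>. F \<omega> * \<phi> (G \<omega>))"
    proof (rule integrable_const_bound)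
      show "AE \<omega> in M. norm (F \<omega> * \<phi> (G \<omega>)) \<le> B * exp ((\<bar>t\<bar> * sqrt c)\<^sup>2 * \<sigma>\<^sup>2 / 2) * 1"
        unfolding norm_mult
        by (intro AE_I2 mult_mono F_bound V1.cmod_char_le_1) (auto simp: B_def)
      show "(\<lambda>\<omega>. F \<omega> * \<phi> (G \<omega>)) \<in> borel_measurable M"
        using V1.char_measurable by measurable
    qed
    ultimately have "expectation (U n (Suc k)) - expectation (U n k) = expectation (\<lambda>\<omega>. F \<omega> * \<phi> (G \<omega>) - U n k \<omega>)"
      by simp
    also have "norm \<dots> \<le> expectation (\<lambda>\<omega>. norm (F \<omega> * \<phi> (G \<omega>) - U n k \<omega>))"
      by (rule integral_norm_bound)
    also have "\<dots> \<le> expectation (\<lambda>\<omega>. B * (C * (\<bar>t\<bar> ^ 3 * (1 + W k \<omega> ^ 4))) / (real n * sqrt (real n)))"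
    proof (rule integral_mono)
      show "integrable M (\<lambda>\<omega>. norm (F \<omega> * \<phi> (G \<omega>) - U n k \<omega>))"
        using F\<phi>_int \<open>integrable M (U n k)\<close> by (intro integrable_norm Bochner_Integration.integrable_diff)
      show "integrable M (\<lambda>\<omega>. B * (C * (\<bar>t\<bar> ^ 3 * (1 + W k \<omega> ^ 4))) / (real n * sqrt (real n)))"
        using K(1) by (intro integrable_divide integrable_mult_right Bochner_Integration.integrable_add) auto
      fix \<omega>
      have "F \<omega> * \<phi> (G \<omega>) - U n k \<omega> = U n k \<omega> * (\<phi> (G \<omega>) * exp ((G \<omega>)\<^sup>2 * \<sigma>\<^sup>2 / 2) - 1)"
        by (simp add: F_def algebra_simps)
      then have "norm (F \<omega> * \<phi> (G \<omega>) - U n k \<omega>) = norm (U n k \<omega>) * norm (\<phi> (G \<omega>) * exp ((G \<omega>)\<^sup>2 * \<sigma>\<^sup>2 / 2) - 1)"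
        by (simp only: norm_mult)
      also have "\<dots> \<le> B * (C * \<bar>G \<omega>\<bar> ^ 3)"
        using H_bound[OF \<open>n > 0\<close>, of k \<omega>]
        by (intro mult_mono U_bound C) (auto simp: B_def G_def)
      also have "\<bar>G \<omega>\<bar> ^ 3 \<le> \<bar>t\<bar> ^ 3 * (1 + W k \<omega> ^ 4) / (real n * sqrt (real n))"
      proof -
        have "\<bar>H n k \<omega>\<bar> ^ 3 \<le> 1 + W k \<omega> ^ 4"
          using cubed_abs_le_fourth_power[of "W k \<omega>"] by (simp add: H_def)
        moreover have "\<bar>G \<omega>\<bar> ^ 3 = \<bar>t\<bar> ^ 3 * \<bar>H n k \<omega>\<bar> ^ 3 / (real n * sqrt (real n))"
        proof -
          have "sqrt (real n) ^ 3 = real n * sqrt (real n)"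
            by (simp add: power3_eq_cube)
          then show ?thesis
            by (simp add: G_def abs_mult power_mult_distrib power_divide)
        qed
        ultimately show ?thesis
          by (simp add: divide_right_mono mult_left_mono)
      qed
      finally show "norm (F \<omega> * \<phi> (G \<omega>) - U n k \<omega>) \<le> B * (C * (\<bar>t\<bar> ^ 3 * (1 + W k \<omega> ^ 4))) / (real n * sqrt (real n))"
        using C(1) by (simp add: B_def mult_left_mono)
    qed
    also have "\<dots> = B * (C * (\<bar>t\<bar> ^ 3 * (1 + expectation (\<lambda>\<omega>. W k \<omega> ^ 4)))) / (real n * sqrt (real n))"
      using K(1)[of k] by (simp add: prob_space)
    also have "\<dots> \<le> L / (real n * sqrt (real n))"
      unfolding L_def using C(1) K(2)[of k]
      by (intro divide_right_mono mult_left_mono) (auto simp: B_def)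
    finally show ?thesis .
  qed
  have total: "norm (expectation (U n n) - 1) \<le> L / sqrt (real n)" if "n > 0" for n
  proof -
    have "norm (expectation (U n m) - 1) \<le> real m * (L / (real n * sqrt (real n)))" for m
    proof (induction m)
      case 0
      have "expectation (U n 0) = 1"
        unfolding U_def[abs_def] by (simp add: S_def Q_def prob_space)
      then show ?case by simp
    next
      case (Suc m)
      have "norm (expectation (U n (Suc m)) - 1) \<le> norm (expectation (U n (Suc m)) - expectation (U n m)) + norm (expectation (U n m) - 1)"
        using norm_triangle_ineq[of "expectation (U n (Suc m)) - expectation (U n m)" "expectation (U n m) - 1"] by simp
      also have "\<dots> \<le> L / (real n * sqrt (real n)) + real m * (L / (real n * sqrt (real n)))"
        by (intro add_mono step[OF that] Suc)
      also have "\<dots> = real (Suc m) * (L / (real n * sqrt (real n)))"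
        by (simp only: of_nat_Suc distrib_right mult_1)
      finally show ?case .
    qed
    from this[of n] show ?thesis using that by simp
  qed
  have "(\<lambda>n. expectation (U n n) - 1) \<longlonglongrightarrow> 0"
  proof (rule Lim_null_comparison)
    show "\<forall>\<^sub>F n in sequentially. norm (expectation (U n n) - 1) \<le> L / sqrt (real n)"
      using eventually_gt_at_top[of 0] by eventually_elim (rule total)
    show "(\<lambda>n. L / sqrt (real n)) \<longlonglongrightarrow> 0"
      by real_asymp
  qed
  (* Once the average of the squared weights is below c, the truncation is inactive up to time
     n, and U n n differs from Y n only by the compensator. *)
  moreover have "(\<lambda>n. expectation (\<lambda>\<omega>. U n n \<omega> - of_real (exp (b * w)) * Y n \<omega>)) \<longlonglongrightarrow> expectation (\<lambda>\<omega>. 0)"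
  proof (rule integral_dominated_convergence[where w="\<lambda>_. B + exp (b * w)"])
    show "AE \<omega> in M. norm (U n n \<omega> - of_real (exp (b * w)) * Y n \<omega>) \<le> B + exp (b * w)" for n
    proof (rule AE_I2)
      fix \<omega>
      have "norm (U n n \<omega> - of_real (exp (b * w)) * Y n \<omega>) \<le> norm (U n n \<omega>) + norm (of_real (exp (b * w)) * Y n \<omega>)"
        by (rule norm_triangle_ineq4)
      also have "\<dots> \<le> B + exp (b * w)"
        using U_bound[of n n \<omega>] by (simp add: norm_mult Y_def)
      finally show "norm (U n n \<omega> - of_real (exp (b * w)) * Y n \<omega>) \<le> B + exp (b * w)" .
    qed
    show "AE \<omega> in M. (\<lambda>n. U n n \<omega> - of_real (exp (b * w)) * Y n \<omega>) \<longlonglongrightarrow> 0"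
      using W_var
    proof eventually_elim
      case (elim \<omega>)
      let ?q = "\<lambda>n. (\<Sum>k<n. (W k \<omega>)\<^sup>2) / real n"
      have "(\<lambda>n. exp (b * ?q n) - exp (b * w)) \<longlonglongrightarrow> exp (b * w) - exp (b * w)"
        by (intro tendsto_intros elim)
      then have lim: "(\<lambda>n. \<bar>exp (b * ?q n) - exp (b * w)\<bar>) \<longlonglongrightarrow> 0"
        by (simp add: tendsto_rabs_zero)
      have "\<forall>\<^sub>F n in sequentially. norm (U n n \<omega> - of_real (exp (b * w)) * Y n \<omega>) \<le> \<bar>exp (b * ?q n) - exp (b * w)\<bar>"
        using order_tendstoD(2)[OF elim c(2)] eventually_gt_at_top[of 0]
      proof eventually_elim
        case (elim n)
        have "H n j \<omega> = W j \<omega>" if "j < n" for j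
        proof -
          have "(\<Sum>i<Suc j. (W i \<omega>)\<^sup>2) \<le> (\<Sum>i<n. (W i \<omega>)\<^sup>2)"
            using that by (intro sum_mono2) auto
          also have "\<dots> \<le> c * real n"
            using elim by (simp add: divide_less_eq)
          finally show ?thesis by (simp only: H_def if_True)
        qed
        then have "U n n \<omega> = Y n \<omega> * of_real (exp (b * ?q n))"
          by (simp add: U_def S_def Q_def Y_def)
        then have "U n n \<omega> - of_real (exp (b * w)) * Y n \<omega> = Y n \<omega> * of_real (exp (b * ?q n) - exp (b * w))"
          by (simp add: algebra_simps)
        moreover have "norm (Y n \<omega>) = 1"
          by (simp add: Y_def)
        ultimately show ?case
          by (simp only: norm_mult norm_of_real mult_1 order_refl)
      qed
      then show ?case
        by (rule Lim_null_comparison[OF _ lim])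
    qed
  qed auto
  ultimately have "(\<lambda>n. of_real (exp (- (b * w))) * ((expectation (U n n) - 1) + 1 - expectation (\<lambda>\<omega>. U n n \<omega> - of_real (exp (b * w)) * Y n \<omega>)))
      \<longlonglongrightarrow> of_real (exp (- (b * w))) * (0 + 1 - expectation (\<lambda>\<omega>. 0))"
    by (intro tendsto_intros)
  moreover have "of_real (exp (- (b * w))) * ((expectation (U n n) - 1) + 1 - expectation (\<lambda>\<omega>. U n n \<omega> - of_real (exp (b * w)) * Y n \<omega>)) = expectation (Y n)" for n
  proof -
    have "integrable M (U n n)"
      by (rule integrable_const_bound[of _ B]) (use U_bound in auto)
    moreover have "integrable M (Y n)"
      by (rule integrable_const_bound[of _ 1]) (auto simp: Y_def)
    ultimately show ?thesis
      by (simp add: exp_minus flip: of_real_mult mult.assoc)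
  qed
  ultimately have "(\<lambda>n. expectation (Y n)) \<longlonglongrightarrow> of_real (exp (- (b * w)))"
    by simp
  then show ?thesis
    by (simp add: Y_def[abs_def] b_def exp_of_real)
qed

end

section \<open>Convergence in probability, tightness and weak limits\<close>

context prob_space
begin

text \<open>
  The stochastic \<open>o(1)\<close> and \<open>O(1)\<close> of asymptotic statistics.
\<close>

definition vanishes_in_prob :: "(nat \<Rightarrow> 'a \<Rightarrow> real) \<Rightarrow> bool" where
  "vanishes_in_prob X \<longleftrightarrow> (\<forall>n. random_variable borel (X n)) \<and>
     (\<forall>e>0. (\<lambda>n. prob {\<omega> \<in> space M. e < \<bar>X n \<omega>\<bar>}) \<longlonglongrightarrow> 0)"

definition tight_seq :: "(nat \<Rightarrow> 'a \<Rightarrow> real) \<Rightarrow> bool" where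
  "tight_seq X \<longleftrightarrow> (\<forall>n. random_variable borel (X n)) \<and>
     (\<forall>d>0. \<exists>K>0. \<forall>\<^sub>F n in sequentially. prob {\<omega> \<in> space M. K < \<bar>X n \<omega>\<bar>} < d)"

lemma vanishes_in_probD:
  assumes "vanishes_in_prob X"
  shows "random_variable borel (X n)"
    and "e > 0 \<Longrightarrow> (\<lambda>n. prob {\<omega> \<in> space M. e < \<bar>X n \<omega>\<bar>}) \<longlonglongrightarrow> 0"
  using assms unfolding vanishes_in_prob_def by blast+

lemma tight_seqD:
  assumes "tight_seq X"
  shows "random_variable borel (X n)"
    and "d > 0 \<Longrightarrow> \<exists>K>0. \<forall>\<^sub>F n in sequentially. prob {\<omega> \<in> space M. K < \<bar>X n \<omega>\<bar>} < d"
  using assms unfolding tight_seq_def by blast+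

lemma tight_seq_cong:
  assumes "tight_seq Y" and "\<And>n \<omega>. \<omega> \<in> space M \<Longrightarrow> Y n \<omega> = Z n \<omega>" and "\<And>n. random_variable borel (Z n)"
  shows "tight_seq Z"
proof -
  have "{\<omega> \<in> space M. K < \<bar>Y n \<omega>\<bar>} = {\<omega> \<in> space M. K < \<bar>Z n \<omega>\<bar>}" for K n
    using assms(2) by auto
  with assms(1,3) show ?thesis
    unfolding tight_seq_def by simp
qed

lemma vanishes_in_prob_if_AE:
  assumes [measurable]: "\<And>n. random_variable borel (X n)"
    and lim: "AE \<omega> in M. (\<lambda>n. X n \<omega>) \<longlonglongrightarrow> 0"
  shows "vanishes_in_prob X"
  unfolding vanishes_in_prob_def
proof (intro conjI allI impI)
  fix e :: real assume e: "e > 0"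
  have "(\<lambda>n. expectation (indicator {\<omega> \<in> space M. e < \<bar>X n \<omega>\<bar>})) \<longlonglongrightarrow> expectation (\<lambda>_. 0 :: real)"
  proof (rule integral_dominated_convergence[where w="\<lambda>_. 1"])
    show "AE \<omega> in M. (\<lambda>n. indicator {\<omega> \<in> space M. e < \<bar>X n \<omega>\<bar>} \<omega> :: real) \<longlonglongrightarrow> 0"
      using lim
    proof eventually_elim
      case (elim \<omega>)
      have "\<forall>\<^sub>F n in sequentially. indicator {\<omega> \<in> space M. e < \<bar>X n \<omega>\<bar>} \<omega> = (0 :: real)"
        using order_tendstoD(2)[OF tendsto_rabs_zero[OF elim] e] by eventually_elim (simp add: indicator_def)
      then show ?case by (rule tendsto_eventually)
    qed
  qed (auto simp: indicator_def)
  then show "(\<lambda>n. prob {\<omega> \<in> space M. e < \<bar>X n \<omega>\<bar>}) \<longlonglongrightarrow> 0"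
    by simp
qed simp

lemma tight_seq_if_vanishes:
  assumes "vanishes_in_prob X"
  shows "tight_seq X"
  unfolding tight_seq_def
proof (intro conjI allI impI vanishes_in_probD[OF assms])
  fix d :: real assume "d > 0"
  with order_tendstoD(2)[OF vanishes_in_probD(2)[OF assms, of 1]]
  show "\<exists>K>0. \<forall>\<^sub>F n in sequentially. prob {\<omega> \<in> space M. K < \<bar>X n \<omega>\<bar>} < d"
    by (intro exI[of _ 1]) simp
qed

lemma tight_seq_if_bounded_second_moment:
  assumes meas [measurable]: "\<And>n. random_variable borel (X n)"
    and int: "\<And>n. integrable M (\<lambda>\<omega>. (X n \<omega>)\<^sup>2)" and bound: "\<And>n. expectation (\<lambda>\<omega>. (X n \<omega>)\<^sup>2) \<le> K"
  shows "tight_seq X"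
  unfolding tight_seq_def
proof (intro conjI allI impI)
  fix d :: real assume d: "d > 0"
  have K: "0 \<le> K"
    using bound[of 0] Bochner_Integration.integral_nonneg[of M "\<lambda>\<omega>. (X 0 \<omega>)\<^sup>2"] by (meson order_trans zero_le_power2)
  define a where "a = sqrt ((K + 1) / d)"
  have a: "a > 0" and a2: "a\<^sup>2 = (K + 1) / d"
    using K d by (auto simp: a_def)
  have "prob {\<omega> \<in> space M. a < \<bar>X n \<omega>\<bar>} < d" for n
  proof -
    have "prob {\<omega> \<in> space M. a < \<bar>X n \<omega>\<bar>} \<le> prob {\<omega> \<in> space M. a \<le> \<bar>X n \<omega>\<bar>}"
      by (intro finite_measure_mono) auto
    also have "\<dots> \<le> expectation (\<lambda>\<omega>. (X n \<omega>)\<^sup>2) / a\<^sup>2"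
      by (rule second_moment_method[OF meas int a])
    also have "\<dots> \<le> K / a\<^sup>2"
      by (intro divide_right_mono bound) simp
    also have "\<dots> < d"
      using K d unfolding a2 by (simp add: field_simps)
    finally show ?thesis .
  qed
  then show "\<exists>K>0. \<forall>\<^sub>F n in sequentially. prob {\<omega> \<in> space M. K < \<bar>X n \<omega>\<bar>} < d"
    using a by (intro exI[of _ a]) simp
qed simp

lemma prob_subset_Un:
  assumes "{\<omega> \<in> space M. P \<omega>} \<subseteq> {\<omega> \<in> space M. Q \<omega>} \<union> {\<omega> \<in> space M. R \<omega>}"
    and "{\<omega> \<in> space M. Q \<omega>} \<in> events" "{\<omega> \<in> space M. R \<omega>} \<in> events"
  shows "prob {\<omega> \<in> space M. P \<omega>} \<le> prob {\<omega> \<in> space M. Q \<omega>} + prob {\<omega> \<in> space M. R \<omega>}"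
  using finite_measure_mono[OF assms(1)] measure_Un_le[OF assms(2,3)] assms(2,3)
  by (meson order_trans sets.Un)

lemma vanishes_in_prob_add:
  assumes X: "vanishes_in_prob X" and Y: "vanishes_in_prob Y"
  shows "vanishes_in_prob (\<lambda>n \<omega>. X n \<omega> + Y n \<omega>)"
  unfolding vanishes_in_prob_def
proof (intro conjI allI impI)
  note [measurable] = vanishes_in_probD(1)[OF X] vanishes_in_probD(1)[OF Y]
  show "random_variable borel (\<lambda>\<omega>. X n \<omega> + Y n \<omega>)" for n
    by measurable
  fix e :: real assume e: "e > 0"
  have lim: "(\<lambda>n. prob {\<omega> \<in> space M. e / 2 < \<bar>X n \<omega>\<bar>} + prob {\<omega> \<in> space M. e / 2 < \<bar>Y n \<omega>\<bar>}) \<longlonglongrightarrow> 0"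
    using tendsto_add[OF vanishes_in_probD(2)[OF X, of "e / 2"] vanishes_in_probD(2)[OF Y, of "e / 2"]] e by simp
  have "prob {\<omega> \<in> space M. e < \<bar>X n \<omega> + Y n \<omega>\<bar>} \<le>
      prob {\<omega> \<in> space M. e / 2 < \<bar>X n \<omega>\<bar>} + prob {\<omega> \<in> space M. e / 2 < \<bar>Y n \<omega>\<bar>}" for n
    by (rule prob_subset_Un) auto
  then show "(\<lambda>n. prob {\<omega> \<in> space M. e < \<bar>X n \<omega> + Y n \<omega>\<bar>}) \<longlonglongrightarrow> 0"
    by (intro Lim_null_comparison[OF _ lim] always_eventually) simp
qed

lemma tight_seq_add:
  assumes X: "tight_seq X" and Y: "tight_seq Y"
  shows "tight_seq (\<lambda>n \<omega>. X n \<omega> + Y n \<omega>)"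
  unfolding tight_seq_def
proof (intro conjI allI impI)
  note [measurable] = tight_seqD(1)[OF X] tight_seqD(1)[OF Y]
  show "random_variable borel (\<lambda>\<omega>. X n \<omega> + Y n \<omega>)" for n
    by measurable
  fix d :: real assume d: "d > 0"
  obtain K where K: "K > 0" "\<forall>\<^sub>F n in sequentially. prob {\<omega> \<in> space M. K < \<bar>X n \<omega>\<bar>} < d / 2"
    using tight_seqD(2)[OF X, of "d / 2"] d by auto
  obtain L where L: "L > 0" "\<forall>\<^sub>F n in sequentially. prob {\<omega> \<in> space M. L < \<bar>Y n \<omega>\<bar>} < d / 2"
    using tight_seqD(2)[OF Y, of "d / 2"] d by auto
  have "\<forall>\<^sub>F n in sequentially. prob {\<omega> \<in> space M. K + L < \<bar>X n \<omega> + Y n \<omega>\<bar>} < d"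
    using K(2) L(2)
  proof eventually_elim
    case (elim n)
    have "prob {\<omega> \<in> space M. K + L < \<bar>X n \<omega> + Y n \<omega>\<bar>} \<le>
        prob {\<omega> \<in> space M. K < \<bar>X n \<omega>\<bar>} + prob {\<omega> \<in> space M. L < \<bar>Y n \<omega>\<bar>}"
      by (rule prob_subset_Un) auto
    with elim show ?case by linarith
  qed
  with K(1) L(1) show "\<exists>K>0. \<forall>\<^sub>F n in sequentially. prob {\<omega> \<in> space M. K < \<bar>X n \<omega> + Y n \<omega>\<bar>} < d"
    by (intro exI[of _ "K + L"]) simp
qed

lemma abs_mult_greaterD:
  fixes x y :: real
  assumes "a * b < \<bar>x * y\<bar>" "0 \<le> a" "0 \<le> b"
  shows "a < \<bar>x\<bar> \<or> b < \<bar>y\<bar>"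
proof (rule ccontr)
  assume "\<not> ?thesis"
  then have "\<bar>x\<bar> * \<bar>y\<bar> \<le> a * b"
    using assms(2) by (intro mult_mono) auto
  with assms(1) show False by (simp add: abs_mult)
qed

lemma tight_seq_mult:
  assumes X: "tight_seq X" and Y: "tight_seq Y"
  shows "tight_seq (\<lambda>n \<omega>. X n \<omega> * Y n \<omega>)"
  unfolding tight_seq_def
proof (intro conjI allI impI)
  note [measurable] = tight_seqD(1)[OF X] tight_seqD(1)[OF Y]
  show "random_variable borel (\<lambda>\<omega>. X n \<omega> * Y n \<omega>)" for n
    by measurable
  fix d :: real assume d: "d > 0"
  obtain K where K: "K > 0" "\<forall>\<^sub>F n in sequentially. prob {\<omega> \<in> space M. K < \<bar>X n \<omega>\<bar>} < d / 2"
    using tight_seqD(2)[OF X, of "d / 2"] d by auto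
  obtain L where L: "L > 0" "\<forall>\<^sub>F n in sequentially. prob {\<omega> \<in> space M. L < \<bar>Y n \<omega>\<bar>} < d / 2"
    using tight_seqD(2)[OF Y, of "d / 2"] d by auto
  have "\<forall>\<^sub>F n in sequentially. prob {\<omega> \<in> space M. K * L < \<bar>X n \<omega> * Y n \<omega>\<bar>} < d"
    using K(2) L(2)
  proof eventually_elim
    case (elim n)
    have "prob {\<omega> \<in> space M. K * L < \<bar>X n \<omega> * Y n \<omega>\<bar>} \<le>
        prob {\<omega> \<in> space M. K < \<bar>X n \<omega>\<bar>} + prob {\<omega> \<in> space M. L < \<bar>Y n \<omega>\<bar>}"
      using abs_mult_greaterD[of K L] K(1) L(1) by (intro prob_subset_Un) fastforce+
    with elim show ?case by linarith
  qed
  with K(1) L(1) show "\<exists>K>0. \<forall>\<^sub>F n in sequentially. prob {\<omega> \<in> space M. K < \<bar>X n \<omega> * Y n \<omega>\<bar>} < d"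
    by (intro exI[of _ "K * L"]) simp
qed

lemma vanishes_in_prob_mult_tight:
  assumes X: "vanishes_in_prob X" and Y: "tight_seq Y"
  shows "vanishes_in_prob (\<lambda>n \<omega>. X n \<omega> * Y n \<omega>)"
  unfolding vanishes_in_prob_def
proof (intro conjI allI impI)
  note [measurable] = vanishes_in_probD(1)[OF X] tight_seqD(1)[OF Y]
  show "random_variable borel (\<lambda>\<omega>. X n \<omega> * Y n \<omega>)" for n
    by measurable
  fix e :: real assume e: "e > 0"
  show "(\<lambda>n. prob {\<omega> \<in> space M. e < \<bar>X n \<omega> * Y n \<omega>\<bar>}) \<longlonglongrightarrow> 0"
  proof (rule order_tendstoI)
    fix d :: real assume d: "0 < d"
    obtain L where L: "L > 0" "\<forall>\<^sub>F n in sequentially. prob {\<omega> \<in> space M. L < \<bar>Y n \<omega>\<bar>} < d / 2"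
      using tight_seqD(2)[OF Y, of "d / 2"] d by auto
    have "\<forall>\<^sub>F n in sequentially. prob {\<omega> \<in> space M. e / L < \<bar>X n \<omega>\<bar>} < d / 2"
      using order_tendstoD(2)[OF vanishes_in_probD(2)[OF X, of "e / L"], of "d / 2"] e d L(1) by simp
    with L(2) show "\<forall>\<^sub>F n in sequentially. prob {\<omega> \<in> space M. e < \<bar>X n \<omega> * Y n \<omega>\<bar>} < d"
    proof eventually_elim
      case (elim n)
      have "prob {\<omega> \<in> space M. e < \<bar>X n \<omega> * Y n \<omega>\<bar>} \<le>
          prob {\<omega> \<in> space M. e / L < \<bar>X n \<omega>\<bar>} + prob {\<omega> \<in> space M. L < \<bar>Y n \<omega>\<bar>}"
        using abs_mult_greaterD[of "e / L" L] L(1) e by (intro prob_subset_Un) fastforce+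
      with elim show ?case by linarith
    qed
  qed (auto intro!: always_eventually intro: less_le_trans)
qed

text \<open>
  Slutsky's argument: \<open>x \<mapsto> iexp (t x)\<close> is bounded and Lipschitz, so the two expectations differ
  little where \<open>Z\<close> and \<open>G\<close> are close, and the remaining event has small probability.
\<close>

lemma char_tendsto_if_vanishing_difference:
  fixes Z G :: "nat \<Rightarrow> 'a \<Rightarrow> real"
  assumes [measurable]: "\<And>n. random_variable borel (Z n)" "\<And>n. random_variable borel (G n)"
    and diff: "vanishes_in_prob (\<lambda>n \<omega>. Z n \<omega> - G n \<omega>)"
    and lim: "(\<lambda>n. expectation (\<lambda>\<omega>. iexp (t * G n \<omega>))) \<longlonglongrightarrow> l"
  shows "(\<lambda>n. expectation (\<lambda>\<omega>. iexp (t * Z n \<omega>))) \<longlonglongrightarrow> l"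
proof -
  have iexp_diff: "norm (iexp a - iexp b) \<le> min 2 \<bar>a - b\<bar>" for a b :: real
  proof -
    have "iexp a - iexp b = iexp b * (iexp (a - b) - 1)"
      by (simp add: right_diff_distrib ring_distribs flip: exp_add)
    moreover have "norm (iexp (a - b) - 1) \<le> \<bar>a - b\<bar>"
      using iexp_approx1[of "a - b" 0] by simp
    moreover have "norm (iexp a - iexp b) \<le> 2"
      using norm_triangle_ineq4[of "iexp a" "iexp b"] by simp
    ultimately show ?thesis
      by (simp add: norm_mult)
  qed
  have "(\<lambda>n. expectation (\<lambda>\<omega>. iexp (t * Z n \<omega>)) - expectation (\<lambda>\<omega>. iexp (t * G n \<omega>))) \<longlonglongrightarrow> 0"
  proof (rule tendstoI)
    fix d :: real assume d: "d > 0"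
    define e where "e = d / (2 * (\<bar>t\<bar> + 1))"
    have e: "e > 0"
      using d by (simp add: e_def)
    have te: "\<bar>t\<bar> * e \<le> d / 2"
    proof -
      have "\<bar>t\<bar> * e = (d / 2) * (\<bar>t\<bar> / (\<bar>t\<bar> + 1))"
        by (simp add: e_def)
      also have "\<dots> \<le> (d / 2) * 1"
        using d by (intro mult_left_mono) (simp_all add: divide_le_eq)
      finally show ?thesis by simp
    qed
    let ?A = "\<lambda>n. {\<omega> \<in> space M. e < \<bar>Z n \<omega> - G n \<omega>\<bar>}"
    have "\<forall>\<^sub>F n in sequentially. prob (?A n) < d / 4"
      using order_tendstoD(2)[OF vanishes_in_probD(2)[OF diff e], of "d / 4"] d by simp
    then show "\<forall>\<^sub>F n in sequentially. dist (expectation (\<lambda>\<omega>. iexp (t * Z n \<omega>)) - expectation (\<lambda>\<omega>. iexp (t * G n \<omega>))) 0 < d"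
    proof eventually_elim
      case (elim n)
      have int: "integrable M (\<lambda>\<omega>. iexp (t * Z n \<omega>))" "integrable M (\<lambda>\<omega>. iexp (t * G n \<omega>))"
        by (rule integrable_const_bound[of _ 1]; simp)+
      have A [measurable]: "?A n \<in> events"
        by measurable
      have "norm (expectation (\<lambda>\<omega>. iexp (t * Z n \<omega>)) - expectation (\<lambda>\<omega>. iexp (t * G n \<omega>)))
          = norm (expectation (\<lambda>\<omega>. iexp (t * Z n \<omega>) - iexp (t * G n \<omega>)))"
        using int by simp
      also have "\<dots> \<le> expectation (\<lambda>\<omega>. norm (iexp (t * Z n \<omega>) - iexp (t * G n \<omega>)))"
        by (rule integral_norm_bound)
      also have "\<dots> \<le> expectation (\<lambda>\<omega>. \<bar>t\<bar> * e + 2 * indicator (?A n) \<omega>)"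
      proof (rule integral_mono)
        show "integrable M (\<lambda>\<omega>. norm (iexp (t * Z n \<omega>) - iexp (t * G n \<omega>)))"
          using int by (intro integrable_norm Bochner_Integration.integrable_diff)
        show "integrable M (\<lambda>\<omega>. \<bar>t\<bar> * e + 2 * indicator (?A n) \<omega>)"
          using A by (intro Bochner_Integration.integrable_add integrable_mult_right integrable_real_indicator) (auto simp: emeasure_eq_measure)
        fix \<omega> assume \<omega>: "\<omega> \<in> space M"
        show "norm (iexp (t * Z n \<omega>) - iexp (t * G n \<omega>)) \<le> \<bar>t\<bar> * e + 2 * indicator (?A n) \<omega>"
        proof (cases "\<omega> \<in> ?A n")
          case True
          have "0 \<le> \<bar>t\<bar> * e" using e by simp
          then show ?thesis
            using True iexp_diff[of "t * Z n \<omega>" "t * G n \<omega>"] by simp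
        next
          case False
          then have "\<bar>t\<bar> * \<bar>Z n \<omega> - G n \<omega>\<bar> \<le> \<bar>t\<bar> * e"
            using \<omega> by (intro mult_left_mono) auto
          then have "\<bar>t * Z n \<omega> - t * G n \<omega>\<bar> \<le> \<bar>t\<bar> * e"
            by (simp add: abs_mult flip: right_diff_distrib)
          with False show ?thesis
            using iexp_diff[of "t * Z n \<omega>" "t * G n \<omega>"] by simp
        qed
      qed
      also have "\<dots> = \<bar>t\<bar> * e + 2 * prob (?A n)"
        using A by (subst Bochner_Integration.integral_add) (auto simp: prob_space emeasure_eq_measure)
      finally show ?case
        using elim te by simp
    qed
  qed
  from tendsto_add[OF this lim] show ?thesis by simp
qed

end

lemma chi_square_1: "chi_square 1 = distr std_normal_distribution borel (\<lambda>x. x\<^sup>2)"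
proof -
  interpret N: prob_space std_normal_distribution
    by (rule real_distribution.axioms(1)[OF real_dist_normal_dist])
  interpret product_prob_space "\<lambda>_. std_normal_distribution" "{..<1::nat}"
    by unfold_locales
  have "distr (PiM {..<1::nat} (\<lambda>_. std_normal_distribution)) std_normal_distribution (\<lambda>z. z 0) = std_normal_distribution"
    by (rule PiM_component) simp
  then have "distr std_normal_distribution borel (\<lambda>x. x\<^sup>2) =
      distr (distr (PiM {..<1::nat} (\<lambda>_. std_normal_distribution)) std_normal_distribution (\<lambda>z. z 0)) borel (\<lambda>x. x\<^sup>2)"
    by simp
  also have "\<dots> = distr (PiM {..<1::nat} (\<lambda>_. std_normal_distribution)) borel (\<lambda>z. (z 0)\<^sup>2)"
    by (subst distr_distr) (auto simp: comp_def)
  finally show ?thesis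
    by (simp add: chi_square_def lessThan_Suc)
qed

lemma weak_conv_m_continuous_image:
  fixes h :: "real \<Rightarrow> real"
  assumes "\<And>n. real_distribution (P n)" "real_distribution P'" "weak_conv_m P P'"
    and cont: "continuous_on UNIV h"
  shows "weak_conv_m (\<lambda>n. distr (P n) borel h) (distr P' borel h)"
proof -
  interpret P: real_distribution "P n" for n by fact
  interpret P': real_distribution P' by fact
  have h [measurable]: "h \<in> borel_measurable borel"
    using cont by (rule borel_measurable_continuous_onI)
  show ?thesis
  proof (rule integral_bdd_continuous_conv_imp_weak_conv)
    show "real_distribution (distr (P n) borel h)" for n
      by (rule P.real_distribution_distr) simp
    show "real_distribution (distr P' borel h)"
      by (rule P'.real_distribution_distr) simp
    fix f :: "real \<Rightarrow> real" assume f: "\<And>x. isCont f x" "\<And>x. \<bar>f x\<bar> \<le> 1"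
    have [measurable]: "f \<in> borel_measurable borel"
      using f(1) by (intro borel_measurable_continuous_onI) (simp add: continuous_on_eq_continuous_at)
    have "(\<lambda>n. \<integral>x. f (h x) \<partial>P n) \<longlonglongrightarrow> (\<integral>x. f (h x) \<partial>P')"
    proof (rule weak_conv_imp_integral_bdd_continuous_conv[OF assms(1-3)])
      show "isCont (\<lambda>x. f (h x)) x" for x
        using cont f(1) by (intro isCont_o2[of _ h f]) (simp_all add: continuous_on_eq_continuous_at)
      show "norm (f (h x)) \<le> 1" for x
        using f(2) by simp
    qed
    then show "(\<lambda>n. integral\<^sup>L (distr (P n) borel h) f) \<longlonglongrightarrow> integral\<^sup>L (distr P' borel h) f"
      by (simp add: integral_distr)
  qed
qed

section \<open>Arbitrary starting values are forgotten\<close>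

text \<open>
  Both homogeneous recursions contract. The rate \<open>r\<close> lies strictly above both coefficients:
  for \<open>\<bar>\<theta>\<bar> = \<bar>\<rho>\<bar>\<close> the common value itself may fail, as \<open>D n\<close> can behave like \<open>n \<theta> ^ n\<close>.
\<close>

lemma ar1_forgets_start:
  fixes D \<delta> :: "nat \<Rightarrow> real"
  assumes stable: "\<bar>\<theta>\<bar> < 1" "\<bar>\<rho>\<bar> < 1"
    and D: "\<And>n. D (Suc n) = \<theta> * D n + \<delta> (Suc n)" and \<delta>: "\<And>n. \<delta> (Suc n) = \<rho> * \<delta> n"
  obtains C r where "0 \<le> r" "r < 1" "\<And>n. \<bar>D n\<bar> \<le> C * r ^ n"
proof -
  define r where "r = (1 + max \<bar>\<theta>\<bar> \<bar>\<rho>\<bar>) / 2"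
  have r: "0 < r" "r < 1" "\<bar>\<theta>\<bar> < r" "\<bar>\<rho>\<bar> < r"
    using stable by (auto simp: r_def max_def field_simps)
  define C where "C = \<bar>D 0\<bar> + \<bar>\<delta> 0\<bar> / (r - \<bar>\<theta>\<bar>)"
  have C: "\<bar>\<theta>\<bar> * C + \<bar>\<delta> 0\<bar> \<le> r * C"
  proof -
    have "\<bar>\<delta> 0\<bar> = (r - \<bar>\<theta>\<bar>) * (\<bar>\<delta> 0\<bar> / (r - \<bar>\<theta>\<bar>))"
      using r by simp
    also have "\<dots> \<le> (r - \<bar>\<theta>\<bar>) * C"
      using r by (intro mult_left_mono) (auto simp: C_def)
    finally show ?thesis by (simp add: algebra_simps)
  qed
  have \<delta>_le: "\<bar>\<delta> n\<bar> \<le> \<bar>\<delta> 0\<bar> * r ^ n" for n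
  proof (induction n)
    case (Suc n)
    have "\<bar>\<delta> (Suc n)\<bar> = \<bar>\<rho>\<bar> * \<bar>\<delta> n\<bar>"
      by (simp add: \<delta> abs_mult)
    also have "\<dots> \<le> r * (\<bar>\<delta> 0\<bar> * r ^ n)"
      using Suc r by (intro mult_mono) auto
    finally show ?case by (simp add: mult_ac)
  qed simp
  have "\<bar>D n\<bar> \<le> C * r ^ n" for n
  proof (induction n)
    case 0
    then show ?case using r by (simp add: C_def)
  next
    case (Suc n)
    have "\<bar>D (Suc n)\<bar> \<le> \<bar>\<theta>\<bar> * \<bar>D n\<bar> + \<bar>\<delta> (Suc n)\<bar>"
      by (simp add: D flip: abs_mult)
    also have "\<dots> \<le> \<bar>\<theta>\<bar> * (C * r ^ n) + \<bar>\<delta> 0\<bar> * r ^ n"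
    proof (intro add_mono mult_left_mono Suc)
      have "\<bar>\<delta> 0\<bar> * r ^ Suc n \<le> \<bar>\<delta> 0\<bar> * r ^ n"
        using r by (intro mult_left_mono power_decreasing) auto
      with \<delta>_le[of "Suc n"] show "\<bar>\<delta> (Suc n)\<bar> \<le> \<bar>\<delta> 0\<bar> * r ^ n" by linarith
    qed simp
    also have "\<dots> = (\<bar>\<theta>\<bar> * C + \<bar>\<delta> 0\<bar>) * r ^ n"
      by (simp add: algebra_simps)
    also have "\<dots> \<le> (r * C) * r ^ n"
      using C r by (intro mult_right_mono) auto
    finally show ?case by (simp add: mult_ac)
  qed
  then show thesis
    using r by (intro that[of r C]) auto
qed

text \<open>
  The noise grows at most linearly, so a geometric factor makes the products summable.
\<close>

lemma summable_noise_times_decay: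
  fixes v d :: "nat \<Rightarrow> real"
  assumes v: "(\<lambda>n. (v n)\<^sup>2 / n) \<longlonglongrightarrow> 0" and r: "0 \<le> r" "r < 1" and d: "\<And>n. \<bar>d n\<bar> \<le> C * r ^ n"
  shows "summable (\<lambda>k. v (k + 2) * d k)"
proof -
  have "Bseq (\<lambda>n. (v n)\<^sup>2 / n)"
    using v by (intro convergent_imp_Bseq) (auto simp: convergent_def)
  then obtain K where K: "K > 0" "\<And>n. norm ((v n)\<^sup>2 / real n) \<le> K"
    by (auto elim: BseqE)
  have v_le: "\<bar>v (k + 2)\<bar> \<le> (K + 1) * (2 * real (Suc k))" for k
  proof -
    have "(v (k + 2))\<^sup>2 \<le> K * real (k + 2)"
      using K(2)[of "k + 2"] by (simp add: divide_le_eq)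
    also have "\<dots> \<le> ((K + 1) * real (k + 2))\<^sup>2"
    proof -
      have "K * real (k + 2) \<le> (K + 1) * real (k + 2)"
        by (intro mult_right_mono) auto
      moreover have "1 \<le> (K + 1) * real (k + 2)"
        using K(1) mult_mono[of 1 "K + 1" 1 "real (k + 2)"] by simp
      then have "(K + 1) * real (k + 2) \<le> ((K + 1) * real (k + 2))\<^sup>2"
        by (rule self_le_power) simp
      ultimately show ?thesis by linarith
    qed
    finally have "\<bar>v (k + 2)\<bar> \<le> \<bar>(K + 1) * real (k + 2)\<bar>"
      by (simp only: abs_le_square_iff)
    also have "\<dots> = (K + 1) * real (k + 2)"
      using K(1) by (simp add: abs_mult)
    also have "\<dots> \<le> (K + 1) * (2 * real (Suc k))"
      using K(1) by (intro mult_left_mono) auto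
    finally show ?thesis .
  qed
  have C: "0 \<le> C"
    using d[of 0] by simp
  have "summable (\<lambda>k. (2 * (K + 1) * C) * (real (Suc k) * r ^ k))"
    using geometric_deriv_sums[of r] r by (intro summable_mult) (auto simp: sums_iff)
  then show ?thesis
  proof (rule summable_comparison_test')
    fix k
    have "norm (v (k + 2) * d k) \<le> ((K + 1) * (2 * real (Suc k))) * (C * r ^ k)"
      unfolding real_norm_def abs_mult using v_le[of k] d[of k] K(1) by (intro mult_mono) auto
    then show "norm (v (k + 2) * d k) \<le> (2 * (K + 1) * C) * (real (Suc k) * r ^ k)"
      by (simp only: mult_ac)
  qed
qed

lemma decay_shift:
  fixes d :: "nat \<Rightarrow> real"
  assumes "\<And>n. \<bar>d n\<bar> \<le> C * r ^ n"
  shows "\<bar>d (n + 1)\<bar> \<le> (C * r) * r ^ n"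
  using assms[of "n + 1"] by (simp add: mult_ac)

lemma decay_tendsto_0:
  fixes d :: "nat \<Rightarrow> real"
  assumes "0 \<le> r" "r < 1" "\<And>n. \<bar>d n\<bar> \<le> C * r ^ n"
  shows "d \<longlonglongrightarrow> 0"
proof (rule Lim_null_comparison)
  show "\<forall>\<^sub>F n in sequentially. norm (d n) \<le> C * r ^ n"
    using assms(3) by simp
  show "(\<lambda>n. C * r ^ n) \<longlonglongrightarrow> 0"
    using LIMSEQ_realpow_zero[OF assms(1,2)] by (rule tendsto_mult_right_zero)
qed

text \<open>
  All the averages in \<open>ar2_path\<close> change by convergent series or decaying squares divided by \<open>n\<close>.
\<close>

lemma ar2_path_forgets_start:
  assumes y: "ar2_path y v \<theta> \<rho> s" and v: "(\<lambda>n. (v n)\<^sup>2 / n) \<longlonglongrightarrow> 0"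
    and rec: "\<And>k. x (k + 2) = (\<theta> + \<rho>) * x (k + 1) - \<theta> * \<rho> * x k + v (k + 2)"
    and r: "0 \<le> r" "r < 1" and d: "\<And>n. \<bar>x n - y n\<bar> \<le> C * r ^ n"
  shows "ar2_path x v \<theta> \<rho> s"
proof -
  interpret y: ar2_path y v \<theta> \<rho> s by fact
  have negl: "(\<lambda>n. (\<Sum>k<n. f k) / real n) \<longlonglongrightarrow> 0" if "summable f" for f :: "nat \<Rightarrow> real"
    using tendsto_mult[OF summable_LIMSEQ[OF that] lim_inverse_n] by (simp add: divide_inverse)
  note sum1 = summable_noise_times_decay[OF v r, OF decay_shift[OF d]]
  note sum0 = summable_noise_times_decay[OF v r d]
  show ?thesis
  proof
    have split: "(\<Sum>k<n. v (k + 2) * x (g k)) / n = (\<Sum>k<n. v (k + 2) * y (g k)) / n + (\<Sum>k<n. v (k + 2) * (x (g k) - y (g k))) / n"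
      for n :: nat and g :: "nat \<Rightarrow> nat"
      unfolding add_divide_distrib[symmetric] sum.distrib[symmetric] by (simp add: algebra_simps)
    show "(\<lambda>n. (\<Sum>k<n. v (k + 2) * x (k + 1)) / n) \<longlonglongrightarrow> 0"
      using tendsto_add[OF y.noise_lag1 negl[OF sum1]] unfolding split by simp
    show "(\<lambda>n. (\<Sum>k<n. v (k + 2) * x k) / n) \<longlonglongrightarrow> 0"
      using tendsto_add[OF y.noise_lag2 negl[OF sum0]] unfolding split[of "\<lambda>k. k"] by simp
    show "(\<lambda>n. (x n)\<^sup>2 / n) \<longlonglongrightarrow> 0"
    proof (rule Lim_null_comparison)
      have "(x n)\<^sup>2 / n \<le> 2 * ((y n)\<^sup>2 / n) + 2 * ((x n - y n)\<^sup>2 * inverse (real n))" for n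
      proof -
        have "(x n)\<^sup>2 \<le> 2 * (y n)\<^sup>2 + 2 * (x n - y n)\<^sup>2"
          using zero_le_power2[of "2 * y n - x n"] by (simp add: power2_eq_square algebra_simps)
        then have "(x n)\<^sup>2 / n \<le> (2 * (y n)\<^sup>2 + 2 * (x n - y n)\<^sup>2) / n"
          by (intro divide_right_mono) auto
        then show ?thesis
          by (simp add: add_divide_distrib divide_inverse distrib_right mult.assoc)
      qed
      then show "\<forall>\<^sub>F n in sequentially. norm ((x n)\<^sup>2 / n) \<le> 2 * ((y n)\<^sup>2 / n) + 2 * ((x n - y n)\<^sup>2 * inverse (real n))"
        by simp
      have "(\<lambda>n. 2 * ((y n)\<^sup>2 / n) + 2 * ((x n - y n)\<^sup>2 * inverse (real n))) \<longlonglongrightarrow> 2 * 0 + 2 * (0\<^sup>2 * 0)"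
        by (intro tendsto_intros y.sq_negligible decay_tendsto_0[OF r d] lim_inverse_n)
      then show "(\<lambda>n. 2 * ((y n)\<^sup>2 / n) + 2 * ((x n - y n)\<^sup>2 * inverse (real n))) \<longlonglongrightarrow> 0"
        by simp
    qed
  qed (fact y.stable y.s_pos rec y.noise_var)+
qed

section \<open>The Durbin-Watson statistic of the autoregression\<close>

locale autoregression = innovations M V \<sigma> for M :: "'a measure" and V \<sigma> +
  fixes X \<epsilon> :: "nat \<Rightarrow> 'a \<Rightarrow> real" and \<theta> \<rho> :: real
  assumes stable: "\<bar>\<theta>\<bar> < 1" "\<bar>\<rho>\<bar> < 1" and \<sigma>: "\<sigma>\<^sup>2 > 0"
    and X_0: "X 0 \<in> borel_measurable M" and \<epsilon>_0: "\<epsilon> 0 \<in> borel_measurable M"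
    and X_Suc: "\<omega> \<in> space M \<Longrightarrow> X (Suc n) \<omega> = \<theta> * X n \<omega> + \<epsilon> (Suc n) \<omega>"
    and \<epsilon>_Suc: "\<omega> \<in> space M \<Longrightarrow> \<epsilon> (Suc n) \<omega> = \<rho> * \<epsilon> n \<omega> + V (Suc n) \<omega>"
begin

lemma \<epsilon>_meas [measurable]: "\<epsilon> n \<in> borel_measurable M"
proof (induction n)
  case (Suc n)
  then have "(\<lambda>\<omega>. \<rho> * \<epsilon> n \<omega> + V (Suc n) \<omega>) \<in> borel_measurable M" by measurable
  moreover have "\<epsilon> (Suc n) \<in> borel_measurable M \<longleftrightarrow> (\<lambda>\<omega>. \<rho> * \<epsilon> n \<omega> + V (Suc n) \<omega>) \<in> borel_measurable M"
    by (rule measurable_cong) (rule \<epsilon>_Suc)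
  ultimately show ?case by (rule iffD2[rotated])
qed (rule \<epsilon>_0)

lemma X_meas [measurable]: "X n \<in> borel_measurable M"
proof (induction n)
  case (Suc n)
  then have "(\<lambda>\<omega>. \<theta> * X n \<omega> + \<epsilon> (Suc n) \<omega>) \<in> borel_measurable M" by measurable
  moreover have "X (Suc n) \<in> borel_measurable M \<longleftrightarrow> (\<lambda>\<omega>. \<theta> * X n \<omega> + \<epsilon> (Suc n) \<omega>) \<in> borel_measurable M"
    by (rule measurable_cong) (rule X_Suc)
  ultimately show ?case by (rule iffD2[rotated])
qed (rule X_0)

lemma lse_meas [measurable]: "(\<lambda>\<omega>. lse (\<lambda>k. X k \<omega>) n) \<in> borel_measurable M"
  unfolding lse_def by measurable

lemma residual_meas [measurable]: "(\<lambda>\<omega>. residual (\<lambda>k. X k \<omega>) n k) \<in> borel_measurable M"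
  by (cases k) (simp_all add: residual_def)

lemma durbin_watson_meas [measurable]: "(\<lambda>\<omega>. durbin_watson (\<lambda>k. X k \<omega>) n) \<in> borel_measurable M"
  unfolding durbin_watson_def by measurable

lemma lag_sum_meas [measurable]: "(\<lambda>\<omega>. lag_sum (\<lambda>k. X k \<omega>) h n) \<in> borel_measurable M"
  unfolding lag_sum_def by measurable

text \<open>
  The process with both starting values replaced by zero. Unlike \<open>X\<close>, its value at time \<open>n\<close> is a
  function of \<open>V 1, \<dots>, V n\<close> alone, which makes the sums below martingales.
\<close>

definition X_rest :: "nat \<Rightarrow> 'a \<Rightarrow> real" where
  "X_rest n \<omega> = ar1 \<theta> (ar1 \<rho> (\<lambda>j. V j \<omega>)) n"

lemma X_rest_past: "n + 1 \<le> m \<Longrightarrow> X_rest n \<in> borel_measurable (past m)"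
proof -
  have "(\<lambda>\<omega>. ar1 \<rho> (\<lambda>j. V j \<omega>) (Suc k)) \<in> borel_measurable (past (Suc (Suc k)))" for k
    by (rule ar1_past) (rule V_past, auto)
  then have "X_rest n \<in> borel_measurable (past (Suc n))"
    unfolding X_rest_def[abs_def] by (rule ar1_past)
  then show "n + 1 \<le> m \<Longrightarrow> X_rest n \<in> borel_measurable (past m)"
    by (rule past_mono[rotated]) simp
qed

lemma X_rest_fourth_moment: "bounded_fourth_moment M X_rest"
proof -
  have "bounded_fourth_moment M (\<lambda>n \<omega>. ar1 \<rho> (\<lambda>j. V j \<omega>) n)"
    by (rule bounded_fourth_moment_ar1[OF stable(2) V_bounded_fourth_moment])
  from bounded_fourth_moment_shift[OF this, of 1]
  have "bounded_fourth_moment M (\<lambda>n \<omega>. ar1 \<rho> (\<lambda>j. V j \<omega>) (Suc n))"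
    by simp
  from bounded_fourth_moment_ar1[OF stable(1) this] show ?thesis
    unfolding X_rest_def[abs_def] .
qed

lemma X_rest_meas [measurable]: "X_rest n \<in> borel_measurable M"
  by (rule past_measurable[OF X_rest_past[OF order_refl]])

lemma X_rest_rec: "X_rest (k + 2) \<omega> = (\<theta> + \<rho>) * X_rest (k + 1) \<omega> - \<theta> * \<rho> * X_rest k \<omega> + V (k + 2) \<omega>"
  by (simp add: X_rest_def algebra_simps)

lemma X_rec:
  assumes "\<omega> \<in> space M"
  shows "X (k + 2) \<omega> = (\<theta> + \<rho>) * X (k + 1) \<omega> - \<theta> * \<rho> * X k \<omega> + V (k + 2) \<omega>"
  using X_Suc[OF assms, of k] X_Suc[OF assms, of "Suc k"] \<epsilon>_Suc[OF assms, of "Suc k"]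
  by (simp add: algebra_simps)

lemma X_minus_X_rest_decay:
  assumes \<omega>: "\<omega> \<in> space M"
  obtains C r where "0 \<le> r" "r < 1" "\<And>n. \<bar>X n \<omega> - X_rest n \<omega>\<bar> \<le> C * r ^ n"
proof (rule ar1_forgets_start[OF stable, of "\<lambda>n. X n \<omega> - X_rest n \<omega>" "\<lambda>n. \<epsilon> n \<omega> - ar1 \<rho> (\<lambda>j. V j \<omega>) n"])
  show "X (Suc n) \<omega> - X_rest (Suc n) \<omega> = \<theta> * (X n \<omega> - X_rest n \<omega>) + (\<epsilon> (Suc n) \<omega> - ar1 \<rho> (\<lambda>j. V j \<omega>) (Suc n))" for n
    using X_Suc[OF \<omega>, of n] by (simp add: X_rest_def algebra_simps)
  show "\<epsilon> (Suc n) \<omega> - ar1 \<rho> (\<lambda>j. V j \<omega>) (Suc n) = \<rho> * (\<epsilon> n \<omega> - ar1 \<rho> (\<lambda>j. V j \<omega>) n)" for n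
    using \<epsilon>_Suc[OF \<omega>, of n] by (simp add: algebra_simps)
qed (rule that)

lemma AE_V_negligible: "AE \<omega> in M. (\<lambda>n. (V n \<omega>)\<^sup>2 / n) \<longlonglongrightarrow> 0"
proof -
  have "AE \<omega> in M. (\<lambda>n. (V (Suc n) \<omega>)\<^sup>2 / n) \<longlonglongrightarrow> 0"
    by (rule AE_square_negligible[OF V_bounded_fourth_moment])
  then show ?thesis
  proof eventually_elim
    case (elim \<omega>)
    have lim: "(\<lambda>n. (V (Suc n) \<omega>)\<^sup>2 / n * (n / Suc n)) \<longlonglongrightarrow> 0 * 1"
      by (intro tendsto_intros elim LIMSEQ_n_over_Suc_n)
    have ev: "\<forall>\<^sub>F n in sequentially. (V (Suc n) \<omega>)\<^sup>2 / n * (n / Suc n) = (V (Suc n) \<omega>)\<^sup>2 / Suc n"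
      using eventually_gt_at_top[of 0] by eventually_elim simp
    from Lim_transform_eventually[OF lim ev] have "(\<lambda>n. (V (Suc n) \<omega>)\<^sup>2 / Suc n) \<longlonglongrightarrow> 0"
      by simp
    then show ?case by (rule LIMSEQ_imp_Suc)
  qed
qed

lemma AE_X_rest_path: "AE \<omega> in M. ar2_path (\<lambda>k. X_rest k \<omega>) (\<lambda>k. V k \<omega>) \<theta> \<rho> (\<sigma>\<^sup>2)"
proof -
  have "AE \<omega> in M. (\<lambda>n. (\<Sum>k<n. V (k + 2) \<omega> * X_rest (k + 1) \<omega>) / n) \<longlonglongrightarrow> 0"
    by (rule martingale_strong_law[OF X_rest_past bounded_fourth_moment_shift[OF X_rest_fourth_moment]]) simp
  moreover have "AE \<omega> in M. (\<lambda>n. (\<Sum>k<n. V (k + 2) \<omega> * X_rest k \<omega>) / n) \<longlonglongrightarrow> 0"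
    by (rule martingale_strong_law) (auto intro: X_rest_past X_rest_fourth_moment)
  ultimately show ?thesis
    using V_square_strong_law AE_square_negligible[OF X_rest_fourth_moment]
  proof eventually_elim
    case (elim \<omega>)
    show ?case
      by unfold_locales (fact stable \<sigma> X_rest_rec elim)+
  qed
qed

lemma AE_X_path: "AE \<omega> in M. ar2_path (\<lambda>k. X k \<omega>) (\<lambda>k. V k \<omega>) \<theta> \<rho> (\<sigma>\<^sup>2)"
  using AE_X_rest_path AE_V_negligible AE_space
proof eventually_elim
  case (elim \<omega>)
  obtain C r where "0 \<le> r" "r < 1" "\<And>n. \<bar>X n \<omega> - X_rest n \<omega>\<bar> \<le> C * r ^ n"
    by (rule X_minus_X_rest_decay[OF elim(3)]) (rule that, auto)
  then show ?case
    by (rule ar2_path_forgets_start[OF elim(1,2) X_rec[OF elim(3)]])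
qed

lemma statistic_diverges_AE:
  assumes "\<theta> \<noteq> 0" "\<rho> \<noteq> 0" "\<theta> \<noteq> - \<rho>"
  shows "AE \<omega> in M. filterlim (\<lambda>n. real n / (4 * (lse (\<lambda>k. X k \<omega>) n)\<^sup>2) * (durbin_watson (\<lambda>k. X k \<omega>) n - 2)\<^sup>2)
    at_top sequentially"
  using AE_X_path by eventually_elim (rule ar2_path.statistic_diverges[OF _ assms])

text \<open>
  The normalised noise sums of \<open>statistic_decomposition\<close>, with \<open>X\<close> replaced by \<open>X_rest\<close>: \<open>score\<close>
  carries the limit law, \<open>score_lag1\<close> governs the error of the estimator.
\<close>

definition score :: "nat \<Rightarrow> 'a \<Rightarrow> real" where
  "score n \<omega> = (\<Sum>k<n. V (k + 2) \<omega> * (X_rest k \<omega> - \<theta> * X_rest (k + 1) \<omega>)) / sqrt n"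

definition score_lag1 :: "nat \<Rightarrow> 'a \<Rightarrow> real" where
  "score_lag1 n \<omega> = (\<Sum>k<n. V (k + 2) \<omega> * X_rest (k + 1) \<omega>) / sqrt n"

lemma score_weight_past: "(\<lambda>\<omega>. X_rest k \<omega> - \<theta> * X_rest (k + 1) \<omega>) \<in> borel_measurable (past (k + 2))"
proof -
  note [measurable] = X_rest_past[of k "k + 2"] X_rest_past[of "k + 1" "k + 2"]
  show ?thesis by measurable
qed

lemma score_weight_fourth_moment: "bounded_fourth_moment M (\<lambda>k \<omega>. X_rest k \<omega> - \<theta> * X_rest (k + 1) \<omega>)"
  using bounded_fourth_moment_lincomb[OF X_rest_fourth_moment bounded_fourth_moment_shift[OF X_rest_fourth_moment, of 1], of 1 "- \<theta>"]
  by simp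

lemma tight_normalised_martingale:
  assumes W: "\<And>k. W k \<in> borel_measurable (past (k + 2))" and W4: "bounded_fourth_moment M W"
  shows "tight_seq (\<lambda>n \<omega>. (\<Sum>k<n. V (k + 2) \<omega> * W k \<omega>) / sqrt n)"
proof -
  have [measurable]: "W k \<in> borel_measurable M" for k
    by (rule past_measurable[OF W])
  obtain K where K: "\<And>n. integrable M (\<lambda>\<omega>. (\<Sum>k<n. V (k + 2) \<omega> * W k \<omega>)\<^sup>2)"
    "\<And>n. expectation (\<lambda>\<omega>. (\<Sum>k<n. V (k + 2) \<omega> * W k \<omega>)\<^sup>2) \<le> K * real n"
    by (rule martingale_variance[OF W W4]) (rule that, auto)
  have sq: "((\<Sum>k<n. V (k + 2) \<omega> * W k \<omega>) / sqrt (real n))\<^sup>2 = (\<Sum>k<n. V (k + 2) \<omega> * W k \<omega>)\<^sup>2 / real n" for n \<omega>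
    by (simp add: power_divide)
  show ?thesis
  proof (rule tight_seq_if_bounded_second_moment)
    show "integrable M (\<lambda>\<omega>. ((\<Sum>k<n. V (k + 2) \<omega> * W k \<omega>) / sqrt (real n))\<^sup>2)" for n
      unfolding sq by (rule integrable_divide[OF K(1)])
    show "expectation (\<lambda>\<omega>. ((\<Sum>k<n. V (k + 2) \<omega> * W k \<omega>) / sqrt (real n))\<^sup>2) \<le> \<bar>K\<bar>" for n
    proof (cases "n = 0")
      case False
      have "expectation (\<lambda>\<omega>. (\<Sum>k<n. V (k + 2) \<omega> * W k \<omega>)\<^sup>2) / real n \<le> K * real n / real n"
        by (intro divide_right_mono K(2)) simp
      also have "\<dots> \<le> \<bar>K\<bar>"
        using False by simp
      finally show ?thesis unfolding sq by simp
    qed simp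
  qed measurable
qed

lemma score_char_tendsto:
  assumes \<rho>: "\<rho> = 0"
  shows "(\<lambda>n. expectation (\<lambda>\<omega>. iexp (t * (score n \<omega> / \<sigma>\<^sup>2)))) \<longlonglongrightarrow> exp (- (t\<^sup>2) / 2)"
proof -
  have "AE \<omega> in M. (\<lambda>n. (\<Sum>k<n. (X_rest k \<omega> - \<theta> * X_rest (k + 1) \<omega>)\<^sup>2) / n) \<longlonglongrightarrow> \<sigma>\<^sup>2"
    using AE_X_rest_path by eventually_elim (rule ar2_path.score_var_tendsto[OF _ \<rho>])
  from martingale_clt[OF score_weight_past score_weight_fourth_moment this, of "t / \<sigma>\<^sup>2"]
  have "(\<lambda>n. expectation (\<lambda>\<omega>. iexp (t / \<sigma>\<^sup>2 * score n \<omega>))) \<longlonglongrightarrow> exp (- ((t / \<sigma>\<^sup>2)\<^sup>2 * \<sigma>\<^sup>2 * \<sigma>\<^sup>2 / 2))"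
    unfolding score_def .
  moreover have "(t / \<sigma>\<^sup>2)\<^sup>2 * \<sigma>\<^sup>2 * \<sigma>\<^sup>2 / 2 = t\<^sup>2 / 2"
  proof -
    have "\<sigma> \<noteq> 0" using \<sigma> by auto
    then show ?thesis by (simp add: power2_eq_square)
  qed
  ultimately show ?thesis
    by simp
qed

text \<open>
  The signed square root of the test statistic; it is this quantity that is asymptotically normal.
\<close>

definition root_statistic :: "nat \<Rightarrow> 'a \<Rightarrow> real" where
  "root_statistic n \<omega> = sqrt n * (durbin_watson (\<lambda>k. X k \<omega>) n - 2) / (2 * lse (\<lambda>k. X k \<omega>) n)"

lemma root_statistic_sq:
  "(root_statistic n \<omega>)\<^sup>2 = real n / (4 * (lse (\<lambda>k. X k \<omega>) n)\<^sup>2) * (durbin_watson (\<lambda>k. X k \<omega>) n - 2)\<^sup>2"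
  by (simp add: root_statistic_def power_divide power_mult_distrib)

lemma root_statistic_meas [measurable]: "root_statistic n \<in> borel_measurable M"
  unfolding root_statistic_def[abs_def] by measurable

lemma score_meas [measurable]: "score n \<in> borel_measurable M" "score_lag1 n \<in> borel_measurable M"
  unfolding score_def[abs_def] score_lag1_def[abs_def] by measurable

lemma lse_consistent_AE:
  assumes \<rho>: "\<rho> = 0"
  shows "AE \<omega> in M. (\<lambda>n. lse (\<lambda>k. X k \<omega>) n) \<longlonglongrightarrow> \<theta>"
  using AE_X_path
  by eventually_elim (metis \<rho> ar2_path.lse_tendsto ar2_path.white_noise_limits(1))

text \<open>
  The last residual equals \<open>V (n + 1) + (\<theta> - lse) X n\<close>. It does not tend to zero, but it stays
  bounded in probability, which suffices after division by \<open>sqrt n\<close>.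
\<close>

lemma tight_last_residual:
  assumes \<rho>: "\<rho> = 0"
  shows "tight_seq (\<lambda>n \<omega>. residual (\<lambda>k. X k \<omega>) (Suc n) (Suc n))"
proof -
  let ?err = "\<lambda>n \<omega>. \<theta> - lse (\<lambda>k. X k \<omega>) (Suc n)"
  have err: "AE \<omega> in M. (\<lambda>n. ?err n \<omega>) \<longlonglongrightarrow> 0"
    using lse_consistent_AE[OF \<rho>]
  proof eventually_elim
    case (elim \<omega>)
    from tendsto_diff[OF tendsto_const[of \<theta>] LIMSEQ_Suc[OF elim]] show ?case by simp
  qed
  obtain K where K: "\<And>n. integrable M (\<lambda>\<omega>. (V (Suc n) \<omega>)\<^sup>2)" "\<And>n. expectation (\<lambda>\<omega>. (V (Suc n) \<omega>)\<^sup>2) \<le> K"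
    by (rule bounded_second_moment[OF V_bounded_fourth_moment]) (rule that, auto)
  obtain L where L: "\<And>n. integrable M (\<lambda>\<omega>. (X_rest n \<omega>)\<^sup>2)" "\<And>n. expectation (\<lambda>\<omega>. (X_rest n \<omega>)\<^sup>2) \<le> L"
    by (rule bounded_second_moment[OF X_rest_fourth_moment]) (rule that, auto)
  have "tight_seq (\<lambda>n. V (Suc n))"
    by (rule tight_seq_if_bounded_second_moment[OF _ K]) measurable
  moreover have "tight_seq (\<lambda>n \<omega>. ?err n \<omega> * X_rest n \<omega>)"
    by (intro tight_seq_if_vanishes vanishes_in_prob_mult_tight vanishes_in_prob_if_AE err
        tight_seq_if_bounded_second_moment[OF _ L]) measurable
  moreover have "tight_seq (\<lambda>n \<omega>. ?err n \<omega> * (X n \<omega> - X_rest n \<omega>))"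
  proof (intro tight_seq_if_vanishes vanishes_in_prob_if_AE)
    show "AE \<omega> in M. (\<lambda>n. ?err n \<omega> * (X n \<omega> - X_rest n \<omega>)) \<longlonglongrightarrow> 0"
      using err AE_space
    proof eventually_elim
      case (elim \<omega>)
      obtain C r where r: "0 \<le> r" "r < 1" "\<And>n. \<bar>X n \<omega> - X_rest n \<omega>\<bar> \<le> C * r ^ n"
        by (rule X_minus_X_rest_decay[OF elim(2)]) (rule that, auto)
      from tendsto_mult[OF elim(1) decay_tendsto_0[OF r]] show ?case by simp
    qed
  qed measurable
  ultimately have "tight_seq (\<lambda>n \<omega>. (V (Suc n) \<omega> + ?err n \<omega> * X_rest n \<omega>) + ?err n \<omega> * (X n \<omega> - X_rest n \<omega>))"
    by (intro tight_seq_add)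
  then show ?thesis
  proof (rule tight_seq_cong)
    fix n \<omega> assume "\<omega> \<in> space M"
    then show "(V (Suc n) \<omega> + ?err n \<omega> * X_rest n \<omega>) + ?err n \<omega> * (X n \<omega> - X_rest n \<omega>) = residual (\<lambda>k. X k \<omega>) (Suc n) (Suc n)"
      using X_Suc[of \<omega> n] \<epsilon>_Suc[of \<omega> n] \<rho> by (simp add: residual_def algebra_simps)
  qed measurable
qed

text \<open>
  The exact formula of \<open>statistic_decomposition\<close>, with the sums over \<open>X\<close> replaced by those over
  \<open>X_rest\<close>. The contributions of the starting values to these sums and the boundary terms at
  time zero converge along almost every trajectory even before the division by \<open>sqrt n\<close>. The
  other terms are kept: their factors \<open>score\<close>, \<open>score_lag1\<close>
  and \<open>e\<close> are bounded in probability only.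
\<close>

lemma root_statistic_expansion:
  assumes \<rho>: "\<rho> = 0" and \<theta>: "\<theta> \<noteq> 0"
  defines "x \<equiv> \<lambda>\<omega> k. X k \<omega>"
  defines "h \<equiv> \<lambda>n \<omega>. lse (x \<omega>) (Suc n)"
    and "q \<equiv> \<lambda>n \<omega>. lag_sum (x \<omega>) 1 n / lag_sum (x \<omega>) 0 (Suc n)"
    and "a \<equiv> \<lambda>n \<omega>. sqrt (Suc n) * sqrt n / (\<Sum>k=0..Suc n. (residual (x \<omega>) (Suc n) k)\<^sup>2)"
    and "e \<equiv> \<lambda>n \<omega>. residual (x \<omega>) (Suc n) (Suc n)"
  shows "AE \<omega> in M. (\<lambda>n. a n \<omega>) \<longlonglongrightarrow> 1 / \<sigma>\<^sup>2"
    and "AE \<omega> in M. (\<lambda>n. q n \<omega>) \<longlonglongrightarrow> \<theta>"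
    and "AE \<omega> in M. (\<lambda>n. h n \<omega>) \<longlonglongrightarrow> \<theta>"
    and "AE \<omega> in M. (\<lambda>n. root_statistic (Suc n) \<omega> - (a n \<omega> * score n \<omega> + a n \<omega> * (\<theta> - q n \<omega>) * score_lag1 n \<omega>
           - a n \<omega> / (2 * h n \<omega> * sqrt n) * (e n \<omega>)\<^sup>2)) \<longlonglongrightarrow> 0"
proof -
  have path_h: "(\<lambda>n. h n \<omega>) \<longlonglongrightarrow> \<theta>" if "ar2_path (x \<omega>) (\<lambda>k. V k \<omega>) \<theta> \<rho> (\<sigma>\<^sup>2)" for \<omega>
  proof -
    interpret ar2_path "x \<omega>" "\<lambda>k. V k \<omega>" \<theta> \<rho> "\<sigma>\<^sup>2" by fact
    show ?thesis
      using LIMSEQ_Suc[OF lse_tendsto] unfolding h_def white_noise_limits(1)[OF \<rho>] .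
  qed
  have path_q: "(\<lambda>n. q n \<omega>) \<longlonglongrightarrow> \<theta>" if "ar2_path (x \<omega>) (\<lambda>k. V k \<omega>) \<theta> \<rho> (\<sigma>\<^sup>2)" for \<omega>
  proof -
    interpret ar2_path "x \<omega>" "\<lambda>k. V k \<omega>" \<theta> \<rho> "\<sigma>\<^sup>2" by fact
    have "(\<lambda>n. (lag_sum (x \<omega>) 1 n / n) * (n / Suc n) / (lag_sum (x \<omega>) 0 (Suc n) / Suc n)) \<longlonglongrightarrow> (lse_lim * x_var) * 1 / x_var"
      by (intro tendsto_intros lag_sum_1 LIMSEQ_Suc[OF lag_sum_0] LIMSEQ_n_over_Suc_n) (use x_var_pos in simp)
    moreover have "\<forall>\<^sub>F n in sequentially. (lag_sum (x \<omega>) 1 n / n) * (n / Suc n) / (lag_sum (x \<omega>) 0 (Suc n) / Suc n) = q n \<omega>"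
      using eventually_gt_at_top[of 0] by eventually_elim (simp add: q_def)
    ultimately have "(\<lambda>n. q n \<omega>) \<longlonglongrightarrow> (lse_lim * x_var) * 1 / x_var"
      by (rule Lim_transform_eventually)
    then show ?thesis
      using x_var_pos white_noise_limits(1)[OF \<rho>] by simp
  qed
  have path_a: "(\<lambda>n. a n \<omega>) \<longlonglongrightarrow> 1 / \<sigma>\<^sup>2" if "ar2_path (x \<omega>) (\<lambda>k. V k \<omega>) \<theta> \<rho> (\<sigma>\<^sup>2)" for \<omega>
  proof -
    interpret ar2_path "x \<omega>" "\<lambda>k. V k \<omega>" \<theta> \<rho> "\<sigma>\<^sup>2" by fact
    have "(\<lambda>n. (\<Sum>k=0..n. (residual (x \<omega>) n k)\<^sup>2) / n) \<longlonglongrightarrow> \<sigma>\<^sup>2"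
      using residual_var_tendsto unfolding white_noise_limits[OF \<rho>] .
    moreover have "(\<lambda>n. sqrt (Suc n) * sqrt n / Suc n) \<longlonglongrightarrow> 1"
      by real_asymp
    ultimately have "(\<lambda>n. (sqrt (Suc n) * sqrt n / Suc n) / ((\<Sum>k=0..Suc n. (residual (x \<omega>) (Suc n) k)\<^sup>2) / Suc n)) \<longlonglongrightarrow> 1 / \<sigma>\<^sup>2"
      using \<sigma> by (intro tendsto_divide LIMSEQ_Suc) auto
    moreover have "(sqrt (Suc n) * sqrt n / Suc n) / (J / Suc n) = sqrt (Suc n) * sqrt n / J" for n :: nat and J :: real
      by simp
    ultimately show ?thesis
      unfolding a_def by (simp only:)
  qed
  show "AE \<omega> in M. (\<lambda>n. h n \<omega>) \<longlonglongrightarrow> \<theta>"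
    using AE_X_path by eventually_elim (rule path_h, simp add: x_def)
  show "AE \<omega> in M. (\<lambda>n. q n \<omega>) \<longlonglongrightarrow> \<theta>"
    using AE_X_path by eventually_elim (rule path_q, simp add: x_def)
  show "AE \<omega> in M. (\<lambda>n. a n \<omega>) \<longlonglongrightarrow> 1 / \<sigma>\<^sup>2"
    using AE_X_path by eventually_elim (rule path_a, simp add: x_def)
  show "AE \<omega> in M. (\<lambda>n. root_statistic (Suc n) \<omega> - (a n \<omega> * score n \<omega> + a n \<omega> * (\<theta> - q n \<omega>) * score_lag1 n \<omega>
           - a n \<omega> / (2 * h n \<omega> * sqrt n) * (e n \<omega>)\<^sup>2)) \<longlonglongrightarrow> 0"
    using AE_X_path AE_V_negligible AE_space
  proof eventually_elim
    case (elim \<omega>)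
    then have path: "ar2_path (x \<omega>) (\<lambda>k. V k \<omega>) \<theta> \<rho> (\<sigma>\<^sup>2)"
      by (simp add: x_def)
    then interpret ar2_path "x \<omega>" "\<lambda>k. V k \<omega>" \<theta> \<rho> "\<sigma>\<^sup>2" .
    obtain C r where r: "0 \<le> r" "r < 1" "\<And>n. \<bar>X n \<omega> - X_rest n \<omega>\<bar> \<le> C * r ^ n"
      by (rule X_minus_X_rest_decay[OF elim(3)]) (rule that, auto)
    define d where "d n = X n \<omega> - X_rest n \<omega>" for n
    have d: "\<And>n. \<bar>d n\<bar> \<le> C * r ^ n"
      using r(3) by (simp add: d_def)
    (* D0 and D1 are the contributions of the starting values to the two noise sums. *)
    define D0 where "D0 n = (\<Sum>k<n. V (k + 2) \<omega> * d k)" for n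
    define D1 where "D1 n = (\<Sum>k<n. V (k + 2) \<omega> * d (k + 1))" for n
    define c where "c = (x \<omega> 1 - \<theta> * x \<omega> 0) * x \<omega> 0"
    obtain l0 l1 where D: "D0 \<longlonglongrightarrow> l0" "D1 \<longlonglongrightarrow> l1"
      using summable_LIMSEQ[OF summable_noise_times_decay[OF elim(2) r(1,2) d]]
        summable_LIMSEQ[OF summable_noise_times_decay[OF elim(2) r(1,2) decay_shift[OF d]]]
      unfolding D0_def[abs_def] D1_def[abs_def] by blast
    have "(\<lambda>n. a n \<omega> * (D0 n - \<theta> * D1 n + (\<theta> - q n \<omega>) * D1 n - q n \<omega> * c - (x \<omega> 0)\<^sup>2 / (2 * h n \<omega>)) * (1 / sqrt (real n)))
       \<longlonglongrightarrow> 1 / \<sigma>\<^sup>2 * (l0 - \<theta> * l1 + (\<theta> - \<theta>) * l1 - \<theta> * c - (x \<omega> 0)\<^sup>2 / (2 * \<theta>)) * 0"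
    proof (intro tendsto_intros D path_a[OF path] path_q[OF path] path_h[OF path])
      show "(\<lambda>n. 1 / sqrt (real n)) \<longlonglongrightarrow> 0" by real_asymp
    qed (use \<theta> in simp)
    then have lim: "(\<lambda>n. a n \<omega> * (D0 n - \<theta> * D1 n + (\<theta> - q n \<omega>) * D1 n - q n \<omega> * c - (x \<omega> 0)\<^sup>2 / (2 * h n \<omega>)) * (1 / sqrt (real n)))
       \<longlonglongrightarrow> 0" by simp
    have "\<forall>\<^sub>F n in sequentially. h n \<omega> \<noteq> 0"
      using tendsto_imp_eventually_ne[OF path_h[OF path] \<theta>] .
    moreover have "\<forall>\<^sub>F n in sequentially. (\<Sum>k=0..Suc n. (residual (x \<omega>) (Suc n) k)\<^sup>2) \<noteq> 0"
      using eventually_sequentially_Suc[THEN iffD2, OF residual_sum_nonzero] .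
    moreover have "\<forall>\<^sub>F n in sequentially. lag_sum (x \<omega>) 0 (Suc n) \<noteq> 0"
      using eventually_sequentially_Suc[THEN iffD2, OF lag_sum_0_nonzero] .
    ultimately have "\<forall>\<^sub>F n in sequentially. a n \<omega> * (D0 n - \<theta> * D1 n + (\<theta> - q n \<omega>) * D1 n - q n \<omega> * c - (x \<omega> 0)\<^sup>2 / (2 * h n \<omega>)) * (1 / sqrt (real n))
      = root_statistic (Suc n) \<omega> - (a n \<omega> * score n \<omega> + a n \<omega> * (\<theta> - q n \<omega>) * score_lag1 n \<omega>
           - a n \<omega> / (2 * h n \<omega> * sqrt n) * (e n \<omega>)\<^sup>2)"
      using eventually_gt_at_top[of 0]
    proof eventually_elim
      case (elim n)
      let ?s = "sqrt (real n)" and ?J = "\<Sum>k=0..Suc n. (residual (x \<omega>) (Suc n) k)\<^sup>2"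
      let ?N = "\<Sum>k<n. V (k + 2) \<omega> * (X_rest k \<omega> - \<theta> * X_rest (k + 1) \<omega>)"
      let ?R = "\<Sum>k<n. V (k + 2) \<omega> * X_rest (k + 1) \<omega>"
      have s: "?s \<noteq> 0" using elim by simp
      have "x \<omega> k = X_rest k \<omega> + d k" for k
        by (simp add: x_def d_def)
      then have N: "(\<Sum>k<n. V (k + 2) \<omega> * (x \<omega> k - \<theta> * x \<omega> (k + 1))) = ?N + (D0 n - \<theta> * D1 n)"
        and R: "(\<Sum>k<n. V (k + 2) \<omega> * x \<omega> (k + 1)) = ?R + D1 n"
        unfolding D0_def D1_def sum_distrib_left sum_subtractf[symmetric] sum.distrib[symmetric]
        by (auto intro!: sum.cong simp: algebra_simps)
      have "sqrt (Suc n) / ?J = a n \<omega> / ?s"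
        using s by (simp add: a_def)
      with statistic_decomposition[OF \<rho> elim(3,2) elim(1)[unfolded h_def]]
      have "root_statistic (Suc n) \<omega> = a n \<omega> / ?s * ((?N + (D0 n - \<theta> * D1 n)) + (\<theta> - q n \<omega>) * (?R + D1 n)
          - q n \<omega> * c - ((x \<omega> 0)\<^sup>2 + (e n \<omega>)\<^sup>2) / (2 * h n \<omega>))"
        unfolding root_statistic_def h_def q_def e_def c_def x_def N[unfolded x_def] R[unfolded x_def] by (simp only:)
      moreover have "A * (D + y * D' - z - u / w) * (1 / m) = A / m * (P + D + y * (P' + D') - z - (u + f) / w)
          - (A * (P / m) + A * y * (P' / m) - A / (w * m) * f)" for A D y D' z u w m P P' f :: real
        by (simp add: divide_inverse algebra_simps)
      ultimately show ?case
        unfolding score_def score_lag1_def by (simp only:)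
    qed
    from Lim_transform_eventually[OF lim this] show ?case .
  qed
qed

text \<open>
  Besides the remainder of the expansion, the difference consists of three products of a factor
  that tends to zero almost surely and a tight one:
  \<open>a - 1 / \<sigma>\<^sup>2\<close> with \<open>score\<close>, \<open>\<theta> - q\<close> with \<open>score_lag1\<close>, and \<open>1 / sqrt n\<close> with the squared last
  residual.
\<close>

lemma root_statistic_approx:
  assumes \<rho>: "\<rho> = 0" and \<theta>: "\<theta> \<noteq> 0"
  shows "vanishes_in_prob (\<lambda>n \<omega>. root_statistic (Suc n) \<omega> - score n \<omega> / \<sigma>\<^sup>2)"
proof -
  define h where "h n \<omega> = lse (\<lambda>k. X k \<omega>) (Suc n)" for n \<omega>
  define q where "q n \<omega> = lag_sum (\<lambda>k. X k \<omega>) 1 n / lag_sum (\<lambda>k. X k \<omega>) 0 (Suc n)" for n \<omega>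
  define a where "a n \<omega> = sqrt (Suc n) * sqrt n / (\<Sum>k=0..Suc n. (residual (\<lambda>k. X k \<omega>) (Suc n) k)\<^sup>2)" for n \<omega>
  define e where "e n \<omega> = residual (\<lambda>k. X k \<omega>) (Suc n) (Suc n)" for n \<omega>
  define rem where "rem n \<omega> = root_statistic (Suc n) \<omega> - (a n \<omega> * score n \<omega> + a n \<omega> * (\<theta> - q n \<omega>) * score_lag1 n \<omega>
           - a n \<omega> / (2 * h n \<omega> * sqrt n) * (e n \<omega>)\<^sup>2)" for n \<omega>
  have [measurable]: "h n \<in> borel_measurable M" "q n \<in> borel_measurable M" "a n \<in> borel_measurable M"
    "e n \<in> borel_measurable M" for n
    unfolding h_def[abs_def] q_def[abs_def] a_def[abs_def] e_def[abs_def] by measurable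
  have [measurable]: "rem n \<in> borel_measurable M" for n
    unfolding rem_def[abs_def] by measurable
  have lims: "AE \<omega> in M. (\<lambda>n. a n \<omega>) \<longlonglongrightarrow> 1 / \<sigma>\<^sup>2" "AE \<omega> in M. (\<lambda>n. q n \<omega>) \<longlonglongrightarrow> \<theta>"
    "AE \<omega> in M. (\<lambda>n. h n \<omega>) \<longlonglongrightarrow> \<theta>" "AE \<omega> in M. (\<lambda>n. rem n \<omega>) \<longlonglongrightarrow> 0"
    unfolding rem_def a_def q_def h_def e_def by (rule root_statistic_expansion[OF \<rho> \<theta>])+
  have tight: "tight_seq score" "tight_seq score_lag1"
    unfolding score_def[abs_def] score_lag1_def[abs_def]
    by (intro tight_normalised_martingale score_weight_past score_weight_fourth_moment X_rest_past
        bounded_fourth_moment_shift[OF X_rest_fourth_moment]; simp)+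
  have "vanishes_in_prob (\<lambda>n \<omega>. (a n \<omega> - 1 / \<sigma>\<^sup>2) * score n \<omega>)"
  proof (rule vanishes_in_prob_mult_tight[OF vanishes_in_prob_if_AE tight(1)])
    show "AE \<omega> in M. (\<lambda>n. a n \<omega> - 1 / \<sigma>\<^sup>2) \<longlonglongrightarrow> 0"
      using lims(1) by eventually_elim (simp add: LIM_zero)
  qed measurable
  moreover have "vanishes_in_prob (\<lambda>n \<omega>. (a n \<omega> * (\<theta> - q n \<omega>)) * score_lag1 n \<omega>)"
  proof (rule vanishes_in_prob_mult_tight[OF vanishes_in_prob_if_AE tight(2)])
    show "AE \<omega> in M. (\<lambda>n. a n \<omega> * (\<theta> - q n \<omega>)) \<longlonglongrightarrow> 0"
      using lims(1,2)
    proof eventually_elim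
      case (elim \<omega>)
      from tendsto_mult[OF elim(1) tendsto_diff[OF tendsto_const[of \<theta>] elim(2)]] show ?case by simp
    qed
  qed measurable
  moreover have "vanishes_in_prob (\<lambda>n \<omega>. (- (a n \<omega> / (2 * h n \<omega> * sqrt n))) * (e n \<omega> * e n \<omega>))"
  proof (rule vanishes_in_prob_mult_tight[OF vanishes_in_prob_if_AE])
    have "tight_seq e"
      unfolding e_def[abs_def] by (rule tight_last_residual[OF \<rho>])
    then show "tight_seq (\<lambda>n \<omega>. e n \<omega> * e n \<omega>)"
      by (intro tight_seq_mult)
    show "AE \<omega> in M. (\<lambda>n. - (a n \<omega> / (2 * h n \<omega> * sqrt n))) \<longlonglongrightarrow> 0"
      using lims(1,3)
    proof eventually_elim
      case (elim \<omega>)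
      have "(\<lambda>n. - (a n \<omega> / (2 * h n \<omega>)) * (1 / sqrt (real n))) \<longlonglongrightarrow> - (1 / \<sigma>\<^sup>2 / (2 * \<theta>)) * 0"
      proof (intro tendsto_intros elim)
        show "(\<lambda>n. 1 / sqrt (real n)) \<longlonglongrightarrow> 0" by real_asymp
      qed (use \<theta> in simp)
      then show ?case by simp
    qed
  qed measurable
  moreover have "vanishes_in_prob rem"
    by (rule vanishes_in_prob_if_AE[OF _ lims(4)]) measurable
  ultimately have "vanishes_in_prob (\<lambda>n \<omega>. (a n \<omega> - 1 / \<sigma>\<^sup>2) * score n \<omega> +
      ((a n \<omega> * (\<theta> - q n \<omega>)) * score_lag1 n \<omega> + ((- (a n \<omega> / (2 * h n \<omega> * sqrt n))) * (e n \<omega> * e n \<omega>) + rem n \<omega>)))"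
    by (intro vanishes_in_prob_add)
  also have "(\<lambda>n \<omega>. (a n \<omega> - 1 / \<sigma>\<^sup>2) * score n \<omega> +
      ((a n \<omega> * (\<theta> - q n \<omega>)) * score_lag1 n \<omega> + ((- (a n \<omega> / (2 * h n \<omega> * sqrt n))) * (e n \<omega> * e n \<omega>) + rem n \<omega>)))
    = (\<lambda>n \<omega>. root_statistic (Suc n) \<omega> - score n \<omega> / \<sigma>\<^sup>2)"
    by (simp add: rem_def power2_eq_square left_diff_distrib)
  finally show ?thesis .
qed

theorem root_statistic_weak_conv:
  assumes \<rho>: "\<rho> = 0" and \<theta>: "\<theta> \<noteq> 0"
  shows "weak_conv_m (\<lambda>n. distr M borel (root_statistic n)) std_normal_distribution"
proof (rule levy_continuity)
  show "real_distribution (distr M borel (root_statistic n))" for n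
    by (rule real_distribution_distr) measurable
  show "real_distribution std_normal_distribution"
    by (rule real_dist_normal_dist)
  fix t
  have "(\<lambda>n. expectation (\<lambda>\<omega>. iexp (t * root_statistic (Suc n) \<omega>))) \<longlonglongrightarrow> exp (- (t\<^sup>2) / 2)"
    by (rule char_tendsto_if_vanishing_difference[OF _ _ root_statistic_approx[OF \<rho> \<theta>] score_char_tendsto[OF \<rho>]])
      measurable
  then have "(\<lambda>n. expectation (\<lambda>\<omega>. iexp (t * root_statistic n \<omega>))) \<longlonglongrightarrow> exp (- (t\<^sup>2) / 2)"
    by (rule LIMSEQ_imp_Suc)
  moreover have "char (distr M borel (root_statistic n)) t = expectation (\<lambda>\<omega>. iexp (t * root_statistic n \<omega>))" for n
    unfolding char_def by (rule integral_distr) measurable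
  ultimately show "(\<lambda>n. char (distr M borel (root_statistic n)) t) \<longlonglongrightarrow> char std_normal_distribution t"
    by (simp add: char_std_normal_distribution)
qed

theorem statistic_weak_conv:
  assumes "\<rho> = 0" and "\<theta> \<noteq> 0"
  shows "weak_conv_m (\<lambda>n. distr M borel (\<lambda>\<omega>. real n / (4 * (lse (\<lambda>k. X k \<omega>) n)\<^sup>2)
      * (durbin_watson (\<lambda>k. X k \<omega>) n - 2)\<^sup>2)) (chi_square 1)"
proof -
  have "weak_conv_m (\<lambda>n. distr (distr M borel (root_statistic n)) borel (\<lambda>x. x\<^sup>2))
      (distr std_normal_distribution borel (\<lambda>x. x\<^sup>2))"
  proof (rule weak_conv_m_continuous_image[OF _ real_dist_normal_dist root_statistic_weak_conv[OF assms]])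
    show "real_distribution (distr M borel (root_statistic n))" for n
      by (rule real_distribution_distr) measurable
  qed (intro continuous_intros)
  moreover have "distr (distr M borel (root_statistic n)) borel (\<lambda>x. x\<^sup>2) =
      distr M borel (\<lambda>\<omega>. real n / (4 * (lse (\<lambda>k. X k \<omega>) n)\<^sup>2) * (durbin_watson (\<lambda>k. X k \<omega>) n - 2)\<^sup>2)" for n
    by (subst distr_distr) (simp_all add: comp_def root_statistic_sq)
  ultimately show ?thesis
    unfolding chi_square_1 by (simp only:)
qed

end

theorem theorem4p6:
  fixes M :: "'a measure"
    and \<theta> \<rho> \<sigma> :: real
    and V X \<epsilon> :: "nat \<Rightarrow> 'a \<Rightarrow> real"
  assumes "prob_space M"
    and "\<bar>\<theta>\<bar> < 1" and "\<bar>\<rho>\<bar> < 1"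
    and "prob_space.indep_vars M (\<lambda>_. borel) V {1..}"
    and "\<And>n. n \<ge> 1 \<Longrightarrow> distr M borel (V n) = distr M borel (V 1)"
    and "\<And>n. n \<ge> 1 \<Longrightarrow> prob_space.expectation M (V n) = 0"
    and "\<And>n. n \<ge> 1 \<Longrightarrow> prob_space.variance M (V n) = \<sigma>\<^sup>2"
    and "\<sigma>\<^sup>2 > 0"
    and "\<And>n. n \<ge> 1 \<Longrightarrow> integrable M (\<lambda>\<omega>. (V n \<omega>) ^ 4)"
    and "X 0 \<in> borel_measurable M" and "\<epsilon> 0 \<in> borel_measurable M"
    and "\<And>n \<omega>. n \<ge> 1 \<Longrightarrow> \<omega> \<in> space M \<Longrightarrow> X n \<omega> = \<theta> * X (n - 1) \<omega> + \<epsilon> n \<omega>"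
    and "\<And>n \<omega>. n \<ge> 1 \<Longrightarrow> \<omega> \<in> space M \<Longrightarrow> \<epsilon> n \<omega> = \<rho> * \<epsilon> (n - 1) \<omega> + V n \<omega>"
    and "\<theta> \<noteq> 0" and "\<theta> \<noteq> - \<rho>"
  shows
    "(\<rho> = 0 \<longrightarrow>
        weak_conv_m
          (\<lambda>n. distr M borel (\<lambda>\<omega>. real n / (4 * (lse (\<lambda>k. X k \<omega>) n)\<^sup>2)
                                     * (durbin_watson (\<lambda>k. X k \<omega>) n - 2)\<^sup>2))
          (chi_square 1)) \<and>
     (\<rho> \<noteq> 0 \<longrightarrow>
        (AE \<omega> in M.
          filterlim (\<lambda>n. real n / (4 * (lse (\<lambda>k. X k \<omega>) n)\<^sup>2)
                           * (durbin_watson (\<lambda>k. X k \<omega>) n - 2)\<^sup>2) at_top sequentially))"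
proof -
  interpret prob_space M by fact
  interpret autoregression M V \<sigma> X \<epsilon> \<theta> \<rho>
  proof
    show "X (Suc n) \<omega> = \<theta> * X n \<omega> + \<epsilon> (Suc n) \<omega>" if "\<omega> \<in> space M" for n \<omega>
      using assms(12)[of "Suc n" \<omega>] that by simp
    show "\<epsilon> (Suc n) \<omega> = \<rho> * \<epsilon> n \<omega> + V (Suc n) \<omega>" if "\<omega> \<in> space M" for n \<omega>
      using assms(13)[of "Suc n" \<omega>] that by simp
  qed (fact assms)+
  show ?thesis
    using statistic_weak_conv statistic_diverges_AE assms(14,15) by blast
qed

end
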